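(* Let $0<q<1$, let $g_0,g_1,g_2,\dots$ be admissible functions and let $\mathcal Z_0$ be an arbitrary Borel probability measure on $\mathcal N$. Let $\mathcal Z_N(t)$, $t=0,1,2,\dots$, be the discrete time Markov chain on $\mathbb{GT}_N$ with initial distribution $E_q(\mathcal Z_0)_N$ and transition probabilities $P_N(\,\cdot\,;g_t)$ from time $t$ to $t+1$, and let $\mathcal Z(t)$ be the discrete time Markov process on $\mathcal N$ with initial distribution $\mathcal Z_0$ and transition kernel $P_\infty(\,\cdot\,,\,\cdot\,;g_t)$ from time $t$ to $t+1$. Then, as $N\to\infty$, the correlation functions of $\mathcal Z_N(t)$ converge pointwise to the correlation functions of $\mathcal Z(t)$: for every $n\ge1$ and all distinct pairs $(x_1,t_1),\dots,(x_n,t_n)\in\mathbb Z\times\mathbb Z_{\ge0}$ the probability that $x_j$ belongs to the point configuration of $\mathcal Z_N(t_j)$ for every $j=1,\dots,n$ converges to the probability that $x_j$ belongs to the point configuration of $\mathcal Z(t_j)$ for every $j=1,\dots,n$.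
   Context: Fix $0<q<1$ and put $\xi_i=q^{1-i}$. $\mathbb{GT}_N=\{\lambda=(\lambda_1\ge\dots\ge\lambda_N):\lambda_i\in\mathbb Z\}$, $\mathbb{GT}_0=\{\varnothing\}$, $|\lambda|=\sum_i\lambda_i$; $s_\lambda(x_1,\dots,x_N)=\det[x_i^{\lambda_j+N-j}]_{i,j=1}^N/\prod_{i<j}(x_i-x_j)$. An admissible function is a finite product of functions of the types $x$, $x^{-1}$, $1+\beta x$, $1+\beta x^{-1}$ ($\beta>0$), $e^{\gamma x}$, $e^{\gamma x^{-1}}$ ($\gamma>0$), $(1-\alpha x^{-1})^{-1}$ ($0<\alpha<1$). If $g(x)=\sum_{k\in\mathbb Z}c_kx^k$ is its Laurent expansion for $1\le|x|<\infty$, define the stochastic matrix on $\mathbb{GT}_N$ $$P_N(\lambda\to\mu;g)=\Big(\prod_{i=1}^N\frac1{g(q^{1-i})}\Big)\det_{i,j=1,\dots,N}\big[c_{\mu_i-i-\lambda_j+j}\big]\frac{s_\mu(1,\dots,q^{1-N})}{s_\lambda(1,\dots,q^{1-N})}.$$ Links: $P_N^\downarrow(\lambda\to\mu)=q^{(1-N)(|\lambda|-|\mu|)}s_\mu(1,\dots,q^{2-N})/s_\lambda(1,\dots,q^{1-N})$ for $\lambda\in\mathbb{GT}_N,\mu\in\mathbb{GT}_{N-1}$ with $\lambda_1\ge\mu_1\ge\lambda_2\ge\dots\ge\mu_{N-1}\ge\lambda_N$, and $0$ otherwise. A coherent system is a sequence $(M_N)_{N\ge0}$ of probability measures $M_N$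 on $\mathbb{GT}_N$ with $M_{N-1}(\mu)=\sum_\lambda M_N(\lambda)P_N^\downarrow(\lambda\to\mu)$ for all $N\ge1$. The matrices $P_N(\cdot;g)$ commute with the links, so they map coherent systems to coherent systems. $\mathcal N=\{\nu_1\le\nu_2\le\dots:\nu_i\in\mathbb Z\}$ with the topology of coordinate-wise convergence. Known background: for $\nu\in\mathcal N$ the limits $\mathcal E^\nu_N(\mu)=\lim_{M\to\infty}(P_M^\downarrow P_{M-1}^\downarrow\cdots P_{N+1}^\downarrow)((\nu_M,\dots,\nu_1)\to\mu)$ exist and $(\mathcal E^\nu_N)_{N\ge 0}$ is a coherent system; the map $\pi\mapsto E_q(\pi)$, $E_q(\pi)_N=\int_{\mathcal N}\mathcal E^\nu_N\,\pi(d\nu)$, is a bijection from Borel probability measures on $\mathcal N$ to coherent systems; and under $\mathcal E_N^\nu$, $\lambda_{N-k+1}\to\nu_k$ in probability as $N\to\infty$ for each $k\ge1$. The Markov kernel $P_\infty(u,\,\cdot\,;g)$ on $\mathcal N$: for $u\in\mathcal N$ it is the unique probability measure $\pi$ on $\mathcal N$ with $E_q(\pi)_N(\mu)=\sum_\lambda\mathcal E^u_N(\lambda)P_N(\lambda\to\mu;g)$ for all $N$ and $\mu\in\mathbb{GT}_N$. Point configurations: $\lambda\in\mathbb{GT}_N$ is identified with the $N$-point subset $\{\lambda_i+N-i:1\le i\le N\}\subset\mathbb Z$, and $\nu\in\mathcal N$ with the subset $\{\nu_i+i-1:i\ge1\}\subset\mathbb Z$. *)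

theory Defs
  imports "HOL-Probability.Probability" "Jordan_Normal_Form.Determinant"
begin

text \<open>A signature of length \<open>N\<close> is a weakly decreasing list, \<open>lam\<^sub>i\<close> being \<open>lam ! (i - 1)\<close>.  All
  indices below are shifted to start from \<open>0\<close>.\<close>

definition GT_sigs :: "nat \<Rightarrow> int list set" where
  "GT_sigs N = {lam. length lam = N \<and> sorted_wrt (\<ge>) lam}"

definition schur_fun :: "int list \<Rightarrow> real list \<Rightarrow> real" where
  "schur_fun lam xs = (let N = length xs in
     Determinant.det (mat N N (\<lambda>(i, j). (xs ! i) powi (lam ! j + int N - 1 - int j)))
     / (\<Prod>j<N. \<Prod>i<j. xs ! i - xs ! j))"

text \<open>The variables \<open>(1, q\<^sup>-\<^sup>1, \<dots>, q\<^sup>1\<^sup>-\<^sup>N)\<close>.\<close>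

definition qvars :: "real \<Rightarrow> nat \<Rightarrow> real list" where
  "qvars q N = map (\<lambda>i. q powi (- int i)) [0..<N]"

inductive elementary_admissible :: "(complex \<Rightarrow> complex) \<Rightarrow> bool" where
  "elementary_admissible (\<lambda>x. x)"
| "elementary_admissible (\<lambda>x. inverse x)"
| "\<beta> > 0 \<Longrightarrow> elementary_admissible (\<lambda>x. 1 + complex_of_real \<beta> * x)"
| "\<beta> > 0 \<Longrightarrow> elementary_admissible (\<lambda>x. 1 + complex_of_real \<beta> * inverse x)"
| "\<gamma> > 0 \<Longrightarrow> elementary_admissible (\<lambda>x. exp (complex_of_real \<gamma> * x))"
| "\<gamma> > 0 \<Longrightarrow> elementary_admissible (\<lambda>x. exp (complex_of_real \<gamma> * inverse x))"
| "0 < \<alpha> \<Longrightarrow> \<alpha> < 1 \<Longrightarrow> elementary_admissible (\<lambda>x. inverse (1 - complex_of_real \<alpha> * inverse x))"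

definition admissible :: "(complex \<Rightarrow> complex) \<Rightarrow> bool" where
  "admissible g \<longleftrightarrow>
     (\<exists>fs. (\<forall>f\<in>set fs. elementary_admissible f) \<and> g = (\<lambda>x. \<Prod>f\<leftarrow>fs. f x))"

text \<open>Coefficients of the Laurent expansion for \<open>1 \<le> \<bar>x\<bar> < \<infinity>\<close>; they are real for admissible
  functions, and such a \<open>g\<close> also takes real values at real arguments.\<close>

definition laurent_coeff :: "(complex \<Rightarrow> complex) \<Rightarrow> int \<Rightarrow> real" where
  "laurent_coeff g = (THE c. \<forall>x. 1 \<le> norm x \<longrightarrow>
     ((\<lambda>k. complex_of_real (c k) * x powi k) has_sum g x) UNIV)"

definition P_fin :: "real \<Rightarrow> nat \<Rightarrow> (complex \<Rightarrow> complex) \<Rightarrow> int list \<Rightarrow> int list \<Rightarrow> real" where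
  "P_fin q N g lam \<mu> =
     (\<Prod>i<N. 1 / Re (g (complex_of_real (q powi (- int i)))))
     * Determinant.det (mat N N (\<lambda>(i, j). laurent_coeff g (\<mu> ! i - int i - lam ! j + int j)))
     * (schur_fun \<mu> (qvars q N) / schur_fun lam (qvars q N))"

definition interlaces :: "int list \<Rightarrow> int list \<Rightarrow> bool" where
  "interlaces \<mu> lam \<longleftrightarrow> length lam = Suc (length \<mu>) \<and>
     (\<forall>i<length \<mu>. lam ! i \<ge> \<mu> ! i \<and> \<mu> ! i \<ge> lam ! Suc i)"

text \<open>\<open>P_down q N\<close> is the link from \<open>GT_sigs N\<close> to \<open>GT_sigs (N - 1)\<close>.\<close>

definition P_down :: "real \<Rightarrow> nat \<Rightarrow> int list \<Rightarrow> int list \<Rightarrow> real" where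
  "P_down q N lam \<mu> = (if interlaces \<mu> lam
     then q powi ((1 - int N) * (sum_list lam - sum_list \<mu>))
       * schur_fun \<mu> (qvars q (N - 1)) / schur_fun lam (qvars q N)
     else 0)"

text \<open>\<open>P_downs q N d\<close> is the matrix product of the links from level \<open>N + d\<close> down to level \<open>N\<close>.  Each
  sum has only finitely many nonzero terms.\<close>

primrec P_downs :: "real \<Rightarrow> nat \<Rightarrow> nat \<Rightarrow> int list \<Rightarrow> int list \<Rightarrow> real" where
  "P_downs q N 0 lam \<mu> = (if lam = \<mu> then 1 else 0)"
| "P_downs q N (Suc d) lam \<mu> =
     (\<Sum>\<^sub>\<infinity>\<kappa>\<in>GT_sigs (N + d). P_down q (N + Suc d) lam \<kappa> * P_downs q N d \<kappa> \<mu>)"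

text \<open>The space of weakly increasing integer sequences (\<open>\<nu>\<^sub>i\<close> being \<open>\<nu> (i - 1)\<close>) with its Borel
  sigma-algebra; \<open>borel\<close> on \<open>nat \<Rightarrow> int\<close> refers to the product of the discrete topologies, that is,
  to coordinatewise convergence.\<close>

definition NN :: "(nat \<Rightarrow> int) measure" where
  "NN = restrict_space borel {\<nu>. mono \<nu>}"

text \<open>The limit over \<open>M = N + d\<close>; the list is \<open>(\<nu>\<^sub>M, \<dots>, \<nu>\<^sub>1)\<close>.\<close>

definition Ecal :: "real \<Rightarrow> (nat \<Rightarrow> int) \<Rightarrow> nat \<Rightarrow> int list \<Rightarrow> real" where
  "Ecal q \<nu> N \<mu> = lim (\<lambda>d. P_downs q N d (rev (map \<nu> [0..<N + d])) \<mu>)"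

definition E_q :: "real \<Rightarrow> (nat \<Rightarrow> int) measure \<Rightarrow> nat \<Rightarrow> int list \<Rightarrow> real" where
  "E_q q \<pi> N \<mu> = (\<integral>\<nu>. Ecal q \<nu> N \<mu> \<partial>\<pi>)"

text \<open>The defining property of \<open>P_inf q g u\<close>, where \<open>space (prob_algebra NN)\<close> is the set of Borel
  probability measures.  A definite description needs some value where it fails to denote; the null
  measure is chosen there because it cannot be mistaken for a probability measure.\<close>

definition is_P_inf ::
  "real \<Rightarrow> (complex \<Rightarrow> complex) \<Rightarrow> (nat \<Rightarrow> int) \<Rightarrow> (nat \<Rightarrow> int) measure \<Rightarrow> bool" where
  "is_P_inf q g u \<pi> \<longleftrightarrow> \<pi> \<in> space (prob_algebra NN) \<and>
     (\<forall>N. \<forall>\<mu>\<in>GT_sigs N. E_q q \<pi> N \<mu> = (\<Sum>\<^sub>\<infinity>lam\<in>GT_sigs N. Ecal q u N lam * P_fin q N g lam \<mu>))"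

definition P_inf ::
  "real \<Rightarrow> (complex \<Rightarrow> complex) \<Rightarrow> (nat \<Rightarrow> int) \<Rightarrow> (nat \<Rightarrow> int) measure" where
  "P_inf q g u =
     (if \<exists>!\<pi>. is_P_inf q g u \<pi> then THE \<pi>. is_P_inf q g u \<pi> else null_measure NN)"

text \<open>\<open>X\<close>, defined on \<open>\<Omega>\<close>, is a (time-inhomogeneous) Markov process with state space \<open>S\<close>, initial
  distribution \<open>init\<close> and Markov kernel \<open>K t\<close> from time \<open>t\<close> to \<open>t + 1\<close>.  The Markov property is
  stated for cylinder events of the past, which determine the conditional distribution.\<close>

definition markov_process ::
  "'w measure \<Rightarrow> 's measure \<Rightarrow> 's measure \<Rightarrow> (nat \<Rightarrow> 's \<Rightarrow> 's measure) \<Rightarrow> (nat \<Rightarrow> 'w \<Rightarrow> 's) \<Rightarrow> bool"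
where
  "markov_process \<Omega> S init K X \<longleftrightarrow>
     prob_space \<Omega> \<and>
     (\<forall>t. X t \<in> \<Omega> \<rightarrow>\<^sub>M S) \<and>
     (\<forall>t. K t \<in> S \<rightarrow>\<^sub>M prob_algebra S) \<and>
     distr \<Omega> S (X 0) = init \<and>
     (\<forall>t A. \<forall>B\<in>sets S. (\<forall>s\<le>t. A s \<in> sets S) \<longrightarrow>
        emeasure \<Omega> {\<omega>\<in>space \<Omega>. (\<forall>s\<le>t. X s \<omega> \<in> A s) \<and> X (Suc t) \<omega> \<in> B}
        = (\<integral>\<^sup>+\<omega>\<in>{\<omega>\<in>space \<Omega>. \<forall>s\<le>t. X s \<omega> \<in> A s}. emeasure (K t (X t \<omega>)) B \<partial>\<Omega>))"

text \<open>The measure on \<open>GT_sigs N\<close>, with all subsets measurable, that has the weights \<open>p\<close>.\<close>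

definition GT_measure :: "nat \<Rightarrow> (int list \<Rightarrow> real) \<Rightarrow> int list measure" where
  "GT_measure N p = point_measure (GT_sigs N) (\<lambda>\<mu>. ennreal (p \<mu>))"

definition config_GT :: "int list \<Rightarrow> int set" where
  "config_GT lam = {lam ! i + int (length lam) - 1 - int i | i. i < length lam}"

definition config_NN :: "(nat \<Rightarrow> int) \<Rightarrow> int set" where
  "config_NN \<nu> = {\<nu> i + int i | i. True}"

text \<open>The \<open>n\<close>-th correlation function of the process \<open>X\<close>, with \<open>conf\<close> sending a state to its point
  configuration, at the space-time points \<open>(x 1, t 1), \<dots>, (x n, t n)\<close>.\<close>

definition correlation ::
  "'w measure \<Rightarrow> ('s \<Rightarrow> int set) \<Rightarrow> (nat \<Rightarrow> 'w \<Rightarrow> 's) \<Rightarrow> nat \<Rightarrow> (nat \<Rightarrow> int) \<Rightarrow> (nat \<Rightarrow> nat) \<Rightarrow> real"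
where
  "correlation \<Omega> conf X n x t =
     measure \<Omega> {\<omega>\<in>space \<Omega>. \<forall>j\<in>{1..n}. x j \<in> conf (X (t j) \<omega>)}"

end

theory Submission
  imports Defs
begin

text \<open>
  The specialized Schur functions are Vandermonde products in \<open>q\<close> to the powers \<open>- (\<lambda>\<^sub>i + N - i)\<close>, so the links
  are explicit: raising the coordinate of rank \<open>s + 1\<close> from the bottom of a signature of length \<open>n\<close> by
  \<open>y\<close> costs a factor of order \<open>q^((n - s) y)\<close>.  Hence the links from any level down to level \<open>M\<close> leave
  the bottom \<open>k\<close> coordinates unchanged with probability at least \<open>exp (- c q^(M - k))\<close>, uniformly in the
  starting point.  This lower bound is positive even for \<open>k = M\<close>, so a Doeblin argument shows that the
  image on a fixed level depends, in the limit, only on the bottom coordinates; this yields existence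
  and continuity of the boundary measures \<open>Ecal\<close>.

  That \<open>P_inf\<close> is a Markov kernel means that the measures \<open>Ecal q u N\<close> pushed forward by \<open>P_N\<close> form a coherent
  system for every \<open>u\<close>.  Since the boundary measures separate functions on each level, \<open>P_N\<close> commutes
  with the links.  Projecting to a fixed level, one sees that \<open>P_N(\<lambda>, \<cdot>)\<close> converges to \<open>P_inf(u, \<cdot>)\<close> on
  bottom coordinates whenever \<open>\<lambda>\<close> converges to \<open>u\<close>.  This continuous convergence is stable under
  composition of kernels, and so gives convergence of the multi-time probabilities.
\<close>

section \<open>Determinants\<close>

text \<open>The obstacle is that weak convergence of kernels does not compose: kernel and state
  space both change with \<open>N\<close>, and the function integrated at each time is itself a
  limit. Hence all limits run along the filter \<open>cylinders u\<close>, which mixes signatures of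
  all lengths, and convergence along it at every monotone \<open>u\<close> is the property carried
  through the induction on the number of steps. There is no direct control of a single transition at
  a high level. Commutation with the links replaces it by a transition at a fixed level
  \<open>M\<close>, where applying the kernel cannot increase total variation distance; the price is
  the probability that projection disturbs the bottom coordinates, paid once for the finite
  signature and once for the boundary. The Doeblin step works over several intermediate levels
  because \<open>keep_bound 0\<close> is merely positive: each level contracts the distance by a
  fixed factor and adds an error, and this error is made small by taking the levels far
  apart.\<close>

lemma det_vandermonde:
  fixes x :: "nat \<Rightarrow> 'a :: idom"
  shows "Determinant.det (mat n n (\<lambda>(i, j). x j ^ i)) = (\<Prod>j<n. \<Prod>i<j. x j - x i)"
proof -
  \<comment> \<open>Newton polynomials of the nodes: their coefficient matrix \<open>L\<close> is
    unitriangular, and \<open>L * V\<close> evaluates them at the nodes, which is triangular because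
    \<open>p i\<close> vanishes at \<open>x k\<close> for \<open>k < i\<close>.\<close>
  define p where "p i = (\<Prod>k<i. [:- x k, 1:])" for i
  have deg: "Polynomial.degree (p i) = i \<and> lead_coeff (p i) = 1" for i
  proof (induction i)
    case (Suc i)
    have p: "p (Suc i) = p i * [:- x i, 1:]"
      by (simp add: p_def)
    have "p i \<noteq> 0" using Suc by auto
    then show ?case
      unfolding p using Suc lead_coeff_mult[of "p i" "[:- x i, 1:]"]
      by (subst (asm) Polynomial.degree_mult_eq) (auto simp: Polynomial.degree_mult_eq simp del: mult_pCons_right)
  qed (simp add: p_def)
  have poly_p: "poly (p i) y = (\<Prod>k<i. y - x k)" for i y
    by (simp add: p_def poly_prod)
  define L where "L = mat n n (\<lambda>(i, k). coeff (p i) k)"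
  define V where "V = mat n n (\<lambda>(i, j). x j ^ i)"
  have L: "L \<in> carrier_mat n n" and V: "V \<in> carrier_mat n n"
    by (auto simp: L_def V_def)
  have LV: "L * V = mat n n (\<lambda>(i, j). poly (p i) (x j))"
  proof (rule eq_matI)
    fix i j assume "i < dim_row (mat n n (\<lambda>(i, j). poly (p i) (x j)))"
      "j < dim_col (mat n n (\<lambda>(i, j). poly (p i) (x j)))"
    then have ij: "i < n" "j < n" by auto
    have "poly (p i) (x j) = (\<Sum>k\<le>i. coeff (p i) k * x j ^ k)"
      using deg[of i] by (simp add: poly_altdef)
    also have "\<dots> = (\<Sum>k\<in>{0..<n}. coeff (p i) k * x j ^ k)"
      using ij deg[of i] by (intro sum.mono_neutral_left) (auto simp: coeff_eq_0)
    finally show "(L * V) $$ (i, j) = mat n n (\<lambda>(i, j). poly (p i) (x j)) $$ (i, j)"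
      using ij by (simp add: L_def V_def scalar_prod_def)
  qed (auto simp: L_def V_def)
  have "Determinant.det L = prod_list (diag_mat L)"
    using deg by (intro det_lower_triangular[OF _ L]) (auto simp: L_def coeff_eq_0)
  also have "\<dots> = (\<Prod>i<n. coeff (p i) i)"
    by (simp add: diag_mat_def L_def prod.list_conv_set_nth atLeast0LessThan)
  also have "\<dots> = 1"
    using deg by (intro prod.neutral) (metis lessThan_iff)
  finally have detL: "Determinant.det L = 1" .
  have "Determinant.det (L * V) = prod_list (diag_mat (L * V))"
    unfolding LV
    by (intro det_upper_triangular[of _ n] upper_triangularI)
       (auto simp: poly_p intro!: prod_zero)
  also have "\<dots> = (\<Prod>j<n. \<Prod>i<j. x j - x i)"
    unfolding LV by (simp add: diag_mat_def poly_p prod.list_conv_set_nth atLeast0LessThan)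
  finally show ?thesis
    using det_mult[OF L V] detL by (simp add: V_def)
qed

text \<open>Subtracting from each column its predecessor turns the row of ones into (1, 0, ..., 0),
  and expansion along it leaves the differences. Read backwards, this raises the size of the
  determinant by one when a sum over interlacing signatures of length \<open>n\<close> is expressed
  through a signature of length \<open>n + 1\<close>.\<close>

lemma det_bordered_differences:
  fixes a :: "nat \<Rightarrow> nat \<Rightarrow> 'a :: idom"
  assumes last: "\<And>j. j \<le> n \<Longrightarrow> a n j = 1"
  shows "Determinant.det (mat (Suc n) (Suc n) (\<lambda>(i, j). a i j))
    = (- 1) ^ n * Determinant.det (mat n n (\<lambda>(i, j). a i (Suc j) - a i j))"
proof -
  define A where "A = mat (Suc n) (Suc n) (\<lambda>(i, j). a i j)"
  define U :: "'a mat" where "U = mat (Suc n) (Suc n)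
    (\<lambda>(k, j). if k = j then 1 else if Suc k = j then - 1 else 0)"
  define B where "B = mat (Suc n) (Suc n)
    (\<lambda>(i, j). if j = 0 then a i 0 else a i j - a i (j - 1))"
  have A: "A \<in> carrier_mat (Suc n) (Suc n)" and U: "U \<in> carrier_mat (Suc n) (Suc n)"
    and B: "B \<in> carrier_mat (Suc n) (Suc n)"
    by (auto simp: A_def U_def B_def)
  have AU: "A * U = B"
  proof (rule eq_matI)
    fix i j assume "i < dim_row B" "j < dim_col B"
    then have ij: "i < Suc n" "j < Suc n" by (auto simp: B_def)
    have "(A * U) $$ (i, j) =
        (\<Sum>k\<in>{0..<Suc n}. a i k * (if k = j then 1 else if Suc k = j then - 1 else 0))"
      using ij by (simp add: A_def U_def scalar_prod_def del: sum.op_ivl_Suc)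
    also have "\<dots> = (\<Sum>k\<in>(if j = 0 then {0} else {j - 1, j}).
        a i k * (if k = j then 1 else if Suc k = j then - 1 else 0))"
      using ij by (intro sum.mono_neutral_right) auto
    also have "\<dots> = B $$ (i, j)"
      using ij by (auto simp: B_def)
    finally show "(A * U) $$ (i, j) = B $$ (i, j)" .
  qed (auto simp: A_def U_def B_def)
  have "Determinant.det U = prod_list (diag_mat U)"
    by (intro det_upper_triangular[OF _ U] upper_triangularI) (auto simp: U_def)
  also have "\<dots> = 1"
    by (auto simp: diag_mat_def U_def prod.list_conv_set_nth intro!: prod.neutral simp del: upt_Suc)
  finally have "Determinant.det A = Determinant.det B"
    using det_mult[OF A U] AU by simp
  also have "\<dots> = (\<Sum>j<Suc n. B $$ (n, j) * cofactor B n j)"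
    by (rule laplace_expansion_row[OF B]) simp
  also have "\<dots> = (\<Sum>j\<in>{0}. B $$ (n, j) * cofactor B n j)"
    using last by (intro sum.mono_neutral_right) (auto simp: B_def)
  also have "\<dots> = cofactor B n 0"
    using last[of 0] by (simp add: B_def)
  also have "\<dots> = (- 1) ^ n * Determinant.det (mat n n (\<lambda>(i, j). a i (Suc j) - a i j))"
    unfolding cofactor_def mat_delete_def
    by (auto simp: B_def intro!: arg_cong[where f = Determinant.det])
  finally show ?thesis by (simp add: A_def)
qed

lemma det_mat_leibniz:
  "Determinant.det (mat n n (\<lambda>(i, j). h i j)) =
    (\<Sum>p | p permutes {0..<n}. signof p * (\<Prod>j<n. h (p j) j :: 'a :: comm_ring_1))"
  by (subst det_col[of _ n])
     (auto intro!: sum.cong prod.cong arg_cong[where f = "\<lambda>x. _ * x"]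
        dest: permutes_in_image[of _ _ "_ :: nat"])

text \<open>Multilinearity: \<open>y j\<close> enters column \<open>j\<close> only, so the sum over
  independent choices factorizes in every term of the Leibniz formula.\<close>

lemma det_sum_columns:
  fixes f :: "nat \<Rightarrow> nat \<Rightarrow> 'b \<Rightarrow> 'a :: comm_ring_1"
  assumes "\<And>j. j < n \<Longrightarrow> finite (S j)"
  shows "(\<Sum>y\<in>PiE {..<n} S. Determinant.det (mat n n (\<lambda>(i, j). f i j (y j))))
    = Determinant.det (mat n n (\<lambda>(i, j). \<Sum>m\<in>S j. f i j m))"
proof -
  have "(\<Sum>y\<in>PiE {..<n} S. Determinant.det (mat n n (\<lambda>(i, j). f i j (y j)))) =
      (\<Sum>p | p permutes {0..<n}. signof p * (\<Sum>y\<in>PiE {..<n} S. \<Prod>j<n. f (p j) j (y j)))"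
    unfolding det_mat_leibniz by (subst sum.swap) (simp add: sum_distrib_left)
  also have "\<dots> = (\<Sum>p | p permutes {0..<n}. signof p * (\<Prod>j<n. \<Sum>m\<in>S j. f (p j) j m))"
    using assms by (subst prod_sum_PiE) (auto simp: prod.distrib)
  finally show ?thesis unfolding det_mat_leibniz .
qed

section \<open>Schur functions at geometric progressions\<close>

lemma det_scale_rows_columns:
  fixes h :: "nat \<Rightarrow> nat \<Rightarrow> 'a :: comm_ring_1"
  shows "Determinant.det (mat n n (\<lambda>(i, j). r i * c j * h i j)) =
    (\<Prod>i<n. r i) * (\<Prod>j<n. c j) * Determinant.det (mat n n (\<lambda>(i, j). h i j))"
proof -
  have "(\<Prod>j<n. r (p j)) = (\<Prod>i<n. r i)" if "p permutes {0..<n}" for p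
    using prod.permute[OF that, of r] by (simp add: atLeast0LessThan o_def)
  then show ?thesis
    unfolding det_mat_leibniz sum_distrib_left
    by (intro sum.cong) (auto simp: prod.distrib mult_ac)
qed

lemma sum_powi_interval:
  fixes q :: real and a b :: int
  assumes q: "0 < q" "q < 1" and k: "k > 0" and ab: "a \<le> b"
  shows "(\<Sum>m\<in>{a..b}. q powi (int k * m)) =
    (q powi (int k * a) - q powi (int k * (b + 1))) / (1 - q ^ k)"
proof -
  have "q ^ k < 1" using q k by (simp add: power_less_one_iff)
  have "(\<Sum>m\<in>{a..b}. q powi (int k * m)) * (1 - q ^ k) =
      q powi (int k * a) - q powi (int k * (b + 1))"
    using ab
  proof (induction b rule: int_ge_induct)
    case base
    show ?case using q by (simp add: algebra_simps power_int_add)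
  next
    case (step b)
    have "q powi (int k * (b + 1 + 1)) = q powi (int k * (b + 1) + int k)"
      by (simp add: algebra_simps)
    also have "\<dots> = q powi (int k * (b + 1)) * q ^ k"
      using q by (subst power_int_add) auto
    finally have eq: "q powi (int k * (b + 1 + 1)) = q powi (int k * (b + 1)) * q ^ k" .
    have "{a..b + 1} = insert (b + 1) {a..b}" using step by auto
    then have "(\<Sum>m\<in>{a..b + 1}. q powi (int k * m)) * (1 - q ^ k) =
        q powi (int k * (b + 1)) * (1 - q ^ k) + (\<Sum>m\<in>{a..b}. q powi (int k * m)) * (1 - q ^ k)"
      by (simp add: distrib_right)
    then show ?case unfolding step eq by (simp add: right_diff_distrib)
  qed
  with \<open>q ^ k < 1\<close> show ?thesis by (simp add: field_simps)
qed

text \<open>Interlacing bounds each coordinate separately, so the range of summation is a box, the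
  shape that \<open>det_sum_columns\<close> handles. The value \<open>undefined\<close> is the one
  that \<open>PiE\<close> prescribes outside the index set.\<close>

lemma sum_interlacing:
  assumes "length lam = Suc n" and "\<And>\<mu>. length \<mu> = n \<Longrightarrow> f \<mu> = g (\<lambda>j. if j < n then \<mu> ! j else undefined)"
  shows "(\<Sum>\<mu> | interlaces \<mu> lam. f \<mu>) = (\<Sum>y\<in>PiE {..<n} (\<lambda>j. {lam ! Suc j..lam ! j}). g y)"
proof (rule sum.reindex_bij_witness[where i = "\<lambda>y. map y [0..<n]"
      and j = "\<lambda>\<mu> j. if j < n then \<mu> ! j else undefined"])
  fix y assume "y \<in> PiE {..<n} (\<lambda>j. {lam ! Suc j..lam ! j})"
  then show "(\<lambda>j. if j < n then map y [0..<n] ! j else undefined) = y"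
    by (auto simp: fun_eq_iff PiE_def extensional_def)
  show "map y [0..<n] \<in> {\<mu>. interlaces \<mu> lam}"
    using \<open>y \<in> _\<close> assms by (auto simp: interlaces_def PiE_iff)
next
  fix \<mu> assume "\<mu> \<in> {\<mu>. interlaces \<mu> lam}"
  then have \<mu>: "length \<mu> = n" "\<And>j. j < n \<Longrightarrow> \<mu> ! j \<in> {lam ! Suc j..lam ! j}"
    using assms by (auto simp: interlaces_def)
  show "map (\<lambda>j. if j < n then \<mu> ! j else undefined) [0..<n] = \<mu>"
    using \<mu> by (auto intro: nth_equalityI)
  show "(\<lambda>j. if j < n then \<mu> ! j else undefined) \<in> PiE {..<n} (\<lambda>j. {lam ! Suc j..lam ! j})"
    using \<mu> by (auto simp: PiE_iff extensional_def)
  show "g (\<lambda>j. if j < n then \<mu> ! j else undefined) = f \<mu>"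
    using assms \<mu> by simp
qed

lemma finite_interlaces: "finite {\<mu>. interlaces \<mu> lam}"
proof (cases "length lam")
  case (Suc n)
  have "{\<mu>. interlaces \<mu> lam} \<subseteq>
      (\<lambda>y. map y [0..<n]) ` PiE {..<n} (\<lambda>j. {lam ! Suc j..lam ! j})"
  proof
    fix \<mu> assume "\<mu> \<in> {\<mu>. interlaces \<mu> lam}"
    then show "\<mu> \<in> (\<lambda>y. map y [0..<n]) ` PiE {..<n} (\<lambda>j. {lam ! Suc j..lam ! j})"
      using Suc by (intro image_eqI[where x = "\<lambda>j\<in>{..<n}. \<mu> ! j"])
        (auto simp: interlaces_def intro!: nth_equalityI)
  qed
  then show ?thesis by (rule finite_subset) (auto intro!: finite_imageI finite_PiE)
qed (simp add: interlaces_def)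

section \<open>Signatures and their particle positions\<close>

lemma GT_sigs_nth_mono: "lam \<in> GT_sigs N \<Longrightarrow> i \<le> j \<Longrightarrow> j < N \<Longrightarrow> lam ! j \<le> lam ! i"
  by (cases "i = j") (auto simp: GT_sigs_def sorted_wrt_iff_nth_less)

lemma GT_sigsI_Suc: "length lam = N \<Longrightarrow> (\<And>i. Suc i < N \<Longrightarrow> lam ! Suc i \<le> lam ! i) \<Longrightarrow> lam \<in> GT_sigs N"
  unfolding GT_sigs_def by (simp add: sorted_wrt_iff_nth_Suc_transp transp_def)

lemma interlaces_GT_sigs: "interlaces \<mu> lam \<Longrightarrow> length lam = Suc n \<Longrightarrow> \<mu> \<in> GT_sigs n"
proof (rule GT_sigsI_Suc)
  assume *: "interlaces \<mu> lam" "length lam = Suc n"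
  then show "length \<mu> = n" by (simp add: interlaces_def)
  fix i assume "Suc i < n"
  then have "\<mu> ! Suc i \<le> lam ! Suc i" "lam ! Suc i \<le> \<mu> ! i"
    using * by (simp_all add: interlaces_def)
  then show "\<mu> ! Suc i \<le> \<mu> ! i" by (rule order.trans)
qed

text \<open>The particle position belonging to a coordinate, and at the same time the exponent in
  the numerator of the Schur function.\<close>

definition gt_point :: "int list \<Rightarrow> nat \<Rightarrow> int" where
  "gt_point lam j = lam ! j + int (length lam) - 1 - int j"

lemma gt_point_strict:
  assumes "lam \<in> GT_sigs N" "i < j" "j < N"
  shows "gt_point lam j + int (j - i) \<le> gt_point lam i"
  using GT_sigs_nth_mono[OF assms(1), of i j] assms by (auto simp: gt_point_def)

locale q_parameter =
  fixes q :: real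
  assumes q_pos: "0 < q" and q_less_1: "q < 1"
begin

definition gt_var :: "int list \<Rightarrow> nat \<Rightarrow> real" where
  "gt_var lam j = q powi (- gt_point lam j)"

text \<open>The differences here and in \<open>vdm_norm\<close> are oriented so that both products
  are positive. Equally many signs are reversed in the numerator and in the denominator of the Schur
  function, so they cancel.\<close>

definition vdm :: "int list \<Rightarrow> real" where
  "vdm lam = (\<Prod>j<length lam. \<Prod>i<j. gt_var lam i - gt_var lam j)"

definition vdm_norm :: "nat \<Rightarrow> real" where
  "vdm_norm N = (\<Prod>j<N. \<Prod>i<j. q powi (- int j) - q powi (- int i))"

lemma gt_var_pos: "gt_var lam j > 0"
  by (simp add: gt_var_def q_pos)

lemma gt_var_less: "lam \<in> GT_sigs N \<Longrightarrow> i < j \<Longrightarrow> j < N \<Longrightarrow> gt_var lam j < gt_var lam i"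
  using gt_point_strict[of lam N i j] q_pos q_less_1 unfolding gt_var_def
  by (intro power_int_strict_decreasing) auto

lemma vdm_pos: "lam \<in> GT_sigs N \<Longrightarrow> vdm lam > 0"
  unfolding vdm_def
  by (intro prod_pos) (auto simp: GT_sigs_def intro!: prod_pos gt_var_less[of _ "length lam"])

lemma vdm_norm_pos: "vdm_norm N > 0"
  unfolding vdm_norm_def using q_pos q_less_1
  by (intro prod_pos) (auto intro!: power_int_strict_decreasing)

lemma det_gt_var:
  "Determinant.det (mat N N (\<lambda>(i, j). gt_var lam j ^ i)) =
    (\<Prod>j<N. \<Prod>i<j. - 1) * (\<Prod>j<N. \<Prod>i<j. gt_var lam i - gt_var lam j)"
  unfolding det_vandermonde prod.distrib[symmetric] by simp

text \<open>Principal specialization: \<open>(q powi (- i)) powi l = (q powi (- l)) ^ i\<close>, so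
  the numerator is a Vandermonde determinant whose nodes belong to the columns.\<close>

lemma schur_fun_qvars:
  assumes "length lam = N"
  shows "schur_fun lam (qvars q N) = vdm lam / vdm_norm N"
proof -
  have "mat N N (\<lambda>(i, j). (qvars q N ! i) powi (lam ! j + int N - 1 - int j))
      = mat N N (\<lambda>(i, j). gt_var lam j ^ i)"
  proof (intro cong_mat refl)
    fix i j assume ij: "i < N" "j < N"
    have "(q powi (- int i)) powi (gt_point lam j) = q powi (- gt_point lam j * int i)"
      by (simp flip: power_int_mult add: mult.commute)
    then show "(\<lambda>(i, j). (qvars q N ! i) powi (lam ! j + int N - 1 - int j)) (i, j) =
        (\<lambda>(i, j). gt_var lam j ^ i) (i, j)"
      using ij assms by (simp add: qvars_def gt_var_def gt_point_def power_int_mult)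
  qed
  moreover have "(\<Prod>j<N. \<Prod>i<j. qvars q N ! i - qvars q N ! j) =
      (\<Prod>j<N. \<Prod>i<j. (- 1) * (q powi (- int j) - q powi (- int i)))"
    by (intro prod.cong) (auto simp: qvars_def)
  moreover have "\<dots> = (\<Prod>j<N. \<Prod>i<j. - 1) * vdm_norm N"
    unfolding vdm_norm_def prod.distrib by simp
  ultimately show ?thesis
    by (simp add: schur_fun_def det_gt_var vdm_def assms qvars_def)
qed

lemma P_down_eq:
  assumes "length lam = Suc n" and "interlaces \<mu> lam"
  shows "P_down q (Suc n) lam \<mu> = q powi (int n * (sum_list \<mu> - sum_list lam)) *
    (vdm \<mu> / vdm_norm n) / (vdm lam / vdm_norm (Suc n))"
  using assms by (auto simp: P_down_def schur_fun_qvars interlaces_def algebra_simps)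

text \<open>The new factors are the constants that come out of the interlacing sum in
  \<open>link_normalization\<close>: one geometric series per row and a power of \<open>q\<close>
  from the columns.\<close>

lemma vdm_norm_Suc:
  "vdm_norm (Suc n) = vdm_norm n * (q powi (- int (n * n)) * (\<Prod>i<n. 1 - q ^ (n - i)))"
proof -
  have "(\<Prod>i<n. q powi (- int n) - q powi (- int i)) = (\<Prod>i<n. q powi (- int n) * (1 - q ^ (n - i)))"
  proof (intro prod.cong refl)
    fix i assume "i \<in> {..<n}"
    then have "q powi (- int i) = q powi (- int n + int (n - i))" by simp
    also have "\<dots> = q powi (- int n) * q ^ (n - i)"
      using q_pos by (subst power_int_add) auto
    finally show "q powi (- int n) - q powi (- int i) = q powi (- int n) * (1 - q ^ (n - i))"
      by (simp add: right_diff_distrib)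
  qed
  also have "\<dots> = q powi (- int (n * n)) * (\<Prod>i<n. 1 - q ^ (n - i))"
  proof -
    have "(q powi (- int n)) ^ n = q powi (- int (n * n))"
      by (simp add: power_int_minus power_inverse power_mult flip: of_nat_mult)
    then show ?thesis by (simp add: prod.distrib del: of_nat_mult)
  qed
  finally show ?thesis by (simp add: vdm_norm_def)
qed

end

section \<open>Stochasticity of the links\<close>

context q_parameter
begin

lemma powi_sum: "finite A \<Longrightarrow> q powi (\<Sum>i\<in>A. f i) = (\<Prod>i\<in>A. q powi f i)"
  by (induction A rule: finite_induct) (use q_pos in \<open>auto simp: power_int_add\<close>)

lemma powi_add: "q powi (a + b) = q powi a * q powi b"
  using q_pos by (simp add: power_int_add)

lemma gt_var_power: "gt_var lam j ^ i = q powi (- int i * gt_point lam j)"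
  by (simp add: gt_var_def power_int_mult mult.commute flip: power_int_of_nat power_int_mult)

text \<open>The branching rule at geometric progressions. Column \<open>j\<close> of the Vandermonde
  determinant of \<mu> depends on \<open>\<mu> ! j\<close> only, so the sum passes into the columns;
  each entry becomes a geometric sum, that is, a difference of values at two neighbouring particles
  of \<open>lam\<close>; and the determinant of these differences is, once bordered, the Vandermonde
  determinant of \<open>lam\<close>.\<close>

lemma link_normalization:
  assumes lam: "length lam = Suc n" "lam \<in> GT_sigs (Suc n)"
  shows "(\<Sum>\<mu> | interlaces \<mu> lam. q powi (int n * sum_list \<mu>) * vdm \<mu>) =
    q powi (int n * sum_list lam) * vdm lam * vdm_norm n / vdm_norm (Suc n)"
proof -
  define D where "D N \<mu> = Determinant.det (mat N N (\<lambda>(i, j). gt_var \<mu> j ^ i))" for N \<mu>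
  define s :: "nat \<Rightarrow> real" where "s N = (\<Prod>j<N. \<Prod>i<j. - 1)" for N
  have D: "D (length \<mu>) \<mu> = s (length \<mu>) * vdm \<mu>" for \<mu>
    unfolding D_def s_def vdm_def by (rule det_gt_var)
  have s_Suc: "s (Suc n) = s n * (- 1) ^ n" by (simp add: s_def)
  have s_nz: "s N \<noteq> 0" for N by (simp add: s_def)
  \<comment> \<open>The extra factor makes row \<open>n\<close> constantly 1, which is the border;
    in a row \<open>i < n\<close> the exponent \<open>n - i\<close> is positive, as the geometric
    sum requires.\<close>
  define a where "a i j = q powi (int n * gt_point lam j) * gt_var lam j ^ i" for i j
  have a_eq: "a i j = q powi (int (n - i) * gt_point lam j)" if "i \<le> n" for i j
    using that by (simp add: a_def gt_var_power of_nat_diff algebra_simps flip: powi_add)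
  \<comment> \<open>Positions in \<mu> are shifted by one against \<open>lam\<close>, which is
    longer: as \<open>m\<close> runs through the closed interval, \<open>m + n - 1 - j\<close> runs
    from \<open>gt_point lam (Suc j)\<close> to just below \<open>gt_point lam j\<close>. Both ends
    of the geometric sum are therefore values of \<open>a\<close>.\<close>
  have entry: "(\<Sum>m\<in>{lam ! Suc j..lam ! j}. q powi (int n * m) * q powi (- int i * (m + int n - 1 - int j))) =
      1 / (1 - q ^ (n - i)) * q powi (- int n * (int n - 1 - int j)) * (a i (Suc j) - a i j)"
    if ij: "i < n" "j < n" for i j
  proof -
    have "(\<Sum>m\<in>{lam ! Suc j..lam ! j}. q powi (int n * m) * q powi (- int i * (m + int n - 1 - int j))) =
        (\<Sum>m\<in>{lam ! Suc j..lam ! j}. q powi (- int i * (int n - 1 - int j)) * q powi (int (n - i) * m))"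
      using ij by (intro sum.cong refl) (simp add: of_nat_diff algebra_simps flip: powi_add)
    also have "\<dots> = q powi (- int i * (int n - 1 - int j)) *
        ((q powi (int (n - i) * lam ! Suc j) - q powi (int (n - i) * (lam ! j + 1))) / (1 - q ^ (n - i)))"
      using ij GT_sigs_nth_mono[OF lam(2), of j "Suc j"] q_pos q_less_1
      by (subst sum_distrib_left[symmetric], subst sum_powi_interval) auto
    also have "\<dots> = 1 / (1 - q ^ (n - i)) *
        (q powi (- int i * (int n - 1 - int j)) * q powi (int (n - i) * lam ! Suc j) -
         q powi (- int i * (int n - 1 - int j)) * q powi (int (n - i) * (lam ! j + 1)))"
      by (simp add: right_diff_distrib diff_divide_distrib)
    also have "q powi (- int i * (int n - 1 - int j)) * q powi (int (n - i) * lam ! Suc j) =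
        q powi (- int n * (int n - 1 - int j)) * a i (Suc j)"
      using ij lam by (simp add: a_eq gt_point_def of_nat_diff algebra_simps flip: powi_add)
    also have "q powi (- int i * (int n - 1 - int j)) * q powi (int (n - i) * (lam ! j + 1)) =
        q powi (- int n * (int n - 1 - int j)) * a i j"
      using ij lam by (simp add: a_eq gt_point_def of_nat_diff algebra_simps flip: powi_add)
    finally show ?thesis by (simp add: right_diff_distrib)
  qed
  have "(\<Sum>\<mu> | interlaces \<mu> lam. q powi (int n * sum_list \<mu>) * D n \<mu>) =
      (\<Sum>y\<in>PiE {..<n} (\<lambda>j. {lam ! Suc j..lam ! j}). Determinant.det (mat n n
        (\<lambda>(i, j). q powi (int n * y j) * q powi (- int i * (y j + int n - 1 - int j)))))"
  proof (rule sum_interlacing[OF lam(1)])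
    fix \<mu> :: "int list" assume \<mu>: "length \<mu> = n"
    have "q powi (int n * sum_list \<mu>) = (\<Prod>j<n. q powi (int n * \<mu> ! j))"
      by (simp add: sum_list_sum_nth \<mu> atLeast0LessThan sum_distrib_left powi_sum)
    then have "q powi (int n * sum_list \<mu>) * D n \<mu> =
        Determinant.det (mat n n (\<lambda>(i, j). 1 * q powi (int n * \<mu> ! j) * gt_var \<mu> j ^ i))"
      unfolding D_def by (subst det_scale_rows_columns) simp
    also have "mat n n (\<lambda>(i, j). 1 * q powi (int n * \<mu> ! j) * gt_var \<mu> j ^ i) =
        mat n n (\<lambda>(i, j). q powi (int n * (if j < n then \<mu> ! j else undefined)) *
          q powi (- int i * ((if j < n then \<mu> ! j else undefined) + int n - 1 - int j)))"
      by (intro cong_mat) (auto simp: gt_var_power gt_point_def \<mu>)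
    finally show "q powi (int n * sum_list \<mu>) * D n \<mu> = Determinant.det (mat n n
        (\<lambda>(i, j). q powi (int n * (if j < n then \<mu> ! j else undefined)) *
          q powi (- int i * ((if j < n then \<mu> ! j else undefined) + int n - 1 - int j))))" .
  qed
  also have "\<dots> = Determinant.det (mat n n (\<lambda>(i, j). \<Sum>m\<in>{lam ! Suc j..lam ! j}.
      q powi (int n * m) * q powi (- int i * (m + int n - 1 - int j))))"
    by (rule det_sum_columns) simp
  also have "mat n n (\<lambda>(i, j). \<Sum>m\<in>{lam ! Suc j..lam ! j}.
        q powi (int n * m) * q powi (- int i * (m + int n - 1 - int j))) =
      mat n n (\<lambda>(i, j). 1 / (1 - q ^ (n - i)) * q powi (- int n * (int n - 1 - int j)) * (a i (Suc j) - a i j))"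
    by (intro cong_mat refl) (simp only: prod.case entry)
  also have "Determinant.det \<dots> = (\<Prod>i<n. 1 / (1 - q ^ (n - i))) *
      (\<Prod>j<n. q powi (- int n * (int n - 1 - int j))) *
      Determinant.det (mat n n (\<lambda>(i, j). a i (Suc j) - a i j))"
    by (rule det_scale_rows_columns)
  also have "Determinant.det (mat n n (\<lambda>(i, j). a i (Suc j) - a i j)) =
      (- 1) ^ n * Determinant.det (mat (Suc n) (Suc n) (\<lambda>(i, j). a i j))"
    by (subst det_bordered_differences[where n = n]) (auto simp: a_eq simp flip: power_add mult_2)
  also have "Determinant.det (mat (Suc n) (Suc n) (\<lambda>(i, j). a i j)) =
      (\<Prod>j<Suc n. q powi (int n * gt_point lam j)) * D (Suc n) lam"
    unfolding a_def D_def
    using det_scale_rows_columns[of "Suc n" "\<lambda>_. 1" "\<lambda>j. q powi (int n * gt_point lam j)"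
        "\<lambda>i j. gt_var lam j ^ i"] by simp
  also have "(\<Prod>j<Suc n. q powi (int n * gt_point lam j)) =
      q powi (int n * sum_list lam) * (\<Prod>j<n. q powi (int n * (int n - int j)))"
  proof -
    have "(\<Prod>j<Suc n. q powi (int n * gt_point lam j)) =
        (\<Prod>j<Suc n. q powi (int n * lam ! j) * q powi (int n * (int n - int j)))"
      unfolding powi_add[symmetric] distrib_left[symmetric]
      using lam(1) by (intro prod.cong) (auto simp: gt_point_def add_diff_eq)
    also have "\<dots> = q powi (int n * sum_list lam) * (\<Prod>j<Suc n. q powi (int n * (int n - int j)))"
      unfolding prod.distrib sum_list_sum_nth lam(1) sum_distrib_left atLeast0LessThan
      by (simp only: powi_sum[OF finite_lessThan])
    finally show ?thesis by simp
  qed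
  finally have 1: "(\<Sum>\<mu> | interlaces \<mu> lam. q powi (int n * sum_list \<mu>) * D n \<mu>) =
      (\<Prod>i<n. 1 / (1 - q ^ (n - i))) * ((\<Prod>j<n. q powi (- int n * (int n - 1 - int j))) *
      (\<Prod>j<n. q powi (int n * (int n - int j)))) * (- 1) ^ n *
      q powi (int n * sum_list lam) * D (Suc n) lam"
    by (simp only: mult_ac)
  \<comment> \<open>The column factors multiply to the reciprocal of the power of \<open>q\<close>
    in \<open>vdm_norm_Suc\<close>.\<close>
  have "(\<Prod>j<n. q powi (- int n * (int n - 1 - int j))) * (\<Prod>j<n. q powi (int n * (int n - int j))) =
      (\<Prod>j<n. q powi (int n))"
    unfolding prod.distrib[symmetric] powi_add[symmetric] by (simp add: algebra_simps)
  also have "\<dots> = 1 / q powi (- int (n * n))"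
    using q_pos by (simp add: power_int_minus power_mult field_simps flip: of_nat_mult)
  finally have 2: "(\<Prod>j<n. q powi (- int n * (int n - 1 - int j))) * (\<Prod>j<n. q powi (int n * (int n - int j))) =
      1 / q powi (- int (n * n))" .
  have "(\<Sum>\<mu> | interlaces \<mu> lam. q powi (int n * sum_list \<mu>) * D n \<mu>) =
      s n * (\<Sum>\<mu> | interlaces \<mu> lam. q powi (int n * sum_list \<mu>) * vdm \<mu>)"
    unfolding sum_distrib_left using D lam by (intro sum.cong) (auto simp: interlaces_def)
  moreover have "D (Suc n) lam = s n * (- 1) ^ n * vdm lam"
    using D[of lam] lam s_Suc by simp
  ultimately have "s n * (\<Sum>\<mu> | interlaces \<mu> lam. q powi (int n * sum_list \<mu>) * vdm \<mu>) = s n *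
     ((\<Prod>i<n. 1 / (1 - q ^ (n - i))) * (1 / q powi (- int (n * n))) *
      (q powi (int n * sum_list lam) * vdm lam))"
    using 1 unfolding 2 by (simp add: mult_ac flip: power_add mult_2)
  then have "(\<Sum>\<mu> | interlaces \<mu> lam. q powi (int n * sum_list \<mu>) * vdm \<mu>) =
      (\<Prod>i<n. 1 / (1 - q ^ (n - i))) * (1 / q powi (- int (n * n))) *
      (q powi (int n * sum_list lam) * vdm lam)"
    by (rule mult_left_cancel[OF s_nz, THEN iffD1])
  also have "\<dots> = q powi (int n * sum_list lam) * vdm lam * vdm_norm n / vdm_norm (Suc n)"
    using vdm_norm_pos[of n] by (simp add: vdm_norm_Suc prod_dividef)
  finally show ?thesis .
qed

lemma P_down_nonneg: "lam \<in> GT_sigs (Suc n) \<Longrightarrow> P_down q (Suc n) lam \<mu> \<ge> 0"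
proof (cases "interlaces \<mu> lam")
  assume lam: "lam \<in> GT_sigs (Suc n)" and il: "interlaces \<mu> lam"
  then have "length lam = Suc n" by (simp add: GT_sigs_def)
  moreover have "0 \<le> q powi k * (vdm \<mu> / vdm_norm n) / (vdm lam / vdm_norm (Suc n))" for k
    using vdm_pos[OF lam] vdm_pos[OF interlaces_GT_sigs[OF il \<open>length lam = Suc n\<close>]]
      vdm_norm_pos[of n] vdm_norm_pos[of "Suc n"] q_pos by simp
  ultimately show ?thesis using il by (simp add: P_down_eq)
qed (simp add: P_down_def)

lemma sum_P_down:
  assumes "lam \<in> GT_sigs (Suc n)"
  shows "(\<Sum>\<mu> | interlaces \<mu> lam. P_down q (Suc n) lam \<mu>) = 1"
proof -
  have len: "length lam = Suc n" using assms by (simp add: GT_sigs_def)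
  have "(\<Sum>\<mu> | interlaces \<mu> lam. P_down q (Suc n) lam \<mu>) =
      (\<Sum>\<mu> | interlaces \<mu> lam. q powi (int n * sum_list \<mu>) * vdm \<mu> *
        (vdm_norm (Suc n) / (q powi (int n * sum_list lam) * vdm lam * vdm_norm n)))"
  proof (intro sum.cong refl)
    fix \<mu> assume "\<mu> \<in> {\<mu>. interlaces \<mu> lam}"
    moreover have "q powi (int n * (sum_list \<mu> - sum_list lam)) =
        q powi (int n * sum_list \<mu>) / q powi (int n * sum_list lam)"
      unfolding right_diff_distrib using q_pos by (subst power_int_diff) auto
    ultimately show "P_down q (Suc n) lam \<mu> = q powi (int n * sum_list \<mu>) * vdm \<mu> *
        (vdm_norm (Suc n) / (q powi (int n * sum_list lam) * vdm lam * vdm_norm n))"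
      by (simp add: P_down_eq len)
  qed
  also have "\<dots> = (\<Sum>\<mu> | interlaces \<mu> lam. q powi (int n * sum_list \<mu>) * vdm \<mu>) *
      (vdm_norm (Suc n) / (q powi (int n * sum_list lam) * vdm lam * vdm_norm n))"
    by (rule sum_distrib_right[symmetric])
  also have "\<dots> = 1"
  proof -
    have "a * b * c / d * (d / (a * b * c)) = 1" if "a > 0" "b > 0" "c > 0" "d > 0" for a b c d :: real
      using that by simp
    from this[OF _ vdm_pos[OF assms] vdm_norm_pos vdm_norm_pos] show ?thesis
      unfolding link_normalization[OF len assms] using q_pos by simp
  qed
  finally show ?thesis .
qed

end

section \<open>Concentration of the links\<close>

context q_parameter
begin

text \<open>A closed form below all partial products of Euler's product of \<open>1 - q ^ d\<close>
  over \<open>d \<ge> 1\<close>, see \<open>q_euler_le\<close>. One factor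
  \<open>1 / (1 - q)\<close> in the exponent comes from the estimate of a single factor, the other
  from the geometric series over \<open>d\<close>.\<close>

definition q_euler :: real where "q_euler = exp (- (q / (1 - q)\<^sup>2))"

lemma q_euler_pos: "q_euler > 0"
  by (simp add: q_euler_def)

lemma q_power_less_1: "0 < d \<Longrightarrow> q ^ d < 1"
  using q_pos q_less_1 by (simp add: power_less_one_iff)

lemma one_minus_power_ge: "exp (- (q ^ Suc d / (1 - q))) \<le> 1 - q ^ Suc d"
proof -
  have lt: "q ^ Suc d < 1" by (rule q_power_less_1) simp
  have "1 / (1 - q ^ Suc d) = 1 + q ^ Suc d / (1 - q ^ Suc d)"
    using lt by (simp add: field_simps)
  also have "\<dots> \<le> 1 + q ^ Suc d / (1 - q)"
    using lt q_pos q_less_1 by (intro add_left_mono divide_left_mono) (auto simp: mult_le_one power_le_one mult_left_le)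
  also have "\<dots> \<le> exp (q ^ Suc d / (1 - q))" by (rule exp_ge_add_one_self)
  finally show ?thesis using lt by (simp add: exp_minus field_simps)
qed

lemma q_euler_le: "q_euler \<le> (\<Prod>d<s. 1 - q ^ Suc d)"
proof -
  have "(\<Sum>d<s. q ^ Suc d / (1 - q)) = q * (\<Sum>d<s. q ^ d) / (1 - q)"
    by (simp add: sum_distrib_left sum_divide_distrib)
  also have "\<dots> = q * (1 - q ^ s) / (1 - q)\<^sup>2"
    using q_less_1 by (simp add: sum_gp_strict power2_eq_square)
  also have "\<dots> \<le> q / (1 - q)\<^sup>2"
    using q_pos by (intro divide_right_mono) (auto simp: mult_left_le)
  finally have "q_euler \<le> exp (- (\<Sum>d<s. q ^ Suc d / (1 - q)))"
    by (simp add: q_euler_def)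
  also have "\<dots> = (\<Prod>d<s. exp (- (q ^ Suc d / (1 - q))))"
    by (simp add: exp_sum flip: sum_negf)
  also have "\<dots> \<le> (\<Prod>d<s. 1 - q ^ Suc d)"
    by (intro prod_mono conjI one_minus_power_ge) simp
  finally show ?thesis .
qed

text \<open>Raising particle \<open>i\<close> multiplies its variable by \<open>1 / q ^ y\<close>.
  Differences with higher particles shrink. Differences with a lower particle \<open>b\<close> grow
  at most by \<open>1 / q ^ y / (1 - q ^ (b - i))\<close>, because the variable of \<open>b\<close>
  is at most \<open>q ^ (b - i)\<close> times that of \<open>i\<close>. There are
  \<open>n - Suc i\<close> lower particles, and \<open>q_euler\<close> absorbs the denominators for
  every \<open>n\<close>.\<close>

lemma vdm_raise_le:
  assumes \<kappa>: "\<kappa> \<in> GT_sigs n" and \<mu>: "\<kappa>[i := \<kappa> ! i + int y] \<in> GT_sigs n" and i: "i < n"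
  shows "vdm (\<kappa>[i := \<kappa> ! i + int y]) \<le> (1 / q ^ y) ^ (n - Suc i) / q_euler * vdm \<kappa>"
proof -
  let ?\<mu> = "\<kappa>[i := \<kappa> ! i + int y]"
  have len: "length \<kappa> = n" using \<kappa> by (simp add: GT_sigs_def)
  define w where "w a b = (if a = i then 1 / q ^ y / (1 - q ^ (b - i)) else 1)" for a b :: nat
  have x_i: "gt_var ?\<mu> i = 1 / q ^ y * gt_var \<kappa> i"
  proof -
    have "gt_point ?\<mu> i = gt_point \<kappa> i + int y"
      using i len by (simp add: gt_point_def)
    then have "gt_var ?\<mu> i = q powi (- int y + - gt_point \<kappa> i)"
      by (simp only: gt_var_def minus_add_distrib add.commute)
    then show ?thesis
      unfolding powi_add gt_var_def by (simp add: power_int_minus divide_inverse)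
  qed
  have x_j: "gt_var ?\<mu> j = gt_var \<kappa> j" if "j \<noteq> i" for j
    using that by (simp add: gt_var_def gt_point_def)
  have qy: "1 / q ^ y \<ge> 1"
    using q_pos q_less_1 by (simp add: power_le_one)
  have factor: "0 \<le> gt_var ?\<mu> a - gt_var ?\<mu> b \<and>
      gt_var ?\<mu> a - gt_var ?\<mu> b \<le> w a b * (gt_var \<kappa> a - gt_var \<kappa> b)" if ab: "a < b" "b < n" for a b
  proof
    show "0 \<le> gt_var ?\<mu> a - gt_var ?\<mu> b"
      using gt_var_less[OF \<mu> ab] by simp
    consider "a = i" | "b = i" | "a \<noteq> i" "b \<noteq> i" by blast
    then show "gt_var ?\<mu> a - gt_var ?\<mu> b \<le> w a b * (gt_var \<kappa> a - gt_var \<kappa> b)"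
    proof cases
      case 1
      have lt: "q ^ (b - i) < 1" using ab 1 by (intro q_power_less_1) simp
      have "gt_var \<kappa> b \<le> q powi (int (b - a) + - gt_point \<kappa> a)"
        unfolding gt_var_def using gt_point_strict[OF \<kappa> ab] q_pos q_less_1
        by (intro power_int_decreasing) auto
      also have "\<dots> = q ^ (b - a) * gt_var \<kappa> a"
        by (simp only: powi_add gt_var_def power_int_of_nat)
      finally have "(1 - q ^ (b - i)) * gt_var \<kappa> a \<le> gt_var \<kappa> a - gt_var \<kappa> b"
        using 1 by (simp add: algebra_simps)
      then have "gt_var \<kappa> a \<le> (gt_var \<kappa> a - gt_var \<kappa> b) / (1 - q ^ (b - i))"
        using lt by (simp add: field_simps)
      then have "1 / q ^ y * gt_var \<kappa> a \<le>
          1 / q ^ y * ((gt_var \<kappa> a - gt_var \<kappa> b) / (1 - q ^ (b - i)))"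
        using q_pos by (intro mult_left_mono) auto
      then have "1 / q ^ y * gt_var \<kappa> a \<le> w a b * (gt_var \<kappa> a - gt_var \<kappa> b)"
        using 1 by (simp add: w_def)
      then show ?thesis
        using 1 ab x_i x_j[of b] gt_var_pos[of \<kappa> b] by simp
    next
      case 2
      then show ?thesis
        using ab x_i x_j[of a] mult_right_mono[OF qy, of "gt_var \<kappa> i"] gt_var_pos[of \<kappa> i] by (simp add: w_def)
    next
      case 3
      then show ?thesis by (simp add: x_j w_def)
    qed
  qed
  have "vdm ?\<mu> \<le> (\<Prod>b<n. \<Prod>a<b. w a b * (gt_var \<kappa> a - gt_var \<kappa> b))"
    unfolding vdm_def using factor len by (auto intro!: prod_mono prod_nonneg)
  also have "\<dots> = (\<Prod>b<n. \<Prod>a<b. w a b) * vdm \<kappa>"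
    by (simp add: prod.distrib vdm_def len)
  also have "(\<Prod>b<n. \<Prod>a<b. w a b) = (\<Prod>b<n. if i < b then 1 / q ^ y / (1 - q ^ (b - i)) else 1)"
    unfolding w_def by (intro prod.cong refl, subst prod.delta) auto
  also have "\<dots> = (\<Prod>b\<in>{Suc i..<n}. 1 / q ^ y / (1 - q ^ (b - i)))"
    by (intro prod.mono_neutral_cong_right) auto
  also have "\<dots> = (\<Prod>d<n - Suc i. 1 / q ^ y / (1 - q ^ Suc d))"
    by (intro prod.reindex_bij_witness[of _ "\<lambda>d. d + Suc i" "\<lambda>b. b - Suc i"])
       (auto simp: Suc_diff_Suc)
  also have "\<dots> = (1 / q ^ y) ^ (n - Suc i) / (\<Prod>d<n - Suc i. 1 - q ^ Suc d)"
    by (simp only: prod_dividef prod_constant card_lessThan power_divide)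
  also have "\<dots> * vdm \<kappa> \<le> (1 / q ^ y) ^ (n - Suc i) / q_euler * vdm \<kappa>"
    using vdm_pos[OF \<kappa>] q_pos q_euler_le[of "n - Suc i"] q_euler_pos
    by (intro mult_right_mono divide_left_mono) auto
  finally show ?thesis by simp
qed

text \<open>The power of \<open>q\<close> in the link gains \<open>n * y\<close> from the larger
  coordinate sum, and the Vandermonde product takes back \<open>(n - Suc i) * y\<close>.\<close>

lemma P_down_raise_le:
  assumes lam: "lam \<in> GT_sigs (Suc n)" and \<kappa>: "interlaces \<kappa> lam"
    and \<mu>: "interlaces (\<kappa>[i := \<kappa> ! i + int y]) lam" and i: "i < n"
  shows "P_down q (Suc n) lam (\<kappa>[i := \<kappa> ! i + int y]) \<le>
    (q ^ Suc i) ^ y / q_euler * P_down q (Suc n) lam \<kappa>"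
proof -
  let ?\<mu> = "\<kappa>[i := \<kappa> ! i + int y]"
  have len: "length lam = Suc n" using lam by (simp add: GT_sigs_def)
  have len': "length \<kappa> = n" using \<kappa> len by (simp add: interlaces_def)
  note GT = interlaces_GT_sigs[OF \<kappa> len] interlaces_GT_sigs[OF \<mu> len]
  have sum: "sum_list ?\<mu> = sum_list \<kappa> + int y"
  proof -
    have "sum_list ?\<mu> = (\<Sum>j<n. \<kappa> ! j + (if j = i then int y else 0))"
      using i len' by (auto simp: sum_list_sum_nth atLeast0LessThan intro!: sum.cong)
    then show ?thesis
      using i len' by (simp add: sum_list_sum_nth atLeast0LessThan sum.distrib)
  qed
  define c where "c = q powi (int n * (sum_list \<kappa> - sum_list lam)) / vdm_norm n / (vdm lam / vdm_norm (Suc n))"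
  have c: "c \<ge> 0"
    using vdm_pos[OF lam] vdm_norm_pos[of n] vdm_norm_pos[of "Suc n"] q_pos by (simp add: c_def)
  have "P_down q (Suc n) lam ?\<mu> = c * (q ^ n) ^ y * vdm ?\<mu>"
  proof -
    have "q powi (int n * (sum_list ?\<mu> - sum_list lam)) =
        q powi (int n * (sum_list \<kappa> - sum_list lam)) * q powi (int (n * y))"
      unfolding sum powi_add[symmetric] by (simp add: algebra_simps)
    then show ?thesis unfolding P_down_eq[OF len \<mu>] c_def
      by (simp add: power_mult del: of_nat_mult)
  qed
  also have "\<dots> \<le> c * (q ^ n) ^ y * ((1 / q ^ y) ^ (n - Suc i) / q_euler * vdm \<kappa>)"
    using c q_pos by (intro mult_left_mono vdm_raise_le GT i) auto
  also have "\<dots> = (q ^ n) ^ y * (1 / q ^ y) ^ (n - Suc i) / q_euler * (c * vdm \<kappa>)"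
    by simp
  also have "(q ^ n) ^ y * (1 / q ^ y) ^ (n - Suc i) = (q ^ Suc i) ^ y"
  proof -
    have "(q ^ n) ^ y = (q ^ y) ^ (n - Suc i) * (q ^ Suc i) ^ y"
    proof -
      have "n * y = y * (n - Suc i) + Suc i * y"
      proof -
        have "n = (n - Suc i) + Suc i" using i by simp
        then show ?thesis by (metis add_mult_distrib mult.commute)
      qed
      then show ?thesis by (simp only: power_mult[symmetric] power_add)
    qed
    then show ?thesis using q_pos by (simp add: power_divide)
  qed
  also have "c * vdm \<kappa> = P_down q (Suc n) lam \<kappa>"
    unfolding P_down_eq[OF len \<kappa>] c_def by simp
  finally show ?thesis .
qed

text \<open>The bottom \<open>s\<close> coordinates sit at the lowest values that interlacing
  allows. The index is shifted because \<open>lam\<close> is longer by one.\<close>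

definition keeping :: "int list \<Rightarrow> nat \<Rightarrow> int list set" where
  "keeping lam s = {\<mu>. interlaces \<mu> lam \<and> (\<forall>j<length \<mu>. length \<mu> \<le> j + s \<longrightarrow> \<mu> ! j = lam ! Suc j)}"

lemma interlaces_list_update:
  assumes "interlaces \<kappa> lam" and "lam ! Suc i \<le> a" "a \<le> lam ! i"
  shows "interlaces (\<kappa>[i := a]) lam"
  unfolding interlaces_def
proof (safe; (simp only: length_list_update)?)
  show "length lam = Suc (length \<kappa>)" using assms by (simp add: interlaces_def)
  fix j assume "j < length \<kappa>"
  then show "\<kappa>[i := a] ! j \<le> lam ! j" "lam ! Suc j \<le> \<kappa>[i := a] ! j"
    using assms by (cases "i = j"; simp add: interlaces_def)+
qed

lemma finite_keeping: "finite (keeping lam s)"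
  by (rule finite_subset[OF _ finite_interlaces[of lam]]) (auto simp: keeping_def)

text \<open>Every element of \<open>keeping lam s\<close> arises from one of
  \<open>keeping lam (Suc s)\<close> by raising one coordinate. The raised weights are dominated by
  a geometric series of ratio \<open>q ^ (n - s)\<close>, which makes the bound uniform in the
  length of the interval where this coordinate moves.\<close>

lemma sum_keeping_step:
  assumes lam: "lam \<in> GT_sigs (Suc n)" and s: "s < n"
  shows "(\<Sum>\<mu>\<in>keeping lam s. P_down q (Suc n) lam \<mu>) \<le>
    exp (q ^ (n - s) / ((1 - q) * q_euler)) * (\<Sum>\<mu>\<in>keeping lam (Suc s). P_down q (Suc n) lam \<mu>)"
proof -
  define i where "i = n - Suc s"
  have i: "i < n" "n - s = Suc i" using s by (auto simp: i_def)
  have len: "length lam = Suc n" using lam by (simp add: GT_sigs_def)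
  define Y where "Y = nat (lam ! i - lam ! Suc i)"
  define r where "r = q ^ Suc i"
  have r: "0 < r" "r \<le> q" "r < 1"
    using q_pos q_less_1 q_power_less_1[of "Suc i"] by (auto simp: r_def mult_left_le power_le_one)
  have raise: "\<kappa> ! i = lam ! Suc i \<and> interlaces \<kappa> lam \<and> interlaces (\<kappa>[i := \<kappa> ! i + int y]) lam"
    if "\<kappa> \<in> keeping lam (Suc s)" "y \<le> Y" for \<kappa> y
  proof -
    have "length \<kappa> = n" using that len by (simp add: keeping_def interlaces_def)
    then have "\<kappa> ! i = lam ! Suc i" "interlaces \<kappa> lam"
      using that i by (auto simp: keeping_def i_def)
    moreover have "lam ! Suc i + int y \<le> lam ! i"
      using that(2) GT_sigs_nth_mono[OF lam, of i "Suc i"] i by (simp add: Y_def le_nat_iff)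
    ultimately show ?thesis by (auto intro: interlaces_list_update)
  qed
  have "(\<Sum>\<mu>\<in>keeping lam s. P_down q (Suc n) lam \<mu>) \<le>
      (\<Sum>(\<kappa>, y)\<in>keeping lam (Suc s) \<times> {..Y}. P_down q (Suc n) lam (\<kappa>[i := \<kappa> ! i + int y]))"
  proof (rule sum_le_included[where i = "\<lambda>(\<kappa>, y). \<kappa>[i := \<kappa> ! i + int y]"])
    show "\<forall>\<mu>\<in>keeping lam s. \<exists>z\<in>keeping lam (Suc s) \<times> {..Y}.
        (case z of (\<kappa>, y) \<Rightarrow> \<kappa>[i := \<kappa> ! i + int y]) = \<mu> \<and>
        P_down q (Suc n) lam \<mu> \<le> (case z of (\<kappa>, y) \<Rightarrow> P_down q (Suc n) lam (\<kappa>[i := \<kappa> ! i + int y]))"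
    proof
      fix \<mu> assume \<mu>: "\<mu> \<in> keeping lam s"
      then have len\<mu>: "length \<mu> = n" and "lam ! Suc i \<le> \<mu> ! i" "\<mu> ! i \<le> lam ! i"
        using len i by (auto simp: keeping_def interlaces_def)
      moreover have "\<mu>[i := lam ! Suc i] \<in> keeping lam (Suc s)"
        unfolding keeping_def
      proof (safe; (simp only: length_list_update)?)
        show "interlaces (\<mu>[i := lam ! Suc i]) lam"
          using \<mu> i GT_sigs_nth_mono[OF lam, of i "Suc i"]
          by (auto simp: keeping_def intro: interlaces_list_update)
        fix j assume "j < length \<mu>" "length \<mu> \<le> j + Suc s"
        then show "\<mu>[i := lam ! Suc i] ! j = lam ! Suc j"
          using \<mu> i len\<mu> by (cases "j = i") (auto simp: keeping_def i_def)
      qed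
      ultimately show "\<exists>z\<in>keeping lam (Suc s) \<times> {..Y}.
          (case z of (\<kappa>, y) \<Rightarrow> \<kappa>[i := \<kappa> ! i + int y]) = \<mu> \<and>
          P_down q (Suc n) lam \<mu> \<le> (case z of (\<kappa>, y) \<Rightarrow> P_down q (Suc n) lam (\<kappa>[i := \<kappa> ! i + int y]))"
        using i by (intro bexI[where x = "(\<mu>[i := lam ! Suc i], nat (\<mu> ! i - lam ! Suc i))"])
          (auto simp: Y_def)
    qed
  qed (use P_down_nonneg[OF lam] in \<open>auto simp: finite_keeping\<close>)
  also have "\<dots> = (\<Sum>\<kappa>\<in>keeping lam (Suc s). \<Sum>y\<le>Y. P_down q (Suc n) lam (\<kappa>[i := \<kappa> ! i + int y]))"
    by (rule sum.cartesian_product[symmetric])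
  also have "\<dots> \<le> (\<Sum>\<kappa>\<in>keeping lam (Suc s). exp (r / ((1 - q) * q_euler)) * P_down q (Suc n) lam \<kappa>)"
  proof (intro sum_mono)
    fix \<kappa> assume \<kappa>: "\<kappa> \<in> keeping lam (Suc s)"
    \<comment> \<open>The term \<open>y = 0\<close> is split off because it carries no factor
      \<open>1 / q_euler\<close>; so the total is close to the unraised weight when \<open>r\<close>
      is small.\<close>
    have "(\<Sum>y\<le>Y. P_down q (Suc n) lam (\<kappa>[i := \<kappa> ! i + int y])) =
        P_down q (Suc n) lam \<kappa> + (\<Sum>y<Y. P_down q (Suc n) lam (\<kappa>[i := \<kappa> ! i + int (Suc y)]))"
      by (subst sum.atMost_shift) simp
    also have "\<dots> \<le> P_down q (Suc n) lam \<kappa> + (\<Sum>y<Y. r ^ Suc y / q_euler * P_down q (Suc n) lam \<kappa>)"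
    proof (intro add_left_mono sum_mono)
      fix y assume "y \<in> {..<Y}"
      then have "Suc y \<le> Y" by simp
      from raise[OF \<kappa> this]
      have "interlaces \<kappa> lam" "interlaces (\<kappa>[i := \<kappa> ! i + int (Suc y)]) lam" by blast+
      from P_down_raise_le[OF lam this i(1)]
      show "P_down q (Suc n) lam (\<kappa>[i := \<kappa> ! i + int (Suc y)]) \<le>
          r ^ Suc y / q_euler * P_down q (Suc n) lam \<kappa>" unfolding r_def .
    qed
    also have "\<dots> = (1 + r * (\<Sum>y<Y. r ^ y) / q_euler) * P_down q (Suc n) lam \<kappa>"
      by (simp add: sum_distrib_left sum_distrib_right sum_divide_distrib distrib_right)
    also have "\<dots> \<le> exp (r / ((1 - q) * q_euler)) * P_down q (Suc n) lam \<kappa>"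
    proof (intro mult_right_mono P_down_nonneg lam)
      have "(\<Sum>y<Y. r ^ y) = (1 - r ^ Y) / (1 - r)" using r by (simp add: sum_gp_strict)
      also have "\<dots> \<le> 1 / (1 - q)" using r q_less_1 by (intro frac_le) auto
      finally have "1 + r * (\<Sum>y<Y. r ^ y) / q_euler \<le> 1 + r * (1 / (1 - q)) / q_euler"
        using r q_euler_pos by (intro add_left_mono divide_right_mono mult_left_mono) auto
      also have "\<dots> \<le> exp (r / ((1 - q) * q_euler))"
        using exp_ge_add_one_self[of "r / ((1 - q) * q_euler)"] by simp
      finally show "1 + r * (\<Sum>y<Y. r ^ y) / q_euler \<le> exp (r / ((1 - q) * q_euler))" .
    qed
    finally show "(\<Sum>y\<le>Y. P_down q (Suc n) lam (\<kappa>[i := \<kappa> ! i + int y])) \<le>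
        exp (r / ((1 - q) * q_euler)) * P_down q (Suc n) lam \<kappa>" .
  qed
  finally show ?thesis by (simp add: sum_distrib_left r_def i)
qed

text \<open>Freezing the coordinates one by one from the bottom costs the factors of
  \<open>sum_keeping_step\<close>, whose exponents form a geometric series dominated by its last
  term.\<close>

lemma sum_keeping_ge:
  assumes lam: "lam \<in> GT_sigs (Suc n)" and k: "k \<le> n"
  shows "exp (- (q ^ (n - k) / ((1 - q)\<^sup>2 * q_euler))) \<le> (\<Sum>\<mu>\<in>keeping lam k. P_down q (Suc n) lam \<mu>)"
  using k
proof (induction k)
  case 0
  have "keeping lam 0 = {\<mu>. interlaces \<mu> lam}" by (auto simp: keeping_def)
  then show ?case using sum_P_down[OF lam] q_pos q_euler_pos by simp
next
  case (Suc s)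
  define c where "c = 1 / ((1 - q)\<^sup>2 * q_euler)"
  have c: "c > 0" using q_euler_pos q_less_1 by (simp add: c_def)
  have eq: "n - s = Suc (n - Suc s)" using Suc by simp
  have "q ^ (n - s) / ((1 - q)\<^sup>2 * q_euler) + q ^ (n - s) / ((1 - q) * q_euler) =
      c * q ^ (n - Suc s) * (q + q * (1 - q))"
  proof -
    have "A / (u\<^sup>2 * e) + A / (u * e) = 1 / (u\<^sup>2 * e) * (A + A * u)" if "u \<noteq> 0" "e \<noteq> 0" for A u e :: real
      using that by (simp add: power2_eq_square field_simps)
    from this[of "1 - q" q_euler "q ^ (n - s)"] show ?thesis
      unfolding c_def eq using q_less_1 q_euler_pos by (simp add: distrib_left mult_ac add_divide_distrib)
  qed
  \<comment> \<open>Amounts to \<open>0 \<le> (1 - q) ^ 2\<close>.\<close>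
  also have "\<dots> \<le> c * q ^ (n - Suc s) * 1"
    using c q_pos sum_squares_ge_zero[of "1 - q" 0]
    by (intro mult_left_mono) (auto simp: algebra_simps)
  finally have le: "q ^ (n - s) / ((1 - q)\<^sup>2 * q_euler) + q ^ (n - s) / ((1 - q) * q_euler) \<le>
      q ^ (n - Suc s) / ((1 - q)\<^sup>2 * q_euler)" by (simp add: c_def)
  have "exp (- (q ^ (n - s) / ((1 - q)\<^sup>2 * q_euler))) \<le>
      exp (q ^ (n - s) / ((1 - q) * q_euler)) * (\<Sum>\<mu>\<in>keeping lam (Suc s). P_down q (Suc n) lam \<mu>)"
    using Suc by (intro order.trans[OF _ sum_keeping_step[OF lam]]) auto
  then have "exp (- (q ^ (n - s) / ((1 - q)\<^sup>2 * q_euler)) - q ^ (n - s) / ((1 - q) * q_euler)) \<le>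
      (\<Sum>\<mu>\<in>keeping lam (Suc s). P_down q (Suc n) lam \<mu>)"
    by (simp add: exp_diff divide_le_eq mult.commute)
  moreover have "exp (- (q ^ (n - Suc s) / ((1 - q)\<^sup>2 * q_euler))) \<le>
      exp (- (q ^ (n - s) / ((1 - q)\<^sup>2 * q_euler)) - q ^ (n - s) / ((1 - q) * q_euler))"
    using le by simp
  ultimately show ?case by linarith
qed

end

section \<open>Expectations over probability mass functions\<close>

abbreviation expect :: "'a pmf \<Rightarrow> ('a \<Rightarrow> real) \<Rightarrow> real" where
  "expect \<equiv> measure_pmf.expectation"

lemma integrable_pmf_bounded: "(\<And>x. \<bar>f x\<bar> \<le> C) \<Longrightarrow> integrable (measure_pmf p) (f :: _ \<Rightarrow> real)"
  by (rule measure_pmf.integrable_const_bound[where B = C]) auto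

lemma expect_bind:
  assumes "\<And>x. \<bar>f x\<bar> \<le> C"
  shows "expect (bind_pmf p k) f = expect p (\<lambda>x. expect (k x) f)"
  unfolding measure_pmf_bind
  by (rule integral_bind[where K = "count_space UNIV" and B = C and B' = 1])
     (use assms measurable_measure_pmf[of k] in \<open>auto simp: measure_pmf.finite_measure_axioms measure_pmf.emeasure_le_1\<close>)

lemma expect_mono:
  assumes "\<And>x. \<bar>f x\<bar> \<le> C" "\<And>x. \<bar>g x\<bar> \<le> D" "\<And>x. x \<in> set_pmf p \<Longrightarrow> f x \<le> g x"
  shows "expect p f \<le> expect p g"
  using assms by (intro integral_mono_AE integrable_pmf_bounded AE_pmfI) auto

lemma abs_expect_le:
  assumes "\<And>x. \<bar>f x\<bar> \<le> C"
  shows "\<bar>expect p f\<bar> \<le> C"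
proof -
  have "\<bar>expect p f\<bar> \<le> expect p (\<lambda>x. \<bar>f x\<bar>)"
    by (rule integral_abs_bound)
  also have "\<dots> \<le> expect p (\<lambda>_. C)"
    using assms order.trans[OF abs_ge_zero assms]
    by (intro expect_mono[where C = C and D = C]) auto
  finally show ?thesis by simp
qed

lemma measure_bind_pmf_ge:
  assumes "\<And>x. x \<in> set_pmf p \<Longrightarrow> x \<in> T \<Longrightarrow> c \<le> measure (measure_pmf (f x)) S" "c \<ge> 0" "c \<le> 1"
  shows "measure (measure_pmf p) T * c \<le> measure (measure_pmf (bind_pmf p f)) S"
proof -
  have "measure (measure_pmf p) T * c = expect p (\<lambda>x. indicator T x * c)"
    by simp
  also have "\<dots> \<le> expect p (\<lambda>x. measure (measure_pmf (f x)) S)"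
    using assms by (intro expect_mono[where C = 1 and D = 1]) (auto simp: indicator_def)
  also have "\<dots> = expect (bind_pmf p f) (indicator S)"
    by (subst expect_bind[where C = 1]) (auto simp: indicator_def)
  finally show ?thesis by simp
qed

text \<open>Off \<open>S\<close> the integrand is within 2 of \<open>c\<close>. This converts lower
  bounds for the probability of keeping the bottom coordinates into bounds for expectations.\<close>

lemma expect_close_const:
  assumes f: "\<And>x. \<bar>f x\<bar> \<le> 1" and c: "\<bar>c\<bar> \<le> 1" and S: "\<And>x. x \<in> set_pmf p \<Longrightarrow> x \<in> S \<Longrightarrow> f x = c"
    and e: "e \<le> measure (measure_pmf p) S"
  shows "\<bar>expect p f - c\<bar> \<le> 2 * (1 - e)"
proof -
  have bd: "\<bar>f x - c\<bar> \<le> 2" for x using f[of x] c by linarith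
  have "expect p f - c = expect p (\<lambda>x. f x - c)"
    using integrable_pmf_bounded[of f 1 p] f by simp
  also have "\<bar>\<dots>\<bar> \<le> expect p (\<lambda>x. \<bar>f x - c\<bar>)"
    by (rule integral_abs_bound)
  also have "\<dots> \<le> expect p (\<lambda>x. 2 * (1 - indicator S x))"
    using bd S by (intro expect_mono[where C = 2 and D = 2]) (auto simp: indicator_def)
  also have "\<dots> = 2 * (1 - measure (measure_pmf p) S)"
  proof -
    have "integrable (measure_pmf p) (indicator S :: _ \<Rightarrow> real)"
      by (rule integrable_pmf_bounded[where C = 1]) (auto simp: indicator_def)
    then show ?thesis by simp
  qed
  finally show ?thesis using e by simp
qed

lemma pmf_eq_expect: "pmf p x = expect p (indicator {x})"
  by (simp add: measure_pmf_single)

lemma pmf_eqI_le: "(\<And>x. pmf p x \<le> pmf r x) \<Longrightarrow> p = r"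
  using pmf_neq_exists_less[of r p] by (metis linorder_not_le)

text \<open>Scheffe's lemma: the limit has total mass 1, so no mass escapes and pointwise
  convergence of the weights is convergence in the l1 norm.\<close>

lemma tendsto_expect_pmf:
  fixes p :: "nat \<Rightarrow> 'a pmf"
  assumes lim: "\<And>x. (\<lambda>n. pmf (p n) x) \<longlonglongrightarrow> pmf r x" and f: "\<And>x. \<bar>f x\<bar> \<le> C"
  shows "(\<lambda>n. expect (p n) f) \<longlonglongrightarrow> expect r f"
proof -
  have integrable: "integrable (count_space UNIV) (pmf (s :: 'a pmf))" for s
    by (rule integrable_pmf)
  have int_f: "integrable (count_space UNIV) (\<lambda>x. pmf s x * f x)" for s :: "'a pmf"
  proof (rule Bochner_Integration.integrable_bound)
    show "integrable (count_space UNIV) (\<lambda>x. C * pmf s x)" by (intro integrable_mult_right integrable)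
    have "\<bar>pmf s x * f x\<bar> \<le> \<bar>C * pmf s x\<bar>" for x
      using f[of x] mult_right_mono[OF f[of x], of "pmf s x"] by (simp add: abs_mult mult.commute)
    then show "AE x in count_space UNIV. norm (pmf s x * f x) \<le> norm (C * pmf s x)" by simp
  qed simp
  have E: "expect s f = (\<integral>x. pmf s x * f x \<partial>count_space UNIV)" for s :: "'a pmf"
    by (simp add: measure_pmf_eq_density integral_density)
  have "(\<lambda>n. \<integral>\<^sup>+x. norm (pmf (p n) x - pmf r x) \<partial>count_space UNIV) \<longlonglongrightarrow> 0"
    by (rule Scheffe_lemma2) (use lim integrable in \<open>auto simp: nn_integral_pmf\<close>)
  moreover have "(\<integral>\<^sup>+x. norm (pmf (p n) x - pmf r x) \<partial>count_space UNIV) =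
      ennreal (\<integral>x. \<bar>pmf (p n) x - pmf r x\<bar> \<partial>count_space UNIV)" for n
    using integrable by (subst nn_integral_eq_integral) auto
  ultimately have l1: "(\<lambda>n. \<integral>x. \<bar>pmf (p n) x - pmf r x\<bar> \<partial>count_space UNIV) \<longlonglongrightarrow> 0"
    by (simp add: ennreal_0[symmetric] del: ennreal_0)
  have "(\<lambda>n. C * (\<integral>x. \<bar>pmf (p n) x - pmf r x\<bar> \<partial>count_space UNIV)) \<longlonglongrightarrow> C * 0"
    by (intro tendsto_intros l1)
  then have "(\<lambda>n. expect (p n) f - expect r f) \<longlonglongrightarrow> 0"
  proof (rule Lim_null_comparison[rotated, OF tendsto_eq_rhs], goal_cases)
    case 2
    have "\<bar>expect (p n) f - expect r f\<bar> \<le> C * (\<integral>x. \<bar>pmf (p n) x - pmf r x\<bar> \<partial>count_space UNIV)" for n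
    proof -
      have "expect (p n) f - expect r f = (\<integral>x. pmf (p n) x * f x - pmf r x * f x \<partial>count_space UNIV)"
        unfolding E by (intro Bochner_Integration.integral_diff[symmetric] int_f)
      also have "\<bar>\<dots>\<bar> \<le> (\<integral>x. \<bar>pmf (p n) x * f x - pmf r x * f x\<bar> \<partial>count_space UNIV)"
        by (rule integral_abs_bound)
      also have "\<dots> \<le> (\<integral>x. C * \<bar>pmf (p n) x - pmf r x\<bar> \<partial>count_space UNIV)"
      proof (rule integral_mono)
        show "\<bar>pmf (p n) x * f x - pmf r x * f x\<bar> \<le> C * \<bar>pmf (p n) x - pmf r x\<bar>" for x
          using mult_right_mono[OF f[of x], of "\<bar>pmf (p n) x - pmf r x\<bar>"]
          by (simp add: left_diff_distrib[symmetric] abs_mult mult.commute[of "\<bar>f x\<bar>"])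
      qed (auto intro!: int_f integrable Bochner_Integration.integrable_diff integrable_abs integrable_mult_right)
      finally show ?thesis by simp
    qed
    then show ?case by simp
  qed simp
  then show ?thesis by (rule LIM_zero_cancel)
qed

section \<open>Iterated links and their mixing\<close>

definition bottom :: "nat \<Rightarrow> int list \<Rightarrow> int list" where
  "bottom k lam = drop (length lam - k) lam"

text \<open>The list is reversed because \<open>u\<close> increases while signatures decrease; it is
  compared with \<open>bottom k lam\<close>.\<close>

definition trunc :: "(nat \<Rightarrow> int) \<Rightarrow> nat \<Rightarrow> int list" where
  "trunc u k = rev (map u [0..<k])"

lemma length_bottom [simp]: "k \<le> length lam \<Longrightarrow> length (bottom k lam) = k"
  by (simp add: bottom_def)

lemma bottom_bottom: "j \<le> k \<Longrightarrow> k \<le> length lam \<Longrightarrow> bottom j (bottom k lam) = bottom j lam"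
  by (simp add: bottom_def)

lemma bottom_GT_sigs: "lam \<in> GT_sigs K \<Longrightarrow> k \<le> K \<Longrightarrow> bottom k lam \<in> GT_sigs k"
  by (auto simp: GT_sigs_def bottom_def sorted_wrt_drop)

lemma bottom_length [simp]: "length lam = k \<Longrightarrow> bottom k lam = lam"
  by (simp add: bottom_def)

lemma nth_bottom: "k \<le> length lam \<Longrightarrow> i < k \<Longrightarrow> bottom k lam ! i = lam ! (length lam - k + i)"
  by (simp add: bottom_def)

lemma length_trunc [simp]: "length (trunc u k) = k"
  by (simp add: trunc_def)

lemma nth_trunc: "i < k \<Longrightarrow> trunc u k ! i = u (k - Suc i)"
  by (simp add: trunc_def rev_nth)

lemma bottom_trunc: "j \<le> k \<Longrightarrow> bottom j (trunc u k) = trunc u j"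
  by (rule nth_equalityI) (auto simp: nth_bottom nth_trunc)

lemma trunc_GT_sigs: "mono u \<Longrightarrow> trunc u k \<in> GT_sigs k"
  by (rule GT_sigsI_Suc) (simp_all add: nth_trunc monoD[of u])

lemma GT_sigs_length: "lam \<in> GT_sigs K \<Longrightarrow> length lam = K"
  by (simp add: GT_sigs_def)

section \<open>Links as probability mass functions\<close>

context q_parameter
begin

definition link :: "int list \<Rightarrow> int list pmf" where
  "link lam = embed_pmf (P_down q (length lam) lam)"

lemma pmf_link: "lam \<in> GT_sigs (Suc n) \<Longrightarrow> pmf (link lam) \<mu> = P_down q (Suc n) lam \<mu>"
proof -
  assume lam: "lam \<in> GT_sigs (Suc n)"
  have "(\<integral>\<^sup>+\<mu>. ennreal (P_down q (Suc n) lam \<mu>) \<partial>count_space UNIV) =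
      (\<Sum>\<mu> | interlaces \<mu> lam. ennreal (P_down q (Suc n) lam \<mu>))"
    by (rule nn_integral_count_space'[OF finite_interlaces]) (auto simp: P_down_def)
  also have "\<dots> = 1"
    using sum_P_down[OF lam] P_down_nonneg[OF lam] by (subst sum_ennreal) auto
  finally show ?thesis
    unfolding link_def GT_sigs_length[OF lam]
    using P_down_nonneg[OF lam] by (intro pmf_embed_pmf) auto
qed

lemma set_link: "lam \<in> GT_sigs (Suc n) \<Longrightarrow> set_pmf (link lam) \<subseteq> {\<mu>. interlaces \<mu> lam}"
  by (auto simp: set_pmf_eq pmf_link P_down_def split: if_splits)

lemma set_link_GT_sigs: "lam \<in> GT_sigs (Suc n) \<Longrightarrow> \<mu> \<in> set_pmf (link lam) \<Longrightarrow> \<mu> \<in> GT_sigs n"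
  using set_link interlaces_GT_sigs GT_sigs_length by blast

lemma finite_set_link: "lam \<in> GT_sigs (Suc n) \<Longrightarrow> finite (set_pmf (link lam))"
  using set_link finite_interlaces finite_subset by metis

primrec links :: "nat \<Rightarrow> int list \<Rightarrow> int list pmf" where
  "links 0 lam = return_pmf lam"
| "links (Suc d) lam = bind_pmf (link lam) (links d)"

lemma set_links:
  "lam \<in> GT_sigs (N + d) \<Longrightarrow> \<mu> \<in> set_pmf (links d lam) \<Longrightarrow>
    \<mu> \<in> GT_sigs N \<and> (\<forall>i<N. lam ! (i + d) \<le> \<mu> ! i \<and> \<mu> ! i \<le> lam ! i)"
proof (induction d arbitrary: lam)
  case (Suc d)
  then obtain \<kappa> where \<kappa>: "\<kappa> \<in> set_pmf (link lam)" "\<mu> \<in> set_pmf (links d \<kappa>)" by auto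
  have lam: "lam \<in> GT_sigs (Suc (N + d))" using Suc.prems by simp
  have \<kappa>': "\<kappa> \<in> GT_sigs (N + d)" "interlaces \<kappa> lam"
    using set_link_GT_sigs[OF lam \<kappa>(1)] set_link[OF lam] \<kappa>(1) by auto
  note IH = Suc.IH[OF \<kappa>'(1) \<kappa>(2)]
  have "lam ! Suc (i + d) \<le> \<kappa> ! (i + d)" "\<kappa> ! i \<le> lam ! i" if "i < N" for i
    using \<kappa>' that by (auto simp: interlaces_def GT_sigs_def)
  with IH show ?case by (auto intro: order.trans)
qed auto

lemma finite_set_links: "lam \<in> GT_sigs (N + d) \<Longrightarrow> finite (set_pmf (links d lam))"
proof (induction d arbitrary: lam)
  case (Suc d)
  then show ?case
    using set_link_GT_sigs[of lam "N + d"] finite_set_link[of lam "N + d"] by auto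
qed simp

lemma links_add: "links (a + b) lam = bind_pmf (links a lam) (links b)"
proof (induction a arbitrary: lam)
  case (Suc a)
  then have "links (a + b) = (\<lambda>\<kappa>. bind_pmf (links a \<kappa>) (links b))" by (rule ext)
  then show ?case by (simp add: bind_assoc_pmf)
qed (simp add: bind_return_pmf)

lemma links_Suc_right: "links (Suc d) lam = bind_pmf (links d lam) link"
proof -
  have "links 0 = return_pmf" by (rule ext) simp
  then have "links (Suc 0) = link" by (intro ext) (simp add: bind_return_pmf')
  then show ?thesis using links_add[of d "Suc 0" lam] by simp
qed

lemma P_downs_eq_links: "lam \<in> GT_sigs (N + d) \<Longrightarrow> P_downs q N d lam \<mu> = pmf (links d lam) \<mu>"
proof (induction d arbitrary: lam)
  case (Suc d)
  then have lam: "lam \<in> GT_sigs (Suc (N + d))" by simp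
  let ?S = "set_pmf (link lam)"
  have "P_downs q N (Suc d) lam \<mu> = (\<Sum>\<^sub>\<infinity>\<kappa>\<in>?S. P_down q (N + Suc d) lam \<kappa> * P_downs q N d \<kappa> \<mu>)"
    unfolding P_downs.simps using set_link_GT_sigs[OF lam]
    by (intro infsum_cong_neutral) (auto simp: set_pmf_eq pmf_link[OF lam])
  also have "\<dots> = (\<Sum>\<kappa>\<in>?S. pmf (links d \<kappa>) \<mu> * pmf (link lam) \<kappa>)"
    using finite_set_link[OF lam] set_link_GT_sigs[OF lam] Suc.IH by (auto simp: pmf_link[OF lam] intro!: sum.cong)
  also have "\<dots> = pmf (links (Suc d) lam) \<mu>"
    using finite_set_link[OF lam] by (simp add: pmf_bind, subst integral_measure_pmf_real[of ?S]) auto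
  finally show ?case .
qed (simp add: pmf_return indicator_def)

text \<open>Two factors \<open>1 / (1 - q)\<close> come from a single link, see
  \<open>sum_keeping_ge\<close>; the third sums a geometric series over the levels in
  \<open>links_keep_bottom\<close>.\<close>

definition decay :: real where
  "decay = 1 / ((1 - q) ^ 3 * q_euler)"

text \<open>A lower bound for the probability that the links from any level down to level \<open>k + r\<close> leave
  the bottom \<open>k\<close> coordinates unchanged.\<close>

definition keep_bound :: "nat \<Rightarrow> real" where
  "keep_bound r = exp (- (decay * q ^ r))"

lemma decay_pos: "decay > 0"
  using q_euler_pos q_less_1 by (simp add: decay_def)

lemma keep_bound_pos: "keep_bound r > 0" and keep_bound_le_1: "keep_bound r \<le> 1"
  using decay_pos q_pos by (simp_all add: keep_bound_def)

lemma keep_bound_tendsto: "keep_bound \<longlonglongrightarrow> 1"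
proof -
  have "(\<lambda>r. exp (- (decay * q ^ r))) \<longlonglongrightarrow> exp (- (decay * 0))"
    using q_pos q_less_1 by (intro tendsto_intros LIMSEQ_realpow_zero) auto
  then show ?thesis by (simp add: keep_bound_def[abs_def])
qed

lemma keep_bound_eventually:
  assumes "\<epsilon> > 0"
  shows "\<exists>r0. \<forall>r\<ge>r0. 1 - keep_bound r < \<epsilon>"
proof -
  have "eventually (\<lambda>r. 1 - \<epsilon> < keep_bound r) sequentially"
    using keep_bound_tendsto assms by (intro order_tendstoD) auto
  then show ?thesis unfolding eventually_sequentially by (auto simp: algebra_simps)
qed

lemma link_keeps_bottom:
  assumes lam: "lam \<in> GT_sigs (Suc n)" and k: "k \<le> n"
  shows "exp (- (decay * (1 - q) * q ^ (n - k))) \<le>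
    measure (measure_pmf (link lam)) {\<mu>. bottom k \<mu> = bottom k lam}"
proof -
  have "keeping lam k \<subseteq> {\<mu>. bottom k \<mu> = bottom k lam}"
  proof
    fix \<mu> assume \<mu>: "\<mu> \<in> keeping lam k"
    have len: "length \<mu> = n" "length lam = Suc n"
      using \<mu> GT_sigs_length[OF lam] by (auto simp: keeping_def interlaces_def)
    have "bottom k \<mu> = bottom k lam"
      using \<mu> len k by (intro nth_equalityI) (auto simp: nth_bottom keeping_def Suc_diff_le)
    then show "\<mu> \<in> {\<mu>. bottom k \<mu> = bottom k lam}" by simp
  qed
  then have "measure (measure_pmf (link lam)) (keeping lam k) \<le>
      measure (measure_pmf (link lam)) {\<mu>. bottom k \<mu> = bottom k lam}"
    by (intro measure_pmf.finite_measure_mono) auto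
  moreover have "decay * (1 - q) * q ^ (n - k) = q ^ (n - k) / ((1 - q)\<^sup>2 * q_euler)"
    using q_less_1 q_euler_pos by (simp add: decay_def power2_eq_square power3_eq_cube)
  ultimately show ?thesis
    using sum_keeping_ge[OF lam k] by (simp add: measure_measure_pmf_finite finite_keeping pmf_link[OF lam])
qed

text \<open>It suffices that every single link keeps the coordinates. The link into level
  \<open>M + m\<close> contributes the exponent \<open>q ^ (M + m - k)\<close>, which is summable
  over \<open>m\<close>, so the bound does not see the starting level.\<close>

lemma links_keep_bottom:
  assumes "lam \<in> GT_sigs (M + d)" and "k \<le> M"
  shows "keep_bound (M - k) \<le> measure (measure_pmf (links d lam)) {\<mu>. bottom k \<mu> = bottom k lam}"
proof -
  define c where "c = decay * (1 - q)"
  have c: "c > 0" using decay_pos q_less_1 by (simp add: c_def)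
  have "exp (- (c * (\<Sum>m<d. q ^ (M + m - k)))) \<le>
      measure (measure_pmf (links d lam)) {\<mu>. bottom k \<mu> = bottom k lam}"
    using assms(1)
  proof (induction d arbitrary: lam)
    case 0
    then show ?case by (simp add: measure_return_pmf)
  next
    case (Suc d)
    then have lam: "lam \<in> GT_sigs (Suc (M + d))" by simp
    let ?S = "{\<mu>. bottom k \<mu> = bottom k lam}"
    have "exp (- (c * (\<Sum>m<Suc d. q ^ (M + m - k)))) =
        exp (- (c * q ^ (M + d - k))) * exp (- (c * (\<Sum>m<d. q ^ (M + m - k))))"
      unfolding exp_add[symmetric] by (simp add: distrib_left)
    also have "\<dots> \<le> measure (measure_pmf (link lam)) ?S * exp (- (c * (\<Sum>m<d. q ^ (M + m - k))))"
      using link_keeps_bottom[OF lam, of k] assms(2) by (intro mult_right_mono) (auto simp: c_def)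
    also have "\<dots> \<le> measure (measure_pmf (bind_pmf (link lam) (links d))) ?S"
    proof (rule measure_bind_pmf_ge)
      fix \<kappa> assume "\<kappa> \<in> set_pmf (link lam)" "\<kappa> \<in> ?S"
      then show "exp (- (c * (\<Sum>m<d. q ^ (M + m - k)))) \<le> measure (measure_pmf (links d \<kappa>)) ?S"
        using Suc.IH[of \<kappa>] set_link_GT_sigs[OF lam] by auto
    qed (use c q_pos in \<open>auto intro!: mult_nonneg_nonneg sum_nonneg\<close>)
    finally show ?case by simp
  qed
  moreover have "c * (\<Sum>m<d. q ^ (M + m - k)) \<le> decay * q ^ (M - k)"
  proof -
    have "(\<Sum>m<d. q ^ (M + m - k)) = q ^ (M - k) * (\<Sum>m<d. q ^ m)"
      using assms(2) by (simp add: sum_distrib_left flip: power_add)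
    also have "\<dots> = q ^ (M - k) * ((1 - q ^ d) / (1 - q))"
      using q_less_1 by (simp add: sum_gp_strict)
    also have "\<dots> \<le> q ^ (M - k) * (1 / (1 - q))"
      using q_pos q_less_1 by (intro mult_left_mono divide_right_mono) auto
    finally have "c * (\<Sum>m<d. q ^ (M + m - k)) \<le> c * (q ^ (M - k) * (1 / (1 - q)))"
      using c by (intro mult_left_mono) auto
    then show ?thesis using q_less_1 by (simp add: c_def)
  qed
  ultimately show ?thesis unfolding keep_bound_def by (meson exp_le_cancel_iff neg_le_iff_le order_trans)
qed

section \<open>Projection to a fixed level and loss of memory\<close>

definition down :: "nat \<Rightarrow> int list \<Rightarrow> int list pmf" where
  "down N lam = links (length lam - N) lam"

lemma set_down: "lam \<in> GT_sigs K \<Longrightarrow> N \<le> K \<Longrightarrow> \<mu> \<in> set_pmf (down N lam) \<Longrightarrow> \<mu> \<in> GT_sigs N"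
  using set_links[of lam N "K - N"] by (simp add: down_def GT_sigs_length)

lemma down_keeps_bottom:
  "lam \<in> GT_sigs K \<Longrightarrow> k \<le> M \<Longrightarrow> M \<le> K \<Longrightarrow>
    keep_bound (M - k) \<le> measure (measure_pmf (down M lam)) {\<mu>. bottom k \<mu> = bottom k lam}"
  using links_keep_bottom[of lam M "K - M" k] by (simp add: down_def GT_sigs_length)

lemma down_down:
  assumes "lam \<in> GT_sigs K" "N \<le> M" "M \<le> K"
  shows "down N lam = bind_pmf (down M lam) (down N)"
proof -
  have "down N lam = bind_pmf (down M lam) (links (M - N))"
    using links_add[of "K - M" "M - N" lam] assms by (simp add: down_def GT_sigs_length)
  also have "\<dots> = bind_pmf (down M lam) (down N)"
  proof (intro bind_pmf_cong refl)
    fix \<kappa> assume "\<kappa> \<in> set_pmf (down M lam)"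
    then have "length \<kappa> = M" using set_down[OF assms(1,3)] GT_sigs_length by blast
    then show "links (M - N) \<kappa> = down N \<kappa>" by (simp add: down_def)
  qed
  finally show ?thesis .
qed

text \<open>\<open>D\<close> bounds twice the total variation distance of the two projections,
  whatever the starting levels. One inequality is enough because \<open>lam\<close> and
  \<open>lam'\<close> may be exchanged.\<close>

definition merging :: "nat \<Rightarrow> nat \<Rightarrow> real \<Rightarrow> bool" where
  "merging N k D \<longleftrightarrow> (\<forall>K K'. \<forall>lam\<in>GT_sigs K. \<forall>lam'\<in>GT_sigs K'. \<forall>f.
     k \<le> K \<longrightarrow> k \<le> K' \<longrightarrow> bottom k lam = bottom k lam' \<longrightarrow> (\<forall>x. \<bar>f x\<bar> \<le> 1) \<longrightarrow>
     expect (down N lam) f - expect (down N lam') f \<le> D)"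

text \<open>With positive probability two chains with the same bottom \<open>k'\<close> coordinates meet at level
  \<open>k'\<close>; if they do not, they still agree in the bottom \<open>k\<close> coordinates, up to a small
  probability.\<close>

lemma merging_step:
  assumes m: "merging N k D" and N: "N \<le> k" "k \<le> k'" and D: "D \<ge> 0"
  shows "merging N k' ((1 - (keep_bound 0)\<^sup>2) * D + 4 * (1 - keep_bound (k' - k)))"
  unfolding merging_def
proof (intro allI ballI impI)
  fix K K' lam lam' and f :: "int list \<Rightarrow> real"
  assume lam: "lam \<in> GT_sigs K" and lam': "lam' \<in> GT_sigs K'" and K: "k' \<le> K" "k' \<le> K'"
    and eq: "bottom k' lam = bottom k' lam'" and f: "\<forall>x. \<bar>f x\<bar> \<le> 1"
  define b where "b = bottom k' lam"
  define \<alpha> \<alpha>' where "\<alpha> = down k' lam" and "\<alpha>' = down k' lam'"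
  define g where "g \<kappa> = expect (down N \<kappa>) f" for \<kappa>
  define u :: "int list \<Rightarrow> real" where "u = indicator {b}"
  define s :: "int list \<Rightarrow> real" where "s = indicator (- {\<kappa>. bottom k \<kappa> = bottom k b})"
  have g: "\<bar>g \<kappa>\<bar> \<le> 1" for \<kappa> unfolding g_def using f by (intro abs_expect_le) auto
  have \<alpha>: "\<kappa> \<in> GT_sigs k'" if "\<kappa> \<in> set_pmf \<alpha>" for \<kappa> using that set_down[OF lam K(1)] by (simp add: \<alpha>_def)
  have \<alpha>': "\<kappa> \<in> GT_sigs k'" if "\<kappa> \<in> set_pmf \<alpha>'" for \<kappa> using that set_down[OF lam' K(2)] by (simp add: \<alpha>'_def)
  have Eg: "expect (down N \<kappa>) f = expect (down k' \<kappa>) g" if "\<kappa> \<in> GT_sigs L" "k' \<le> L" for \<kappa> L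
    unfolding g_def using down_down[OF that(1) _ that(2), of N] N f
    by (simp add: expect_bind[where C = 1])
  have b': "b = bottom k' lam'" by (simp add: b_def eq)
  have bb: "bottom k b = bottom k lam" "bottom k b = bottom k lam'"
    unfolding b_def using N K lam by (simp add: bottom_bottom GT_sigs_length)
      (unfold b_def[symmetric] b', use N K lam' in \<open>simp add: bottom_bottom GT_sigs_length\<close>)
  have int [simp]: "integrable (measure_pmf p) u" "integrable (measure_pmf p) s" "integrable (measure_pmf p) g" for p
    using g by (auto intro!: integrable_pmf_bounded[where C = 1] simp: u_def s_def indicator_def)
  \<comment> \<open>The two chains run independently down to level \<open>k'\<close>. Unless both
    hit \<open>b\<close>, the old bound \<open>D\<close> is charged; if one of them has lost its
    bottom \<open>k\<close> coordinates, the trivial bound 2 is charged.\<close>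
  have point: "g x - g y \<le> D * (1 - u x * u y) + 2 * s x + 2 * s y"
    if "x \<in> set_pmf \<alpha>" "y \<in> set_pmf \<alpha>'" for x y
  proof (cases "x = b \<and> y = b")
    case True
    then show ?thesis by (simp add: u_def s_def)
  next
    case False
    show ?thesis
    proof (cases "bottom k x = bottom k b \<and> bottom k y = bottom k b")
      case True
      then have "g x - g y \<le> D"
        unfolding g_def using m[unfolded merging_def, rule_format, of x k' y k' f] f N \<alpha>[OF that(1)] \<alpha>'[OF that(2)]
        by auto
      moreover have "u x * u y = 0" "s x = 0" "s y = 0"
        using True \<open>\<not> (x = b \<and> y = b)\<close> by (auto simp: u_def s_def)
      ultimately show ?thesis by auto
    next
      case False
      then have "2 \<le> 2 * s x + 2 * s y" by (auto simp: s_def)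
      moreover have "0 \<le> D * (1 - u x * u y)" using D by (auto simp: u_def indicator_def)
      ultimately show ?thesis using g[of x] g[of y] by linarith
    qed
  qed
  have inner: "g x - expect \<alpha>' g \<le> D * (1 - u x * expect \<alpha>' u) + 2 * s x + 2 * expect \<alpha>' s"
    if x: "x \<in> set_pmf \<alpha>" for x
  proof -
    have "g x - expect \<alpha>' g = expect \<alpha>' (\<lambda>y. g x - g y)" by simp
    also have "\<dots> \<le> expect \<alpha>' (\<lambda>y. D * (1 - u x * u y) + 2 * s x + 2 * s y)"
      using point[OF x] by (intro integral_mono_AE AE_pmfI) auto
    also have "\<dots> = D * (1 - u x * expect \<alpha>' u) + 2 * s x + 2 * expect \<alpha>' s" by simp
    finally show ?thesis .
  qed
  have "expect \<alpha> g - expect \<alpha>' g = expect \<alpha> (\<lambda>x. g x - expect \<alpha>' g)" by simp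
  also have "\<dots> \<le> expect \<alpha> (\<lambda>x. D * (1 - u x * expect \<alpha>' u) + 2 * s x + 2 * expect \<alpha>' s)"
    using inner by (intro integral_mono_AE AE_pmfI) auto
  also have "\<dots> = D * (1 - expect \<alpha> u * expect \<alpha>' u) + 2 * expect \<alpha> s + 2 * expect \<alpha>' s" by simp
  also have "\<dots> \<le> D * (1 - keep_bound 0 * keep_bound 0) + 2 * (1 - keep_bound (k' - k)) + 2 * (1 - keep_bound (k' - k))"
  proof -
    \<comment> \<open>At level \<open>k'\<close> the bottom \<open>k'\<close> coordinates are the
      whole signature, so keeping them means hitting \<open>b\<close>.\<close>
    have u_ge: "keep_bound 0 \<le> expect (down k' \<kappa>) u"
      if \<kappa>: "\<kappa> \<in> GT_sigs L" "k' \<le> L" "bottom k' \<kappa> = b" for \<kappa> L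
    proof -
      have "keep_bound 0 \<le> measure (measure_pmf (down k' \<kappa>)) {\<mu>. bottom k' \<mu> = bottom k' \<kappa>}"
        using down_keeps_bottom[OF \<kappa>(1) order.refl \<kappa>(2)] by simp
      also have "\<dots> = measure (measure_pmf (down k' \<kappa>)) {b}"
        using set_down[OF \<kappa>(1,2)] \<kappa>(3)
        by (intro measure_pmf.finite_measure_eq_AE AE_pmfI) (auto simp: GT_sigs_length)
      finally show ?thesis by (simp add: u_def)
    qed
    have s_le: "expect (down k' \<kappa>) s \<le> 1 - keep_bound (k' - k)"
      if \<kappa>: "\<kappa> \<in> GT_sigs L" "k' \<le> L" "bottom k b = bottom k \<kappa>" for \<kappa> L
    proof -
      have "expect (down k' \<kappa>) s = 1 - measure (measure_pmf (down k' \<kappa>)) {\<mu>. bottom k \<mu> = bottom k b}"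
        unfolding s_def by (simp add: measure_pmf.prob_compl[symmetric] Compl_eq_Diff_UNIV)
      then show ?thesis using down_keeps_bottom[OF \<kappa>(1) N(2) \<kappa>(2)] \<kappa>(3) by simp
    qed
    have "keep_bound 0 * keep_bound 0 \<le> expect \<alpha> u * expect \<alpha>' u"
      unfolding \<alpha>_def \<alpha>'_def
      using u_ge[OF lam K(1) b_def[symmetric]] u_ge[OF lam' K(2) b'[symmetric]] keep_bound_pos[of 0]
      by (intro mult_mono) auto
    moreover have "expect \<alpha> s \<le> 1 - keep_bound (k' - k)" "expect \<alpha>' s \<le> 1 - keep_bound (k' - k)"
      unfolding \<alpha>_def \<alpha>'_def by (rule s_le[OF lam K(1) bb(1)], rule s_le[OF lam' K(2) bb(2)])
    ultimately show ?thesis using D by (intro add_mono mult_left_mono) auto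
  qed
  finally show "expect (down N lam) f - expect (down N lam') f \<le>
      (1 - (keep_bound 0)\<^sup>2) * D + 4 * (1 - keep_bound (k' - k))"
    unfolding Eg[OF lam K(1)] Eg[OF lam' K(2)] \<alpha>_def[symmetric] \<alpha>'_def[symmetric]
    by (simp add: power2_eq_square algebra_simps)
qed

lemma merging_eventually:
  assumes "\<epsilon> > 0"
  shows "\<exists>k\<ge>N. merging N k \<epsilon>"
proof -
  \<comment> \<open>A merging step contracts by \<open>1 - 2 * c\<close>. Half of the gain is given
    up to absorb the additive error, which leaves the factor \<open>1 - c\<close>.\<close>
  define c where "c = (keep_bound 0)\<^sup>2 / 2"
  have c: "0 < c" "c \<le> 1 / 2"
    using keep_bound_pos[of 0] keep_bound_le_1[of 0] by (auto simp: c_def power_le_one)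
  have mono: "merging N k D'" if "merging N k D" "D \<le> D'" for k D D'
    using that unfolding merging_def by (meson order.trans)
  have "\<exists>k\<ge>N. merging N k (2 * (1 - c) ^ j)" for j
  proof (induction j)
    case 0
    have "merging N N 2"
      unfolding merging_def
    proof (intro allI ballI impI)
      fix lam lam' and f :: "int list \<Rightarrow> real" assume "\<forall>x. \<bar>f x\<bar> \<le> 1"
      then show "expect (down N lam) f - expect (down N lam') f \<le> 2"
        using abs_expect_le[of f 1 "down N lam"] abs_expect_le[of f 1 "down N lam'"] by auto
    qed
    then show ?case by auto
  next
    case (Suc j)
    then obtain k where k: "k \<ge> N" "merging N k (2 * (1 - c) ^ j)" by blast
    have pos: "c * (2 * (1 - c) ^ j) / 4 > 0" using c by simp
    from keep_bound_eventually[OF pos] obtain r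
      where r: "1 - keep_bound r < c * (2 * (1 - c) ^ j) / 4" by blast
    have "merging N (k + r) ((1 - (keep_bound 0)\<^sup>2) * (2 * (1 - c) ^ j) + 4 * (1 - keep_bound (k + r - k)))"
      using k c by (intro merging_step) auto
    moreover have "(1 - (keep_bound 0)\<^sup>2) * (2 * (1 - c) ^ j) + 4 * (1 - keep_bound (k + r - k)) \<le> 2 * (1 - c) ^ Suc j"
      using r by (simp add: c_def algebra_simps)
    ultimately show ?case using k mono by (intro exI[of _ "k + r"]) auto
  qed
  moreover have "(\<lambda>j. 2 * (1 - c) ^ j) \<longlonglongrightarrow> 2 * 0"
    using c by (intro tendsto_intros LIMSEQ_realpow_zero) auto
  then have "eventually (\<lambda>j. 2 * (1 - c) ^ j < \<epsilon>) sequentially"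
    using assms by (intro order_tendstoD) auto
  then obtain j where "2 * (1 - c) ^ j < \<epsilon>" by (auto simp: eventually_sequentially)
  ultimately show ?thesis using mono by (meson less_imp_le)
qed

end

section \<open>Boundary measures\<close>

context q_parameter
begin

text \<open>For monotone \<open>u\<close> the weights do form a probability mass function, see
  \<open>pmf_bdry\<close>, and the limit inside \<open>Ecal\<close> exists, see
  \<open>pmf_approx_tendsto\<close>.\<close>

definition bdry :: "(nat \<Rightarrow> int) \<Rightarrow> nat \<Rightarrow> int list pmf" where
  "bdry u N = embed_pmf (Ecal q u N)"

context
  fixes u :: "nat \<Rightarrow> int" and N :: nat
  assumes u: "mono u"
begin

definition approx :: "nat \<Rightarrow> int list pmf" where
  "approx d = links d (trunc u (N + d))"

lemma approx_eq_down: "approx d = down N (trunc u (N + d))"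
  by (simp add: approx_def down_def)

text \<open>Long truncations of \<open>u\<close> share their bottom \<open>k\<close> coordinates, so
  \<open>merging\<close> applies to them. The threshold is uniform in \<open>f\<close>, and this is
  what prevents loss of mass in \<open>pmf_bdry\<close>.\<close>

lemma approx_cauchy:
  assumes "\<epsilon> > 0"
  obtains d0 where "\<And>d d' f. d \<ge> d0 \<Longrightarrow> d' \<ge> d0 \<Longrightarrow> (\<And>x. \<bar>f x\<bar> \<le> 1) \<Longrightarrow>
    \<bar>expect (approx d) f - expect (approx d') f\<bar> \<le> \<epsilon>"
proof -
  obtain k where k: "merging N k \<epsilon>" using merging_eventually[OF assms] by blast
  have "expect (approx d) f - expect (approx d') f \<le> \<epsilon>" if "d \<ge> k" "d' \<ge> k" "\<And>x. \<bar>f x\<bar> \<le> 1" for d d' f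
    unfolding approx_eq_down
    by (rule k[unfolded merging_def, rule_format, of _ "N + d" _ "N + d'"])
       (use that trunc_GT_sigs[OF u] in \<open>auto simp: bottom_trunc\<close>)
  then show ?thesis by (intro that[of k]) (auto simp: abs_le_iff)
qed

lemma pmf_approx_tendsto: "(\<lambda>d. pmf (approx d) \<mu>) \<longlonglongrightarrow> Ecal q u N \<mu>"
proof -
  have "Cauchy (\<lambda>d. pmf (approx d) \<mu>)"
    unfolding Cauchy_altdef2
  proof (intro allI impI)
    fix e :: real assume "e > 0"
    then have "e / 2 > 0" by simp
    from approx_cauchy[OF this] obtain d0 where d0: "\<And>d d' f. d \<ge> d0 \<Longrightarrow> d' \<ge> d0 \<Longrightarrow>
      (\<And>x. \<bar>f x\<bar> \<le> 1) \<Longrightarrow> \<bar>expect (approx d) f - expect (approx d') f\<bar> \<le> e / 2" by blast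
    show "\<exists>d0. \<forall>d\<ge>d0. dist (pmf (approx d) \<mu>) (pmf (approx d0) \<mu>) < e"
      using d0[of _ d0 "indicator {\<mu>}"] \<open>e > 0\<close>
      by (intro exI[of _ d0]) (fastforce simp: pmf_eq_expect dist_real_def indicator_def)
  qed
  moreover have "P_downs q N d (rev (map u [0..<N + d])) \<mu> = pmf (approx d) \<mu>" for d
    using P_downs_eq_links[OF trunc_GT_sigs[OF u], of N d] by (simp add: approx_def trunc_def)
  ultimately show ?thesis
    by (simp add: Ecal_def Cauchy_convergent_iff convergent_LIMSEQ_iff)
qed

lemma Ecal_nonneg: "Ecal q u N \<mu> \<ge> 0"
  by (rule LIMSEQ_le_const[OF pmf_approx_tendsto]) auto

text \<open>Fatou's lemma bounds the total mass by 1. Conversely, the finite support of one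
  approximation carries almost all of the mass of every later one, hence of the limit.\<close>

lemma pmf_bdry: "pmf (bdry u N) \<mu> = Ecal q u N \<mu>"
proof -
  have "(\<integral>\<^sup>+\<mu>. ennreal (Ecal q u N \<mu>) \<partial>count_space UNIV) \<le> 1"
  proof -
    have lim: "ennreal (Ecal q u N \<mu>) = liminf (\<lambda>d. ennreal (pmf (approx d) \<mu>))" for \<mu>
      by (intro lim_imp_Liminf[symmetric] tendsto_ennrealI pmf_approx_tendsto) simp
    have "(\<integral>\<^sup>+\<mu>. ennreal (Ecal q u N \<mu>) \<partial>count_space UNIV) \<le>
        liminf (\<lambda>d. \<integral>\<^sup>+\<mu>. ennreal (pmf (approx d) \<mu>) \<partial>count_space UNIV)"
      unfolding lim by (rule nn_integral_liminf) simp
    then show ?thesis by (simp add: nn_integral_pmf_eq_1 Liminf_const)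
  qed
  moreover have "1 \<le> (\<integral>\<^sup>+\<mu>. ennreal (Ecal q u N \<mu>) \<partial>count_space UNIV)"
  proof (rule ennreal_le_epsilon)
    fix e :: real assume "e > 0"
    from approx_cauchy[OF this] obtain d0 where d0: "\<And>d d' f. d \<ge> d0 \<Longrightarrow> d' \<ge> d0 \<Longrightarrow>
      (\<And>x. \<bar>f x\<bar> \<le> 1) \<Longrightarrow> \<bar>expect (approx d) f - expect (approx d') f\<bar> \<le> e" by blast
    define F where "F = set_pmf (approx d0)"
    have F: "finite F"
      unfolding F_def approx_def by (rule finite_set_links[OF trunc_GT_sigs[OF u]])
    have "1 - e \<le> (\<Sum>\<mu>\<in>F. pmf (approx d) \<mu>)" if "d \<ge> d0" for d
    proof -
      have "measure (measure_pmf (approx d0)) F = 1"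
        by (simp add: F_def measure_pmf.prob_eq_1 AE_measure_pmf)
      moreover have "\<bar>expect (approx d) (indicator F) - expect (approx d0) (indicator F)\<bar> \<le> e"
        by (rule d0[OF that order.refl]) (auto simp: indicator_def)
      ultimately show ?thesis
        using F by (simp add: measure_measure_pmf_finite abs_le_iff)
    qed
    then have "1 - e \<le> (\<Sum>\<mu>\<in>F. Ecal q u N \<mu>)"
      by (intro LIMSEQ_le_const[OF tendsto_sum[OF pmf_approx_tendsto]]) auto
    then have "ennreal 1 \<le> ennreal ((\<Sum>\<mu>\<in>F. Ecal q u N \<mu>) + e)"
      by (intro ennreal_leI) simp
    also have "\<dots> = (\<Sum>\<mu>\<in>F. ennreal (Ecal q u N \<mu>)) + ennreal e"
      using \<open>e > 0\<close> by (simp add: ennreal_plus sum_nonneg Ecal_nonneg)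
    also have "(\<Sum>\<mu>\<in>F. ennreal (Ecal q u N \<mu>)) = (\<integral>\<^sup>+\<mu>. ennreal (Ecal q u N \<mu>) * indicator F \<mu> \<partial>count_space UNIV)"
      using F by (subst nn_integral_count_space'[of F]) (auto simp: indicator_def)
    also have "\<dots> \<le> (\<integral>\<^sup>+\<mu>. ennreal (Ecal q u N \<mu>) \<partial>count_space UNIV)"
      by (intro nn_integral_mono) (auto simp: indicator_def)
    finally show "1 \<le> (\<integral>\<^sup>+\<mu>. ennreal (Ecal q u N \<mu>) \<partial>count_space UNIV) + ennreal e"
      by (simp add: add_right_mono)
  qed
  ultimately show ?thesis
    unfolding bdry_def by (intro pmf_embed_pmf Ecal_nonneg antisym)
qed

lemma expect_approx_tendsto:
  "(\<And>x. \<bar>f x\<bar> \<le> C) \<Longrightarrow> (\<lambda>d. expect (approx d) f) \<longlonglongrightarrow> expect (bdry u N) f"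
  by (rule tendsto_expect_pmf) (simp_all add: pmf_bdry pmf_approx_tendsto)

text \<open>Merging compares \<open>lam\<close> with the truncations of \<open>u\<close>, which then
  grow. The bound is uniform over all signatures that agree with \<open>u\<close> in the bottom
  \<open>k\<close> coordinates.\<close>

lemma expect_down_bdry:
  assumes m: "merging N k \<epsilon>" and lam: "lam \<in> GT_sigs K" "k \<le> K" "bottom k lam = trunc u k"
    and f: "\<And>x. \<bar>f x\<bar> \<le> 1"
  shows "\<bar>expect (down N lam) f - expect (bdry u N) f\<bar> \<le> \<epsilon>"
proof -
  have "\<bar>expect (down N lam) f - expect (approx d) f\<bar> \<le> \<epsilon>" if "d \<ge> k" for d
  proof -
    note T = trunc_GT_sigs[OF u, of "N + d"]
    have eq: "bottom k lam = bottom k (trunc u (N + d))" using that lam by (simp add: bottom_trunc)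
    show ?thesis
      using m[unfolded merging_def, rule_format, of lam K _ _ f, OF lam(1) T lam(2) _ eq]
        m[unfolded merging_def, rule_format, of _ _ lam K f, OF T lam(1) _ lam(2) eq[symmetric]] that f
      by (auto simp: approx_eq_down abs_le_iff)
  qed
  then show ?thesis
    by (intro LIMSEQ_le_const2[OF tendsto_rabs[OF tendsto_diff[OF tendsto_const expect_approx_tendsto[OF f]]]]) auto
qed

lemma bdry_keeps_bottom:
  assumes k: "k \<le> N"
  shows "keep_bound (N - k) \<le> measure (measure_pmf (bdry u N)) {\<mu>. bottom k \<mu> = trunc u k}"
proof -
  let ?S = "{\<mu>. bottom k \<mu> = trunc u k}"
  have "keep_bound (N - k) \<le> expect (approx d) (indicator ?S)" for d
    using links_keep_bottom[OF trunc_GT_sigs[OF u] k] k by (simp add: approx_def bottom_trunc)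
  then have "keep_bound (N - k) \<le> expect (bdry u N) (indicator ?S)"
    by (intro LIMSEQ_le_const[OF expect_approx_tendsto[where C = 1]]) (auto simp: indicator_def)
  then show ?thesis by simp
qed

text \<open>A signature of positive limit weight has positive weight under some approximation, so
  the interlacing bounds of \<open>set_links\<close> pass to the limit.\<close>

lemma set_bdry:
  assumes "\<mu> \<in> set_pmf (bdry u N)"
  shows "\<mu> \<in> GT_sigs N" and "i < N \<Longrightarrow> trunc u N ! i \<le> \<mu> ! i"
    and "(\<And>j. u j \<le> L) \<Longrightarrow> i < N \<Longrightarrow> \<mu> ! i \<le> L"
proof -
  have "\<exists>d. \<mu> \<in> set_pmf (approx d)"
  proof (rule ccontr)
    assume "\<nexists>d. \<mu> \<in> set_pmf (approx d)"
    then have "pmf (approx d) \<mu> = 0" for d by (simp add: set_pmf_eq)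
    then have "Ecal q u N \<mu> = 0" using LIMSEQ_unique[OF pmf_approx_tendsto, of \<mu> 0] by simp
    then show False using assms by (simp add: set_pmf_eq pmf_bdry)
  qed
  then obtain d where d: "\<mu> \<in> set_pmf (links d (trunc u (N + d)))" by (auto simp: approx_def)
  note * = set_links[OF trunc_GT_sigs[OF u] d]
  show "\<mu> \<in> GT_sigs N" using * by simp
  show "trunc u N ! i \<le> \<mu> ! i" if "i < N" using * that by (auto simp: nth_trunc)
  show "\<mu> ! i \<le> L" if "\<And>j. u j \<le> L" "i < N"
    using * that(2) that(1)[of "N + d - Suc i"] by (fastforce simp: nth_trunc)
qed

end

lemma bdry_coherent:
  assumes u: "mono u"
  shows "bind_pmf (bdry u (Suc N)) link = bdry u N"
proof (rule pmf_eqI)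
  fix \<mu>
  have "(\<lambda>d. expect (approx u (Suc N) d) (\<lambda>\<kappa>. pmf (link \<kappa>) \<mu>)) \<longlonglongrightarrow>
      expect (bdry u (Suc N)) (\<lambda>\<kappa>. pmf (link \<kappa>) \<mu>)"
    by (rule expect_approx_tendsto[OF u, where C = 1]) (simp add: pmf_le_1)
  moreover have "expect (approx u (Suc N) d) (\<lambda>\<kappa>. pmf (link \<kappa>) \<mu>) = pmf (approx u N (Suc d)) \<mu>" for d
    using u by (simp add: approx_def links_Suc_right pmf_bind del: links.simps)
  ultimately have "(\<lambda>d. pmf (approx u N (Suc d)) \<mu>) \<longlonglongrightarrow> pmf (bind_pmf (bdry u (Suc N)) link) \<mu>"
    by (simp add: pmf_bind)
  moreover have "(\<lambda>d. pmf (approx u N (Suc d)) \<mu>) \<longlonglongrightarrow> pmf (bdry u N) \<mu>"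
    using LIMSEQ_Suc[OF pmf_approx_tendsto[OF u]] by (simp add: pmf_bdry[OF u])
  ultimately show "pmf (bind_pmf (bdry u (Suc N)) link) \<mu> = pmf (bdry u N) \<mu>"
    by (rule LIMSEQ_unique)
qed

text \<open>The measures on level \<open>N\<close> coming from the boundary are triangular with positive diagonal: a
  signature continued by repeating its top coordinate yields a measure supported on larger
  signatures with the same top coordinate.\<close>

lemma bdry_separates:
  assumes zero: "\<And>u. mono u \<Longrightarrow> expect (bdry u N) F = 0" and lam: "lam \<in> GT_sigs N" and N: "N \<ge> 1"
  shows "F lam = 0"
  using lam
proof (induction "nat (\<Sum>i<N. lam ! 0 - lam ! i)" arbitrary: lam rule: less_induct)
  \<comment> \<open>The total gap to the top coordinate drops strictly: any other signature in the
    support is larger in some coordinate and has the same top.\<close>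
  case less
  define u where "u j = (if j < N then lam ! (N - Suc j) else lam ! 0)" for j
  have le0: "lam ! i \<le> lam ! 0" if "i < N" for i
    using GT_sigs_nth_mono[OF less.prems, of 0 i] that by simp
  have u: "mono u"
    by (rule monoI) (use le0 GT_sigs_nth_mono[OF less.prems] in \<open>auto simp: u_def\<close>)
  have tr: "trunc u N = lam"
    using GT_sigs_length[OF less.prems] by (intro nth_equalityI) (auto simp: nth_trunc u_def)
  have uL: "u j \<le> lam ! 0" for j using le0 N by (auto simp: u_def)
  have other: "F \<kappa> = 0" if \<kappa>: "\<kappa> \<in> set_pmf (bdry u N)" "\<kappa> \<noteq> lam" for \<kappa>
  proof (rule less.hyps)
    note S = set_bdry[OF u \<kappa>(1), unfolded tr]
    show "\<kappa> \<in> GT_sigs N" by (rule S)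
    have top: "\<kappa> ! 0 = lam ! 0" using S(2)[of 0] S(3)[OF uL, of 0] N by simp
    have "\<exists>i<N. \<kappa> ! i \<noteq> lam ! i"
      using \<kappa>(2) GT_sigs_length[OF less.prems] GT_sigs_length[OF S(1)] by (auto simp: list_eq_iff_nth_eq)
    then have "(\<Sum>i<N. \<kappa> ! 0 - \<kappa> ! i) < (\<Sum>i<N. lam ! 0 - lam ! i)"
      using S(2) unfolding top by (intro sum_strict_mono_ex1) (auto intro: le_neq_trans[OF S(2)] dest: not_sym)
    moreover have "0 \<le> (\<Sum>i<N. \<kappa> ! 0 - \<kappa> ! i)"
      using S(3)[OF uL] unfolding top by (intro sum_nonneg) auto
    ultimately show "nat (\<Sum>i<N. \<kappa> ! 0 - \<kappa> ! i) < nat (\<Sum>i<N. lam ! 0 - lam ! i)" by simp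
  qed
  have "0 = expect (bdry u N) F" using zero[OF u] by simp
  also have "\<dots> = F lam * pmf (bdry u N) lam"
    using other by (subst integral_measure_pmf_real[of "{lam}"]) auto
  finally have "F lam * pmf (bdry u N) lam = 0" by simp
  moreover have "pmf (bdry u N) lam > 0"
  proof -
    have "measure (measure_pmf (bdry u N)) {\<mu>. bottom N \<mu> = trunc u N} = measure (measure_pmf (bdry u N)) {lam}"
      using set_bdry(1)[OF u] tr
      by (intro measure_pmf.finite_measure_eq_AE AE_pmfI) (auto simp: GT_sigs_length)
    then show ?thesis
      using bdry_keeps_bottom[OF u order.refl, of N] keep_bound_pos[of 0] by (simp add: measure_pmf_single)
  qed
  ultimately show ?case by simp
qed

end

section \<open>Mixtures and weak convergence\<close>

lemma space_NN: "space NN = {\<nu>. mono \<nu>}"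
  by (simp add: NN_def space_restrict_space)

lemma measurable_coordinate_NN: "{\<nu>\<in>space NN. \<nu> i = c} \<in> sets NN"
proof -
  have "(\<lambda>\<nu>. \<nu> i) \<in> NN \<rightarrow>\<^sub>M (borel :: int measure)"
    unfolding NN_def by (intro measurable_restrict_space1 measurable_product_coordinates)
  from measurable_sets[OF this, of "{c}"] show ?thesis
    by (simp add: vimage_def Int_def conj_commute)
qed

lemma measurable_trunc: "(\<lambda>\<nu>. trunc \<nu> k) \<in> NN \<rightarrow>\<^sub>M count_space UNIV"
proof (subst measurable_count_space_eq2_countable, intro conjI ballI)
  fix l :: "int list"
  have "(\<lambda>\<nu>. trunc \<nu> k) -` {l} \<inter> space NN = {\<nu>\<in>space NN. length l = k \<and> (\<forall>i\<in>{..<k}. \<nu> (k - Suc i) = l ! i)}"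
    by (auto simp: list_eq_iff_nth_eq nth_trunc)
  also have "\<dots> \<in> sets NN"
    by (intro sets.sets_Collect_conj sets.sets_Collect_const sets.sets_Collect_finite_All measurable_coordinate_NN) auto
  finally show "(\<lambda>\<nu>. trunc \<nu> k) -` {l} \<inter> space NN \<in> sets NN" .
qed auto

lemma measurable_of_trunc: "(\<lambda>\<nu>. h (trunc \<nu> k)) \<in> NN \<rightarrow>\<^sub>M borel"
  by (rule measurable_compose[OF measurable_trunc]) simp

lemma prob_algebra_NN:
  assumes "\<pi> \<in> space (prob_algebra NN)"
  shows "prob_space \<pi>" "sets \<pi> = sets NN" "space \<pi> = {\<nu>. mono \<nu>}"
  using assms sets_eq_imp_space_eq[of \<pi> NN] by (auto simp: space_prob_algebra space_NN)

lemma integrable_prob_NN: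
  fixes f :: "_ \<Rightarrow> real"
  assumes "\<pi> \<in> space (prob_algebra NN)" "f \<in> borel_measurable NN" "\<And>\<nu>. mono \<nu> \<Longrightarrow> \<bar>f \<nu>\<bar> \<le> C"
  shows "integrable \<pi> f"
proof -
  interpret prob_space \<pi> by (rule prob_algebra_NN(1)[OF assms(1)])
  have "f \<in> borel_measurable \<pi>"
    using assms(2) measurable_cong_sets[OF prob_algebra_NN(2)[OF assms(1)] refl] by blast
  then show ?thesis
    by (intro integrable_const_bound[where B = C]) (use assms prob_algebra_NN[OF assms(1)] in \<open>auto intro!: AE_I2\<close>)
qed

text \<open>Convergence along \<open>cylinders u\<close> is convergence at \<open>u\<close> of functions of signatures of growing
  length, signatures being compared with \<open>u\<close> through their bottom coordinates.\<close>

definition cylinder :: "(nat \<Rightarrow> int) \<Rightarrow> nat \<Rightarrow> int list set" where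
  "cylinder u k = {lam. k \<le> length lam \<and> lam \<in> GT_sigs (length lam) \<and> bottom k lam = trunc u k}"

definition cylinders :: "(nat \<Rightarrow> int) \<Rightarrow> int list filter" where
  "cylinders u = (INF k. principal (cylinder u k))"

lemma cylinder_antimono: "k \<le> k' \<Longrightarrow> cylinder u k' \<subseteq> cylinder u k"
  unfolding cylinder_def by (auto, metis bottom_bottom bottom_trunc)

lemma eventually_cylinders: "eventually P (cylinders u) \<longleftrightarrow> (\<exists>k. \<forall>lam\<in>cylinder u k. P lam)"
proof -
  have "eventually P (cylinders u) \<longleftrightarrow> (\<exists>k\<in>UNIV. eventually P (principal (cylinder u k)))"
    unfolding cylinders_def
  proof (rule eventually_INF_base)
    fix a b :: nat
    show "\<exists>k\<in>UNIV. principal (cylinder u k) \<le> inf (principal (cylinder u a)) (principal (cylinder u b))"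
      using cylinder_antimono[of a "max a b" u] cylinder_antimono[of b "max a b" u]
      by (intro bexI[of _ "max a b"]) auto
  qed simp
  then show ?thesis by (simp add: eventually_principal)
qed

lemma trunc_in_cylinder: "mono u \<Longrightarrow> k \<le> k' \<Longrightarrow> trunc u k' \<in> cylinder u k"
  by (simp add: cylinder_def trunc_GT_sigs bottom_trunc)

lemma filterlim_trunc: "mono u \<Longrightarrow> filterlim (trunc u) (cylinders u) sequentially"
  unfolding filterlim_iff eventually_cylinders eventually_sequentially
  using trunc_in_cylinder by blast

text \<open>An extended continuous mapping theorem. Convergence of \<open>f\<close> at every
  \<open>u\<close> implies that, for large \<open>k\<close>, the bottom \<open>k\<close> coordinates
  determine \<open>f\<close> up to a small error outside a set of small \<pi>-measure. With such a
  \<open>k\<close> fixed, the convergence of one marginal suffices.\<close>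

lemma expect_tendsto_of_marginals:
  assumes \<pi>: "\<pi> \<in> space (prob_algebra NN)"
    and supp: "\<And>k. eventually (\<lambda>i. \<forall>lam\<in>set_pmf (\<rho> i). k \<le> length lam \<and> lam \<in> GT_sigs (length lam)) F"
    and marg: "\<And>j h. (\<And>l. \<bar>h l\<bar> \<le> 1) \<Longrightarrow>
      ((\<lambda>i. expect (\<rho> i) (\<lambda>lam. h (bottom j lam))) \<longlongrightarrow> (\<integral>\<nu>. h (trunc \<nu> j) \<partial>\<pi>)) F"
    and f: "\<And>lam. \<bar>f lam\<bar> \<le> 1"
    and lim: "\<And>u. mono u \<Longrightarrow> (f \<longlongrightarrow> f' u) (cylinders u)"
  shows "((\<lambda>i. expect (\<rho> i) f) \<longlongrightarrow> (\<integral>\<nu>. f' \<nu> \<partial>\<pi>)) F"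
proof (rule tendstoI)
  fix e :: real assume e: "e > 0"
  \<comment> \<open>Five errors of this size are added below: three for replacing
    \<open>f lam\<close> by \<open>f (bottom k lam)\<close>, one for the marginal, one for replacing
    \<open>f (trunc \<nu> k)\<close> by \<open>f' \<nu>\<close>.\<close>
  define \<epsilon> where "\<epsilon> = e / 6"
  have \<epsilon>: "\<epsilon> > 0" using e by (simp add: \<epsilon>_def)
  interpret prob_space \<pi> by (rule prob_algebra_NN(1)[OF \<pi>])
  note sets_\<pi> = prob_algebra_NN(2)[OF \<pi>] and space_\<pi> = prob_algebra_NN(3)[OF \<pi>]
  have meas [measurable]: "(\<lambda>\<nu>. h (trunc \<nu> k)) \<in> borel_measurable \<pi>" for h :: "int list \<Rightarrow> real" and k
    using measurable_of_trunc[of h k] measurable_cong_sets[OF sets_\<pi> refl] by blast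
  \<comment> \<open>The oscillation of \<open>f\<close> is controlled over all signatures above
    \<open>b\<close> at once, of whatever length.\<close>
  define good where "good k = {b. \<forall>lam lam'. lam \<in> GT_sigs (length lam) \<longrightarrow> lam' \<in> GT_sigs (length lam') \<longrightarrow>
    k \<le> length lam \<longrightarrow> k \<le> length lam' \<longrightarrow> bottom k lam = b \<longrightarrow> bottom k lam' = b \<longrightarrow> \<bar>f lam - f lam'\<bar> \<le> \<epsilon>}" for k
  have f_lim: "(\<lambda>k. f (trunc u k)) \<longlonglongrightarrow> f' u" if "mono u" for u
    by (rule filterlim_compose[OF lim[OF that] filterlim_trunc[OF that]])
  have meas_f' [measurable]: "f' \<in> borel_measurable \<pi>"
    by (rule borel_measurable_LIMSEQ_real[where u = "\<lambda>k \<nu>. f (trunc \<nu> k)"]) (use f_lim space_\<pi> in auto)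
  have "(\<lambda>k. \<integral>\<nu>. f (trunc \<nu> k) \<partial>\<pi>) \<longlonglongrightarrow> (\<integral>\<nu>. f' \<nu> \<partial>\<pi>)"
    by (rule integral_dominated_convergence[where w = "\<lambda>_. 1"])
       (use f f_lim space_\<pi> in \<open>auto intro!: AE_I2\<close>)
  then have ev1: "eventually (\<lambda>k. \<bar>(\<integral>\<nu>. f (trunc \<nu> k) \<partial>\<pi>) - (\<integral>\<nu>. f' \<nu> \<partial>\<pi>)\<bar> < \<epsilon>) sequentially"
    using \<epsilon> by (auto dest!: tendstoD simp: dist_real_def)
  have good_lim: "(\<lambda>k. indicator (good k) (trunc u k) :: real) \<longlonglongrightarrow> 1" if u: "mono u" for u
  proof -
    have "eventually (\<lambda>lam. dist (f lam) (f' u) < \<epsilon> / 2) (cylinders u)"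
      by (rule tendstoD[OF lim[OF u]]) (use \<epsilon> in simp)
    then obtain k0 where k0: "\<bar>f lam - f' u\<bar> < \<epsilon> / 2" if "lam \<in> cylinder u k0" for lam
      unfolding eventually_cylinders by (auto simp: dist_real_def)
    have "trunc u k \<in> good k" if "k \<ge> k0" for k
      unfolding good_def
    proof (intro CollectI allI impI)
      fix lam lam' assume "lam \<in> GT_sigs (length lam)" "lam' \<in> GT_sigs (length lam')"
        "k \<le> length lam" "k \<le> length lam'" "bottom k lam = trunc u k" "bottom k lam' = trunc u k"
      then have "lam \<in> cylinder u k0" "lam' \<in> cylinder u k0"
        using cylinder_antimono[OF that, of u] by (auto simp: cylinder_def)
      from this[THEN k0] show "\<bar>f lam - f lam'\<bar> \<le> \<epsilon>" by linarith
    qed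
    then have "eventually (\<lambda>k. (indicator (good k) (trunc u k) :: real) = 1) sequentially"
      unfolding eventually_sequentially by (intro exI[of _ k0]) auto
    then show ?thesis by (rule tendsto_eventually)
  qed
  have "(\<lambda>k. \<integral>\<nu>. indicator (good k) (trunc \<nu> k) \<partial>\<pi>) \<longlonglongrightarrow> (\<integral>\<nu>. 1 \<partial>\<pi> :: real)"
    by (rule integral_dominated_convergence[where w = "\<lambda>_. 1"])
       (use good_lim space_\<pi> meas in \<open>auto intro!: AE_I2 simp: indicator_def\<close>)
  then have ev2: "eventually (\<lambda>k. (\<integral>\<nu>. indicator (good k) (trunc \<nu> k) \<partial>\<pi>) > 1 - \<epsilon>) sequentially"
    using \<epsilon> prob_space by (intro order_tendstoD) auto
  obtain k where k1: "\<bar>(\<integral>\<nu>. f (trunc \<nu> k) \<partial>\<pi>) - (\<integral>\<nu>. f' \<nu> \<partial>\<pi>)\<bar> < \<epsilon>"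
    and k2: "(\<integral>\<nu>. indicator (good k) (trunc \<nu> k) \<partial>\<pi>) > 1 - \<epsilon>"
    using eventually_happens'[OF sequentially_bot eventually_conj[OF ev1 ev2]] by blast
  have ev3: "eventually (\<lambda>i. expect (\<rho> i) (\<lambda>lam. indicator (good k) (bottom k lam)) > 1 - \<epsilon>) F"
    using marg[of "indicator (good k)" k] k2 by (intro order_tendstoD(1)) (auto simp: indicator_def)
  have "((\<lambda>i. expect (\<rho> i) (\<lambda>lam. f (bottom k lam))) \<longlongrightarrow> (\<integral>\<nu>. f (trunc \<nu> k) \<partial>\<pi>)) F"
    using f by (rule marg)
  then have ev4: "eventually (\<lambda>i. \<bar>expect (\<rho> i) (\<lambda>lam. f (bottom k lam)) - (\<integral>\<nu>. f (trunc \<nu> k) \<partial>\<pi>)\<bar> < \<epsilon>) F"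
    using \<epsilon> by (auto dest!: tendstoD simp: dist_real_def)
  show "eventually (\<lambda>i. dist (expect (\<rho> i) f) (\<integral>\<nu>. f' \<nu> \<partial>\<pi>) < e) F"
    using supp[of k] ev3 ev4
  proof eventually_elim
    fix i
    assume s: "\<forall>lam\<in>set_pmf (\<rho> i). k \<le> length lam \<and> lam \<in> GT_sigs (length lam)"
      and g: "1 - \<epsilon> < expect (\<rho> i) (\<lambda>lam. indicator (good k) (bottom k lam))"
      and m: "\<bar>expect (\<rho> i) (\<lambda>lam. f (bottom k lam)) - (\<integral>\<nu>. f (trunc \<nu> k) \<partial>\<pi>)\<bar> < \<epsilon>"
    define I :: "int list \<Rightarrow> real" where "I lam = indicator (good k) (bottom k lam)" for lam
    have int [simp]: "integrable (measure_pmf (\<rho> i)) f" "integrable (measure_pmf (\<rho> i)) (\<lambda>lam. f (bottom k lam))"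
      "integrable (measure_pmf (\<rho> i)) I"
      by (rule integrable_pmf_bounded[where C = 1], use f in \<open>auto simp: I_def indicator_def\<close>)+
    have "\<bar>expect (\<rho> i) f - expect (\<rho> i) (\<lambda>lam. f (bottom k lam))\<bar> =
        \<bar>expect (\<rho> i) (\<lambda>lam. f lam - f (bottom k lam))\<bar>" by simp
    also have "\<dots> \<le> expect (\<rho> i) (\<lambda>lam. \<bar>f lam - f (bottom k lam)\<bar>)"
      by (rule integral_abs_bound)
    also have "\<dots> \<le> expect (\<rho> i) (\<lambda>lam. \<epsilon> + 2 * (1 - I lam))"
    proof (intro integral_mono_AE AE_pmfI)
      fix lam assume "lam \<in> set_pmf (\<rho> i)"
      then have lam: "k \<le> length lam" "lam \<in> GT_sigs (length lam)" using s by auto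
      show "\<bar>f lam - f (bottom k lam)\<bar> \<le> \<epsilon> + 2 * (1 - I lam)"
      proof (cases "bottom k lam \<in> good k")
        case True
        then have "\<bar>f lam - f (bottom k lam)\<bar> \<le> \<epsilon>"
          unfolding good_def using lam bottom_GT_sigs[OF lam(2,1)] by simp
        then show ?thesis using True by (simp add: I_def)
      next
        case False
        then show ?thesis using f[of lam] f[of "bottom k lam"] \<epsilon> by (simp add: I_def)
      qed
    qed auto
    also have "\<dots> = \<epsilon> + 2 * (1 - expect (\<rho> i) I)" by simp
    also have "\<dots> \<le> 3 * \<epsilon>" using g by (simp add: I_def[abs_def])
    finally have "\<bar>expect (\<rho> i) f - expect (\<rho> i) (\<lambda>lam. f (bottom k lam))\<bar> \<le> 3 * \<epsilon>" .
    moreover have "e = 6 * \<epsilon>" by (simp add: \<epsilon>_def)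
    ultimately show "dist (expect (\<rho> i) f) (\<integral>\<nu>. f' \<nu> \<partial>\<pi>) < e"
      using m k1 \<epsilon> unfolding dist_real_def by linarith
  qed
qed

section \<open>Coherent systems as mixtures of boundary measures\<close>

context q_parameter
begin

lemma measurable_expect_bdry:
  assumes "\<And>x. \<bar>f x\<bar> \<le> C"
  shows "(\<lambda>\<nu>. expect (bdry \<nu> N) f) \<in> borel_measurable NN"
proof (rule borel_measurable_LIMSEQ_real)
  show "(\<lambda>d. expect (links d (trunc \<nu> (N + d))) f) \<longlonglongrightarrow> expect (bdry \<nu> N) f" if "\<nu> \<in> space NN" for \<nu>
    using expect_approx_tendsto[of \<nu> f C N] that assms by (simp add: space_NN approx_def)
  show "(\<lambda>\<nu>. expect (links d (trunc \<nu> (N + d))) f) \<in> borel_measurable NN" for d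
    by (rule measurable_of_trunc)
qed

lemma measurable_bdry: "(\<lambda>\<nu>. measure_pmf (bdry \<nu> N)) \<in> NN \<rightarrow>\<^sub>M subprob_algebra (count_space UNIV)"
proof (rule measurable_subprob_algebra)
  fix A :: "int list set"
  have "(\<lambda>\<nu>. ennreal (expect (bdry \<nu> N) (indicator A))) \<in> borel_measurable NN"
    by (intro measurable_compose[OF measurable_expect_bdry[where C = 1] measurable_ennreal]) (auto simp: indicator_def)
  then show "(\<lambda>\<nu>. emeasure (measure_pmf (bdry \<nu> N)) A) \<in> borel_measurable NN"
    by (simp add: measure_pmf.emeasure_eq_measure)
qed (auto simp: subprob_space_measure_pmf)

definition mix :: "(nat \<Rightarrow> int) measure \<Rightarrow> nat \<Rightarrow> int list pmf" where
  "mix \<pi> N = Abs_pmf (\<pi> \<bind> (\<lambda>\<nu>. measure_pmf (bdry \<nu> N)))"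

context
  fixes \<pi> :: "(nat \<Rightarrow> int) measure"
  assumes \<pi>: "\<pi> \<in> space (prob_algebra NN)"
begin

lemma measurable_bdry_prob: "(\<lambda>\<nu>. measure_pmf (bdry \<nu> N)) \<in> \<pi> \<rightarrow>\<^sub>M subprob_algebra (count_space UNIV)"
  using measurable_bdry measurable_cong_sets[OF prob_algebra_NN(2)[OF \<pi>] refl] by blast

lemma measure_pmf_mix: "measure_pmf (mix \<pi> N) = \<pi> \<bind> (\<lambda>\<nu>. measure_pmf (bdry \<nu> N))"
  unfolding mix_def
proof (rule Abs_pmf_inverse, intro CollectI conjI)
  let ?M = "\<pi> \<bind> (\<lambda>\<nu>. measure_pmf (bdry \<nu> N))"
  interpret \<pi>: prob_space \<pi> by (rule prob_algebra_NN(1)[OF \<pi>])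
  show P: "prob_space ?M"
    by (rule \<pi>.prob_space_bind[OF _ measurable_bdry_prob]) (auto intro!: AE_I2 measure_pmf.prob_space_axioms)
  show S: "sets ?M = UNIV"
    using \<pi>.not_empty by (subst sets_bind[where N = "count_space UNIV"]) auto
  interpret M: prob_space ?M by (rule P)
  show "AE x in ?M. measure ?M {x} \<noteq> 0"
    using S by (subst M.AE_support_countable) (auto intro!: exI[of _ UNIV])
qed

lemma expect_mix:
  assumes "\<And>x. \<bar>f x\<bar> \<le> C"
  shows "expect (mix \<pi> N) f = (\<integral>\<nu>. expect (bdry \<nu> N) f \<partial>\<pi>)"
proof -
  interpret \<pi>: prob_space \<pi> by (rule prob_algebra_NN(1)[OF \<pi>])
  show ?thesis
    unfolding measure_pmf_mix
    by (rule integral_bind[where K = "count_space UNIV" and B = C and B' = 1])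
       (use assms measurable_bdry_prob in \<open>auto simp: \<pi>.finite_measure_axioms measure_pmf.emeasure_le_1\<close>)
qed

lemma pmf_mix: "pmf (mix \<pi> N) \<mu> = E_q q \<pi> N \<mu>"
proof -
  have "pmf (mix \<pi> N) \<mu> = (\<integral>\<nu>. expect (bdry \<nu> N) (indicator {\<mu>}) \<partial>\<pi>)"
    unfolding pmf_eq_expect by (rule expect_mix[where C = 1]) (auto simp: indicator_def)
  also have "\<dots> = E_q q \<pi> N \<mu>"
    unfolding E_q_def
    by (intro Bochner_Integration.integral_cong refl)
       (simp add: prob_algebra_NN(3)[OF \<pi>] measure_pmf_single pmf_bdry)
  finally show ?thesis .
qed

lemma set_mix: "set_pmf (mix \<pi> N) \<subseteq> GT_sigs N"
proof
  fix \<mu> assume "\<mu> \<in> set_pmf (mix \<pi> N)"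
  then have "(\<integral>\<nu>. Ecal q \<nu> N \<mu> \<partial>\<pi>) \<noteq> 0" by (simp add: set_pmf_eq pmf_mix E_q_def)
  then obtain \<nu> where "\<nu> \<in> space \<pi>" "Ecal q \<nu> N \<mu> \<noteq> 0"
    by (metis (no_types, lifting) Bochner_Integration.integral_cong integral_zero)
  then have "mono \<nu>" "\<mu> \<in> set_pmf (bdry \<nu> N)"
    using prob_algebra_NN(3)[OF \<pi>] by (auto simp: set_pmf_eq pmf_bdry)
  then show "\<mu> \<in> GT_sigs N" by (rule set_bdry)
qed

lemma mix_coherent: "bind_pmf (mix \<pi> (Suc N)) link = mix \<pi> N"
proof (rule pmf_eqI)
  fix \<mu>
  have "pmf (bind_pmf (mix \<pi> (Suc N)) link) \<mu> =
      (\<integral>\<nu>. expect (bdry \<nu> (Suc N)) (\<lambda>\<kappa>. pmf (link \<kappa>) \<mu>) \<partial>\<pi>)"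
    unfolding pmf_bind by (rule expect_mix[where C = 1]) (simp add: pmf_le_1)
  also have "\<dots> = E_q q \<pi> N \<mu>"
    unfolding E_q_def
    by (intro Bochner_Integration.integral_cong refl)
       (simp add: prob_algebra_NN(3)[OF \<pi>] bdry_coherent pmf_bdry flip: pmf_bind)
  finally show "pmf (bind_pmf (mix \<pi> (Suc N)) link) \<mu> = pmf (mix \<pi> N) \<mu>" by (simp add: pmf_mix)
qed

lemma mix_bottom:
  assumes h: "\<And>l. \<bar>h l\<bar> \<le> 1" and k: "k \<le> N"
  shows "\<bar>expect (mix \<pi> N) (\<lambda>lam. h (bottom k lam)) - (\<integral>\<nu>. h (trunc \<nu> k) \<partial>\<pi>)\<bar> \<le> 2 * (1 - keep_bound (N - k))"
proof -
  interpret \<pi>: prob_space \<pi> by (rule prob_algebra_NN(1)[OF \<pi>])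
  let ?h = "\<lambda>lam. h (bottom k lam)"
  have int: "integrable \<pi> (\<lambda>\<nu>. expect (bdry \<nu> N) ?h)" "integrable \<pi> (\<lambda>\<nu>. h (trunc \<nu> k))"
    using h by (auto intro!: integrable_prob_NN[OF \<pi>, where C = 1] measurable_expect_bdry[where C = 1]
        measurable_of_trunc abs_expect_le)
  have "expect (mix \<pi> N) ?h - (\<integral>\<nu>. h (trunc \<nu> k) \<partial>\<pi>) = (\<integral>\<nu>. expect (bdry \<nu> N) ?h - h (trunc \<nu> k) \<partial>\<pi>)"
    using int h by (simp add: expect_mix[where C = 1])
  also have "\<bar>\<dots>\<bar> \<le> (\<integral>\<nu>. \<bar>expect (bdry \<nu> N) ?h - h (trunc \<nu> k)\<bar> \<partial>\<pi>)"
    by (rule integral_abs_bound)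
  also have "\<dots> \<le> (\<integral>\<nu>. 2 * (1 - keep_bound (N - k)) \<partial>\<pi>)"
  proof (rule integral_mono)
    fix \<nu> assume "\<nu> \<in> space \<pi>"
    then have \<nu>: "mono \<nu>" using prob_algebra_NN(3)[OF \<pi>] by simp
    show "\<bar>expect (bdry \<nu> N) ?h - h (trunc \<nu> k)\<bar> \<le> 2 * (1 - keep_bound (N - k))"
      by (rule expect_close_const[OF h h _ bdry_keeps_bottom[OF \<nu> k]]) simp
  qed (use int in auto)
  finally show ?thesis by (simp add: \<pi>.prob_space)
qed

text \<open>The coherent system recovers \<pi>: by \<open>mix_bottom\<close> its bottom coordinates
  have, in the limit, the law of the coordinates under \<pi>. It handles the initial distribution,
  as \<open>kernel_tendsto\<close> handles the transitions.\<close>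

lemma mix_tendsto:
  assumes "\<And>lam. \<bar>f lam\<bar> \<le> 1" and "\<And>u. mono u \<Longrightarrow> (f \<longlongrightarrow> f' u) (cylinders u)"
  shows "(\<lambda>N. expect (mix \<pi> N) f) \<longlonglongrightarrow> (\<integral>\<nu>. f' \<nu> \<partial>\<pi>)"
proof (rule expect_tendsto_of_marginals[OF \<pi> _ _ assms])
  show "\<forall>\<^sub>F N in sequentially. \<forall>lam\<in>set_pmf (mix \<pi> N). k \<le> length lam \<and> lam \<in> GT_sigs (length lam)" for k
    unfolding eventually_sequentially using set_mix by (intro exI[of _ k]) (auto simp: GT_sigs_def)
  fix j and h :: "int list \<Rightarrow> real" assume h: "\<And>l. \<bar>h l\<bar> \<le> 1"
  have "(\<lambda>N. keep_bound (N - j)) \<longlonglongrightarrow> 1"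
    using filterlim_compose[OF keep_bound_tendsto filterlim_minus_const_nat_at_top] .
  then have "(\<lambda>N. 2 * (1 - keep_bound (N - j))) \<longlonglongrightarrow> 2 * (1 - 1)"
    by (intro tendsto_intros)
  then have "(\<lambda>N. expect (mix \<pi> N) (\<lambda>lam. h (bottom j lam)) - (\<integral>\<nu>. h (trunc \<nu> j) \<partial>\<pi>)) \<longlonglongrightarrow> 0"
    by (rule Lim_null_comparison[rotated, OF tendsto_eq_rhs])
       (use mix_bottom[OF h] in \<open>auto simp: eventually_sequentially intro!: exI[of _ j]\<close>)
  then show "(\<lambda>N. expect (mix \<pi> N) (\<lambda>lam. h (bottom j lam))) \<longlonglongrightarrow> (\<integral>\<nu>. h (trunc \<nu> j) \<partial>\<pi>)"
    by (rule LIM_zero_cancel)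
qed

end

end

section \<open>Kernels intertwined with the links\<close>

text \<open>\<open>A\<close> acts on signatures of all lengths. The intertwining is assumed through
  the boundary measures, the form in which the defining property of \<open>P_inf\<close> provides
  it, and commutation with the links is derived from it.\<close>

locale boundary_kernel = q_parameter +
  fixes A :: "int list \<Rightarrow> int list pmf" and K :: "(nat \<Rightarrow> int) \<Rightarrow> (nat \<Rightarrow> int) measure"
  assumes set_A: "\<And>N lam. N \<ge> 1 \<Longrightarrow> lam \<in> GT_sigs N \<Longrightarrow> set_pmf (A lam) \<subseteq> GT_sigs N"
    and K_prob: "\<And>u. mono u \<Longrightarrow> K u \<in> space (prob_algebra NN)"
    and mix_K: "\<And>u N. mono u \<Longrightarrow> N \<ge> 1 \<Longrightarrow> mix (K u) N = bind_pmf (bdry u N) A"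
begin

text \<open>Both sides have the same average under \<open>bdry u (Suc N)\<close> for every \<open>u\<close>, because
  \<open>mix (K u)\<close> is coherent.\<close>

lemma link_commute:
  assumes lam: "lam \<in> GT_sigs (Suc N)" and N: "N \<ge> 1"
  shows "bind_pmf (A lam) link = bind_pmf (link lam) A"
proof (rule pmf_eqI)
  fix \<mu>
  let ?F = "\<lambda>\<kappa>. pmf (bind_pmf (A \<kappa>) link) \<mu> - pmf (bind_pmf (link \<kappa>) A) \<mu>"
  have "?F lam = 0"
  proof (rule bdry_separates[OF _ lam])
    fix u :: "nat \<Rightarrow> int" assume u: "mono u"
    have "expect (bdry u (Suc N)) ?F =
        pmf (bind_pmf (bdry u (Suc N)) (\<lambda>\<kappa>. bind_pmf (A \<kappa>) link)) \<mu> -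
        pmf (bind_pmf (bdry u (Suc N)) (\<lambda>\<kappa>. bind_pmf (link \<kappa>) A)) \<mu>"
      unfolding pmf_bind[of "bdry u (Suc N)"]
      by (intro Bochner_Integration.integral_diff integrable_pmf_bounded[where C = 1]) (simp_all add: pmf_le_1)
    also have "bind_pmf (bdry u (Suc N)) (\<lambda>\<kappa>. bind_pmf (A \<kappa>) link) = mix (K u) N"
      using mix_coherent[OF K_prob[OF u], of N] mix_K[OF u, of "Suc N"] by (simp add: bind_assoc_pmf)
    also have "bind_pmf (bdry u (Suc N)) (\<lambda>\<kappa>. bind_pmf (link \<kappa>) A) = mix (K u) N"
      using bdry_coherent[OF u, of N] mix_K[OF u N] by (simp flip: bind_assoc_pmf)
    finally show "expect (bdry u (Suc N)) ?F = 0" by simp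
  qed simp
  then show "pmf (bind_pmf (A lam) link) \<mu> = pmf (bind_pmf (link lam) A) \<mu>" by simp
qed

lemma links_commute:
  assumes "lam \<in> GT_sigs (N + d)" and "N \<ge> 1"
  shows "bind_pmf (A lam) (links d) = bind_pmf (links d lam) A"
  using assms(1)
proof (induction d arbitrary: lam)
  case 0
  have "links 0 = return_pmf" by (rule ext) simp
  then show ?case by (simp add: bind_return_pmf bind_return_pmf')
next
  case (Suc d)
  then have lam: "lam \<in> GT_sigs (Suc (N + d))" by simp
  have "links (Suc d) = (\<lambda>\<kappa>. bind_pmf (link \<kappa>) (links d))" by (rule ext) simp
  then have "bind_pmf (A lam) (links (Suc d)) = bind_pmf (bind_pmf (A lam) link) (links d)"
    by (simp add: bind_assoc_pmf)
  also have "\<dots> = bind_pmf (link lam) (\<lambda>\<kappa>. bind_pmf (A \<kappa>) (links d))"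
    using link_commute[OF lam] assms(2) by (simp add: bind_assoc_pmf)
  also have "\<dots> = bind_pmf (link lam) (\<lambda>\<kappa>. bind_pmf (links d \<kappa>) A)"
    by (rule bind_pmf_cong[OF refl], rule Suc.IH, rule set_link_GT_sigs[OF lam])
  also have "\<dots> = bind_pmf (links (Suc d) lam) A"
    by (simp add: bind_assoc_pmf)
  finally show ?case .
qed

text \<open>Three comparisons. Projecting the image of \<open>lam\<close> to level \<open>M\<close>
  mostly keeps its bottom \<open>j\<close> coordinates; by commutation the result is the kernel at
  level \<open>M\<close> applied to the projection of \<open>lam\<close>, which is \<epsilon>-close
  to \<open>bdry u M\<close>; and the bottom \<open>j\<close> coordinates under
  \<open>mix (K u) M\<close> almost have their law under \<open>K u\<close>.\<close>

lemma kernel_bottom: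
  assumes u: "mono u" and M: "1 \<le> M" "j \<le> M" "M \<le> k" and m: "merging M k \<epsilon>"
    and lam: "lam \<in> cylinder u k" and h: "\<And>l. \<bar>h l\<bar> \<le> 1"
  shows "\<bar>expect (A lam) (\<lambda>\<kappa>. h (bottom j \<kappa>)) - (\<integral>\<nu>. h (trunc \<nu> j) \<partial>K u)\<bar> \<le> \<epsilon> + 4 * (1 - keep_bound (M - j))"
proof -
  define d where "d = length lam - M"
  let ?h = "\<lambda>\<kappa>. h (bottom j \<kappa>)"
  have lam': "lam \<in> GT_sigs (M + d)" "k \<le> M + d" "bottom k lam = trunc u k"
    using lam M by (auto simp: cylinder_def d_def)
  have Alam: "\<kappa> \<in> GT_sigs (M + d)" if "\<kappa> \<in> set_pmf (A lam)" for \<kappa>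
    using set_A[OF _ lam'(1)] M that by auto
  have int: "integrable (measure_pmf p) (\<lambda>\<kappa>. expect (r \<kappa>) ?h)" "integrable (measure_pmf p) ?h" for p r
    using h by (auto intro!: integrable_pmf_bounded[where C = 1] abs_expect_le)
  have 1: "\<bar>expect (bind_pmf (A lam) (links d)) ?h - expect (A lam) ?h\<bar> \<le> 2 * (1 - keep_bound (M - j))"
  proof -
    have "expect (bind_pmf (A lam) (links d)) ?h - expect (A lam) ?h =
        expect (A lam) (\<lambda>\<kappa>. expect (links d \<kappa>) ?h - ?h \<kappa>)"
      using h int by (simp add: expect_bind[where C = 1])
    also have "\<bar>\<dots>\<bar> \<le> expect (A lam) (\<lambda>\<kappa>. \<bar>expect (links d \<kappa>) ?h - ?h \<kappa>\<bar>)"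
      by (rule integral_abs_bound)
    also have "\<dots> \<le> expect (A lam) (\<lambda>_. 2 * (1 - keep_bound (M - j)))"
    proof (intro integral_mono_AE AE_pmfI)
      fix \<kappa> assume "\<kappa> \<in> set_pmf (A lam)"
      note keep = links_keep_bottom[OF Alam[OF this] M(2)]
      show "\<bar>expect (links d \<kappa>) ?h - ?h \<kappa>\<bar> \<le> 2 * (1 - keep_bound (M - j))"
        by (rule expect_close_const[OF h h _ keep]) simp
    qed (use int in auto)
    finally show ?thesis by simp
  qed
  \<comment> \<open>The expectation of \<open>?h\<close> under \<open>A \<kappa>\<close> is again a
    function of \<kappa> bounded by 1, so merging applies to it with the same \<epsilon>.\<close>
  have 2: "\<bar>expect (bind_pmf (links d lam) A) ?h - expect (bind_pmf (bdry u M) A) ?h\<bar> \<le> \<epsilon>"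
  proof -
    have "down M lam = links d lam" by (simp add: down_def d_def)
    then show ?thesis
      using expect_down_bdry[OF u m lam'(1,2,3), of "\<lambda>\<kappa>. expect (A \<kappa>) ?h"] h
      by (simp add: expect_bind[where C = 1] abs_expect_le)
  qed
  have "\<bar>expect (mix (K u) M) ?h - (\<integral>\<nu>. h (trunc \<nu> j) \<partial>K u)\<bar> \<le> 2 * (1 - keep_bound (M - j))"
    by (rule mix_bottom[OF K_prob[OF u] h M(2)])
  then show ?thesis
    using 1 2 unfolding links_commute[OF lam'(1) M(1)] mix_K[OF u M(1)] by linarith
qed

text \<open>Hypothesis and conclusion have the same form, with \<open>f\<close> replaced by its
  image under the kernel; this is what allows iteration over the time steps.\<close>

lemma kernel_tendsto:
  assumes f: "\<And>lam. \<bar>f lam\<bar> \<le> 1" and lim: "\<And>u. mono u \<Longrightarrow> (f \<longlongrightarrow> f' u) (cylinders u)" and u: "mono u"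
  shows "((\<lambda>lam. expect (A lam) f) \<longlongrightarrow> (\<integral>\<nu>. f' \<nu> \<partial>K u)) (cylinders u)"
proof (rule expect_tendsto_of_marginals[OF K_prob[OF u] _ _ f lim])
  show "\<forall>\<^sub>F lam in cylinders u. \<forall>\<kappa>\<in>set_pmf (A lam). k \<le> length \<kappa> \<and> \<kappa> \<in> GT_sigs (length \<kappa>)" for k
    unfolding eventually_cylinders
  proof (intro exI[of _ "Suc k"] ballI)
    fix lam \<kappa> assume lam: "lam \<in> cylinder u (Suc k)" and "\<kappa> \<in> set_pmf (A lam)"
    then have "\<kappa> \<in> GT_sigs (length lam)"
      using set_A[of "length lam" lam] by (auto simp: cylinder_def)
    then show "k \<le> length \<kappa> \<and> \<kappa> \<in> GT_sigs (length \<kappa>)"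
      using lam by (auto simp: cylinder_def GT_sigs_length)
  qed
  fix j and h :: "int list \<Rightarrow> real" assume h: "\<And>l. \<bar>h l\<bar> \<le> 1"
  show "((\<lambda>lam. expect (A lam) (\<lambda>\<kappa>. h (bottom j \<kappa>))) \<longlongrightarrow> (\<integral>\<nu>. h (trunc \<nu> j) \<partial>K u)) (cylinders u)"
  proof (rule tendstoI)
    fix e :: real assume e: "e > 0"
    then have "e / 8 > 0" by simp
    from keep_bound_eventually[OF this] obtain r where r: "1 - keep_bound r < e / 8" by blast
    \<comment> \<open>\<open>Suc\<close> ensures \<open>1 \<le> M\<close>, where commutation is
      available. The total error is below \<open>e / 8 + 4 * (e / 8)\<close>.\<close>
    define M where "M = Suc j + r"
    have "1 - keep_bound (M - j) < e / 8"
    proof -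
      have "decay * q ^ Suc r \<le> decay * q ^ r"
        using decay_pos q_pos q_less_1 by (intro mult_left_mono) (auto simp: mult_left_le_one_le)
      then have "keep_bound r \<le> keep_bound (Suc r)" by (simp add: keep_bound_def)
      then show ?thesis using r by (simp add: M_def Suc_diff_le)
    qed
    moreover obtain k where k: "k \<ge> M" "merging M k (e / 8)" using merging_eventually[of "e / 8" M] e by auto
    ultimately have "dist (expect (A lam) (\<lambda>\<kappa>. h (bottom j \<kappa>))) (\<integral>\<nu>. h (trunc \<nu> j) \<partial>K u) < e"
      if "lam \<in> cylinder u k" for lam
      using kernel_bottom[OF u _ _ k that, of j h] h e by (simp add: M_def dist_real_def)
    then show "\<forall>\<^sub>F lam in cylinders u. dist (expect (A lam) (\<lambda>\<kappa>. h (bottom j \<kappa>))) (\<integral>\<nu>. h (trunc \<nu> j) \<partial>K u) < e"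
      unfolding eventually_cylinders by blast
  qed
qed

end

section \<open>Path probabilities of Markov processes\<close>

text \<open>This version matches the \<open>emeasure\<close> in the Markov property;
  \<open>path_prob\<close> below is the real one to which the convergence lemmas apply.\<close>

primrec path_weight :: "(nat \<Rightarrow> 's set) \<Rightarrow> (nat \<Rightarrow> 's \<Rightarrow> 's measure) \<Rightarrow> nat \<Rightarrow> nat \<Rightarrow> 's \<Rightarrow> ennreal" where
  "path_weight A K 0 t x = indicator (A t) x"
| "path_weight A K (Suc r) t x = indicator (A t) x * (\<integral>\<^sup>+y. path_weight A K r (Suc t) y \<partial>K t x)"

lemma measurable_path_weight:
  assumes "\<And>t. K t \<in> S \<rightarrow>\<^sub>M prob_algebra S" "\<And>t. A t \<in> sets S"
  shows "path_weight A K r t \<in> borel_measurable S"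
proof (induction r arbitrary: t)
  case 0
  have "path_weight A K 0 t = indicator (A t)" by (rule ext) simp
  then show ?case using borel_measurable_indicator[OF assms(2)[of t]] by simp
next
  case (Suc r)
  have "(\<lambda>x. \<integral>\<^sup>+y. path_weight A K r (Suc t) y \<partial>K t x) \<in> borel_measurable S"
    by (rule measurable_compose[OF measurable_prob_algebraD[OF assms(1)]
          nn_integral_measurable_subprob_algebra[OF Suc.IH]])
  from borel_measurable_times_ennreal[OF borel_measurable_indicator[OF assms(2)[of t]] this]
  have "(\<lambda>x. path_weight A K (Suc r) t x) \<in> borel_measurable S" unfolding path_weight.simps .
  then show ?case .
qed

text \<open>Weighting \<Omega> by the indicator of the past event turns the Markov property for sets
  into an equality of two measures on \<open>S\<close>, and equal measures integrate every
  \<open>f\<close> alike.\<close>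

lemma markov_process_nn_integral:
  assumes M: "markov_process \<Omega> S init K X" and A: "\<And>s. s \<le> t \<Longrightarrow> A s \<in> sets S"
    and f: "f \<in> borel_measurable S"
  shows "(\<integral>\<^sup>+\<omega>. indicator {\<omega>\<in>space \<Omega>. \<forall>s\<le>t. X s \<omega> \<in> A s} \<omega> * f (X (Suc t) \<omega>) \<partial>\<Omega>) =
    (\<integral>\<^sup>+\<omega>. indicator {\<omega>\<in>space \<Omega>. \<forall>s\<le>t. X s \<omega> \<in> A s} \<omega> * (\<integral>\<^sup>+y. f y \<partial>K t (X t \<omega>)) \<partial>\<Omega>)"
proof -
  let ?H = "{\<omega>\<in>space \<Omega>. \<forall>s\<le>t. X s \<omega> \<in> A s}"
  let ?D = "density \<Omega> (indicator ?H)"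
  note M' = M[unfolded markov_process_def]
  interpret prob_space \<Omega> using M' by simp
  have X [measurable]: "X s \<in> \<Omega> \<rightarrow>\<^sub>M S" and K: "K s \<in> S \<rightarrow>\<^sub>M prob_algebra S" for s using M' by auto
  have "?H = {\<omega>\<in>space \<Omega>. \<forall>s\<in>{..t}. X s \<omega> \<in> A s}" by auto
  also have "\<dots> \<in> sets \<Omega>"
    by (intro sets.sets_Collect_finite_All measurable_sets_Collect[OF X]) (use A in auto)
  finally have H [measurable]: "?H \<in> sets \<Omega>" .
  have HI: "(indicator ?H :: _ \<Rightarrow> ennreal) \<in> borel_measurable \<Omega>"
    using H by (rule borel_measurable_indicator)
  have K': "(\<lambda>\<omega>. K t (X t \<omega>)) \<in> ?D \<rightarrow>\<^sub>M subprob_algebra S"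
    using measurable_compose[OF X measurable_prob_algebraD[OF K]] by simp
  have X': "X s \<in> ?D \<rightarrow>\<^sub>M S" for s using X by simp
  have ne: "space ?D \<noteq> {}" using not_empty by simp
  have meas_em: "(\<lambda>\<omega>. emeasure (K t (X t \<omega>)) B) \<in> borel_measurable \<Omega>" if "B \<in> sets S" for B
    using measurable_compose[OF K' measurable_emeasure_subprob_algebra[OF that]] by simp
  have "distr ?D S (X (Suc t)) = ?D \<bind> (\<lambda>\<omega>. K t (X t \<omega>))"
  proof (rule measure_eqI)
    show "sets (distr ?D S (X (Suc t))) = sets (?D \<bind> (\<lambda>\<omega>. K t (X t \<omega>)))"
      using sets_bind[OF sets_kernel[OF K'] ne] by simp
    fix B assume "B \<in> sets (distr ?D S (X (Suc t)))"
    then have B: "B \<in> sets S" by simp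
    have "emeasure (distr ?D S (X (Suc t))) B = emeasure ?D (X (Suc t) -` B \<inter> space \<Omega>)"
      using B X' by (subst emeasure_distr) auto
    also have "\<dots> = (\<integral>\<^sup>+\<omega>. indicator ?H \<omega> * indicator (X (Suc t) -` B \<inter> space \<Omega>) \<omega> \<partial>\<Omega>)"
      by (rule emeasure_density[OF HI measurable_sets[OF X B]])
    also have "\<dots> = (\<integral>\<^sup>+\<omega>. indicator {\<omega>\<in>space \<Omega>. (\<forall>s\<le>t. X s \<omega> \<in> A s) \<and> X (Suc t) \<omega> \<in> B} \<omega> \<partial>\<Omega>)"
      by (intro nn_integral_cong) (auto simp: indicator_def)
    also have "\<dots> = emeasure \<Omega> {\<omega>\<in>space \<Omega>. (\<forall>s\<le>t. X s \<omega> \<in> A s) \<and> X (Suc t) \<omega> \<in> B}"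
    proof (rule nn_integral_indicator)
      have "{\<omega>\<in>space \<Omega>. (\<forall>s\<le>t. X s \<omega> \<in> A s) \<and> X (Suc t) \<omega> \<in> B} = ?H \<inter> (X (Suc t) -` B \<inter> space \<Omega>)" by auto
      then show "{\<omega>\<in>space \<Omega>. (\<forall>s\<le>t. X s \<omega> \<in> A s) \<and> X (Suc t) \<omega> \<in> B} \<in> sets \<Omega>"
        by (simp only: sets.Int[OF H measurable_sets[OF X B]])
    qed
    also have "\<dots> = (\<integral>\<^sup>+\<omega>\<in>?H. emeasure (K t (X t \<omega>)) B \<partial>\<Omega>)"
      by (rule conjunct2[OF conjunct2[OF conjunct2[OF conjunct2[OF M']]], THEN spec, THEN spec, THEN bspec, THEN mp])
        (use A B in auto)
    also have "\<dots> = (\<integral>\<^sup>+\<omega>. indicator ?H \<omega> * emeasure (K t (X t \<omega>)) B \<partial>\<Omega>)"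
      by (simp add: mult.commute)
    also have "\<dots> = (\<integral>\<^sup>+\<omega>. emeasure (K t (X t \<omega>)) B \<partial>?D)"
      by (rule nn_integral_density[symmetric, OF HI meas_em[OF B]])
    also have "\<dots> = emeasure (?D \<bind> (\<lambda>\<omega>. K t (X t \<omega>))) B"
      by (rule emeasure_bind[symmetric, OF ne K' B])
    finally show "emeasure (distr ?D S (X (Suc t))) B = emeasure (?D \<bind> (\<lambda>\<omega>. K t (X t \<omega>))) B" .
  qed
  then have "(\<integral>\<^sup>+y. f y \<partial>distr ?D S (X (Suc t))) = (\<integral>\<^sup>+y. f y \<partial>(?D \<bind> (\<lambda>\<omega>. K t (X t \<omega>))))" by simp
  moreover have "(\<integral>\<^sup>+y. f y \<partial>distr ?D S (X (Suc t))) = (\<integral>\<^sup>+\<omega>. indicator ?H \<omega> * f (X (Suc t) \<omega>) \<partial>\<Omega>)"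
  proof -
    have "(\<integral>\<^sup>+y. f y \<partial>distr ?D S (X (Suc t))) = (\<integral>\<^sup>+\<omega>. f (X (Suc t) \<omega>) \<partial>?D)"
      by (rule nn_integral_distr[OF X']) (simp add: f)
    also have "\<dots> = (\<integral>\<^sup>+\<omega>. indicator ?H \<omega> * f (X (Suc t) \<omega>) \<partial>\<Omega>)"
      by (rule nn_integral_density[OF HI measurable_compose[OF X f]])
    finally show ?thesis .
  qed
  moreover have "(\<integral>\<^sup>+y. f y \<partial>(?D \<bind> (\<lambda>\<omega>. K t (X t \<omega>)))) =
      (\<integral>\<^sup>+\<omega>. indicator ?H \<omega> * (\<integral>\<^sup>+y. f y \<partial>K t (X t \<omega>)) \<partial>\<Omega>)"
  proof -
    have "(\<lambda>\<omega>. \<integral>\<^sup>+y. f y \<partial>K t (X t \<omega>)) \<in> borel_measurable \<Omega>"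
      using measurable_compose[OF K' nn_integral_measurable_subprob_algebra[OF f]] by simp
    then show ?thesis unfolding nn_integral_bind[OF f K'] by (rule nn_integral_density[OF HI])
  qed
  ultimately show ?thesis by (simp only:)
qed

text \<open>The final time \<open>t + r\<close> stays fixed while the split between past and
  remaining steps moves back by one: the hypothesis is used at \<open>Suc t\<close>, and the
  transition out of time \<open>t\<close> is then integrated.\<close>

lemma markov_process_path:
  assumes M: "markov_process \<Omega> S init K X" and A: "\<And>s. A s \<in> sets S"
  shows "emeasure \<Omega> {\<omega>\<in>space \<Omega>. \<forall>s\<le>t + r. X s \<omega> \<in> A s} =
    (\<integral>\<^sup>+\<omega>. indicator {\<omega>\<in>space \<Omega>. \<forall>s<t. X s \<omega> \<in> A s} \<omega> * path_weight A K r t (X t \<omega>) \<partial>\<Omega>)"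
proof (induction r arbitrary: t)
  case 0
  have X: "X s \<in> \<Omega> \<rightarrow>\<^sub>M S" for s using M by (auto simp: markov_process_def)
  have "{\<omega>\<in>space \<Omega>. \<forall>s\<le>t. X s \<omega> \<in> A s} = {\<omega>\<in>space \<Omega>. \<forall>s\<in>{..t}. X s \<omega> \<in> A s}" by auto
  also have "\<dots> \<in> sets \<Omega>"
    by (intro sets.sets_Collect_finite_All measurable_sets_Collect[OF X]) (use A in auto)
  finally have "emeasure \<Omega> {\<omega>\<in>space \<Omega>. \<forall>s\<le>t. X s \<omega> \<in> A s} =
      (\<integral>\<^sup>+\<omega>. indicator {\<omega>\<in>space \<Omega>. \<forall>s\<le>t. X s \<omega> \<in> A s} \<omega> \<partial>\<Omega>)"
    by (rule nn_integral_indicator[symmetric])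
  also have "\<dots> = (\<integral>\<^sup>+\<omega>. indicator {\<omega>\<in>space \<Omega>. \<forall>s<t. X s \<omega> \<in> A s} \<omega> * path_weight A K 0 t (X t \<omega>) \<partial>\<Omega>)"
    by (intro nn_integral_cong) (auto simp: indicator_def le_less)
  finally show ?case by simp
next
  case (Suc r)
  have K: "K s \<in> S \<rightarrow>\<^sub>M prob_algebra S" for s using M by (auto simp: markov_process_def)
  have "emeasure \<Omega> {\<omega>\<in>space \<Omega>. \<forall>s\<le>t + Suc r. X s \<omega> \<in> A s} =
      (\<integral>\<^sup>+\<omega>. indicator {\<omega>\<in>space \<Omega>. \<forall>s\<le>t. X s \<omega> \<in> A s} \<omega> * path_weight A K r (Suc t) (X (Suc t) \<omega>) \<partial>\<Omega>)"
    using Suc.IH[of "Suc t"] by (simp add: less_Suc_eq_le)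
  also have "\<dots> = (\<integral>\<^sup>+\<omega>. indicator {\<omega>\<in>space \<Omega>. \<forall>s\<le>t. X s \<omega> \<in> A s} \<omega> *
      (\<integral>\<^sup>+y. path_weight A K r (Suc t) y \<partial>K t (X t \<omega>)) \<partial>\<Omega>)"
    by (rule markov_process_nn_integral[OF M A measurable_path_weight[OF K A]])
  also have "\<dots> = (\<integral>\<^sup>+\<omega>. indicator {\<omega>\<in>space \<Omega>. \<forall>s<t. X s \<omega> \<in> A s} \<omega> * path_weight A K (Suc r) t (X t \<omega>) \<partial>\<Omega>)"
    by (intro nn_integral_cong) (auto simp: indicator_def le_less)
  finally show ?case .
qed

lemma markov_process_path_init:
  assumes M: "markov_process \<Omega> S init K X" and A: "\<And>s. A s \<in> sets S"
  shows "emeasure \<Omega> {\<omega>\<in>space \<Omega>. \<forall>s\<le>r. X s \<omega> \<in> A s} = (\<integral>\<^sup>+x. path_weight A K r 0 x \<partial>init)"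
proof -
  have X: "X 0 \<in> \<Omega> \<rightarrow>\<^sub>M S" and K: "\<And>s. K s \<in> S \<rightarrow>\<^sub>M prob_algebra S" and init: "distr \<Omega> S (X 0) = init"
    using M by (auto simp: markov_process_def)
  have "emeasure \<Omega> {\<omega>\<in>space \<Omega>. \<forall>s\<le>r. X s \<omega> \<in> A s} = (\<integral>\<^sup>+\<omega>. path_weight A K r 0 (X 0 \<omega>) \<partial>\<Omega>)"
    using markov_process_path[OF M A, of 0 r] by (auto intro!: nn_integral_cong simp: indicator_def)
  also have "\<dots> = (\<integral>\<^sup>+x. path_weight A K r 0 x \<partial>init)"
    unfolding init[symmetric]
    by (rule nn_integral_distr[symmetric, OF X]) (simp add: measurable_path_weight[OF K A])
  finally show ?thesis .
qed

primrec path_prob :: "(nat \<Rightarrow> 's set) \<Rightarrow> (nat \<Rightarrow> 's \<Rightarrow> 's measure) \<Rightarrow> nat \<Rightarrow> nat \<Rightarrow> 's \<Rightarrow> real" where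
  "path_prob A K 0 t x = indicator (A t) x"
| "path_prob A K (Suc r) t x = indicator (A t) x * (\<integral>y. path_prob A K r (Suc t) y \<partial>K t x)"

lemma path_weight_eq_path_prob:
  assumes K: "\<And>t. K t \<in> S \<rightarrow>\<^sub>M prob_algebra S" and A: "\<And>t. A t \<in> sets S"
  shows "path_prob A K r t \<in> borel_measurable S \<and>
    (\<forall>x\<in>space S. path_weight A K r t x = ennreal (path_prob A K r t x) \<and> 0 \<le> path_prob A K r t x \<and> path_prob A K r t x \<le> 1)"
proof (induction r arbitrary: t)
  case 0
  have "path_prob A K 0 t = indicator (A t)" by (rule ext) simp
  then have "path_prob A K 0 t \<in> borel_measurable S"
    using borel_measurable_indicator[OF A[of t]] by (simp only:)
  moreover have "\<forall>x\<in>space S. path_weight A K 0 t x = ennreal (path_prob A K 0 t x) \<and>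
      0 \<le> path_prob A K 0 t x \<and> path_prob A K 0 t x \<le> 1" by (auto simp: indicator_def)
  ultimately show ?case by (rule conjI)
next
  case (Suc r)
  have IH: "path_prob A K r (Suc t) \<in> borel_measurable S"
    "\<And>x. x \<in> space S \<Longrightarrow> path_weight A K r (Suc t) x = ennreal (path_prob A K r (Suc t) x)"
    "\<And>x. x \<in> space S \<Longrightarrow> 0 \<le> path_prob A K r (Suc t) x"
    "\<And>x. x \<in> space S \<Longrightarrow> path_prob A K r (Suc t) x \<le> 1"
    using Suc.IH[of "Suc t"] by auto
  have "(\<lambda>x. \<integral>y. path_prob A K r (Suc t) y \<partial>K t x) \<in> borel_measurable S"
    by (rule measurable_compose[OF measurable_prob_algebraD[OF K]
          integral_measurable_subprob_algebra[OF IH(1)]])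
  from borel_measurable_times[OF borel_measurable_indicator[OF A[of t]] this]
  have "(\<lambda>x. path_prob A K (Suc r) t x) \<in> borel_measurable S" unfolding path_prob.simps .
  then have meas: "path_prob A K (Suc r) t \<in> borel_measurable S" .
  have "path_weight A K (Suc r) t x = ennreal (path_prob A K (Suc r) t x) \<and>
      0 \<le> path_prob A K (Suc r) t x \<and> path_prob A K (Suc r) t x \<le> 1" if x: "x \<in> space S" for x
  proof -
    have Kx: "prob_space (K t x)" "sets (K t x) = sets S"
      using measurable_space[OF K[of t] x] by (simp_all add: space_prob_algebra)
    note sp = sets_eq_imp_space_eq[OF Kx(2)]
    interpret prob_space "K t x" by (rule Kx)
    have meas': "path_prob A K r (Suc t) \<in> borel_measurable (K t x)"
      using IH(1) measurable_cong_sets[OF Kx(2) refl] by blast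
    have int: "integrable (K t x) (path_prob A K r (Suc t))"
      using IH meas' sp by (intro integrable_const_bound[where B = 1]) (auto intro!: AE_I2)
    have "(\<integral>\<^sup>+y. path_weight A K r (Suc t) y \<partial>K t x) = (\<integral>\<^sup>+y. ennreal (path_prob A K r (Suc t) y) \<partial>K t x)"
      using IH(2) sp by (intro nn_integral_cong) simp
    also have "\<dots> = ennreal (\<integral>y. path_prob A K r (Suc t) y \<partial>K t x)"
      using int IH(3) sp by (intro nn_integral_eq_integral) (auto intro!: AE_I2)
    finally have eq: "(\<integral>\<^sup>+y. path_weight A K r (Suc t) y \<partial>K t x) = ennreal (\<integral>y. path_prob A K r (Suc t) y \<partial>K t x)" .
    moreover have "0 \<le> (\<integral>y. path_prob A K r (Suc t) y \<partial>K t x)"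
      using IH(3) sp by (intro integral_nonneg_AE AE_I2) auto
    moreover have "(\<integral>y. path_prob A K r (Suc t) y \<partial>K t x) \<le> 1"
      using IH(4) sp by (intro integral_le_const[OF int] AE_I2) auto
    ultimately show ?thesis by (auto simp: indicator_def)
  qed
  with meas show ?case by blast
qed

section \<open>Convergence of the correlation functions\<close>

text \<open>\<open>GT_measure\<close> sends negative weights to 0 through \<open>ennreal\<close>;
  \<open>max 0\<close> does the same, so both describe the same measure whenever the former is a
  probability.\<close>

definition sig_pmf :: "nat \<Rightarrow> (int list \<Rightarrow> real) \<Rightarrow> int list pmf" where
  "sig_pmf N p = embed_pmf (\<lambda>\<mu>. if \<mu> \<in> GT_sigs N then max 0 (p \<mu>) else 0)"

lemma emeasure_space_GT_measure:
  "emeasure (GT_measure N p) (space (GT_measure N p)) = (\<integral>\<^sup>+\<mu>. ennreal (p \<mu>) \<partial>count_space (GT_sigs N))"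
  unfolding GT_measure_def point_measure_def
  by (subst emeasure_density) (auto intro!: nn_integral_cong)

lemma pmf_sig_pmf:
  assumes "prob_space (GT_measure N p)"
  shows "pmf (sig_pmf N p) \<mu> = (if \<mu> \<in> GT_sigs N then max 0 (p \<mu>) else 0)"
  unfolding sig_pmf_def
proof (rule pmf_embed_pmf)
  have "(\<integral>\<^sup>+\<mu>. ennreal (if \<mu> \<in> GT_sigs N then max 0 (p \<mu>) else 0) \<partial>count_space UNIV) =
      (\<integral>\<^sup>+\<mu>. ennreal (p \<mu>) * indicator (GT_sigs N) \<mu> \<partial>count_space UNIV)"
    by (intro nn_integral_cong) (auto simp: indicator_def max_def ennreal_neg)
  also have "\<dots> = (\<integral>\<^sup>+\<mu>. ennreal (p \<mu>) \<partial>count_space (GT_sigs N))"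
    by (simp add: nn_integral_count_space_indicator)
  also have "\<dots> = 1"
    using prob_space.emeasure_space_1[OF assms] by (simp add: emeasure_space_GT_measure)
  finally show "(\<integral>\<^sup>+\<mu>. ennreal (if \<mu> \<in> GT_sigs N then max 0 (p \<mu>) else 0) \<partial>count_space UNIV) = 1" .
qed auto

lemma nn_integral_GT_measure:
  assumes "\<And>\<mu>. \<mu> \<in> GT_sigs N \<Longrightarrow> ennreal (p \<mu>) = ennreal (pmf r \<mu>)" "set_pmf r \<subseteq> GT_sigs N"
  shows "(\<integral>\<^sup>+\<mu>. f \<mu> \<partial>GT_measure N p) = (\<integral>\<^sup>+\<mu>. f \<mu> \<partial>measure_pmf r)"
proof -
  have "(\<integral>\<^sup>+\<mu>. f \<mu> \<partial>GT_measure N p) = (\<integral>\<^sup>+\<mu>. ennreal (p \<mu>) * f \<mu> \<partial>count_space (GT_sigs N))"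
    unfolding GT_measure_def point_measure_def by (subst nn_integral_density) auto
  also have "\<dots> = (\<integral>\<^sup>+\<mu>. ennreal (p \<mu>) * f \<mu> * indicator (GT_sigs N) \<mu> \<partial>count_space UNIV)"
    by (simp add: nn_integral_count_space_indicator)
  also have "\<dots> = (\<integral>\<^sup>+\<mu>. ennreal (pmf r \<mu>) * f \<mu> \<partial>count_space UNIV)"
    using assms by (intro nn_integral_cong) (auto simp: indicator_def set_pmf_eq)
  finally show ?thesis by (simp add: nn_integral_measure_pmf)
qed

section \<open>Point configurations read from the bottom coordinates\<close>

lemma cylinder_nth:
  assumes "lam \<in> cylinder u k" "b < k"
  shows "lam ! (length lam - 1 - b) = u b"
proof -
  have lam: "k \<le> length lam" "bottom k lam = trunc u k" using assms(1) by (auto simp: cylinder_def)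
  have "lam ! (length lam - 1 - b) = bottom k lam ! (k - 1 - b)"
    using lam(1) assms(2) by (simp add: nth_bottom)
  also have "\<dots> = u b" unfolding lam(2) using assms(2) by (simp add: nth_trunc)
  finally show ?thesis .
qed

lemma config_GT_alt: "config_GT lam = {lam ! (length lam - 1 - b) + int b | b. b < length lam}"
proof -
  have "\<exists>b<length lam. lam ! i + int (length lam) - 1 - int i = lam ! (length lam - 1 - b) + int b" if "i < length lam" for i
    using that by (intro exI[of _ "length lam - 1 - i"]) auto
  moreover have "\<exists>i<length lam. lam ! (length lam - 1 - b) + int b = lam ! i + int (length lam) - 1 - int i" if "b < length lam" for b
    using that by (intro exI[of _ "length lam - 1 - b"]) auto
  ultimately show ?thesis unfolding config_GT_def by blast
qed

text \<open>A point \<open>x\<close> can only be occupied by the bottom \<open>x - u 0 + 1\<close> coordinates.\<close>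

lemma eventually_config:
  assumes u: "mono u"
  shows "eventually (\<lambda>lam. x \<in> config_GT lam \<longleftrightarrow> x \<in> config_NN u) (cylinders u)"
  unfolding eventually_cylinders
proof (intro exI ballI)
  define k where "k = Suc (nat (x - u 0))"
  fix lam assume lam: "lam \<in> cylinder u k"
  have L: "k \<le> length lam" "lam \<in> GT_sigs (length lam)" using lam by (auto simp: cylinder_def)
  have big: "b < k" if "x = u b + int b" for b
    using monoD[OF u, of 0 b] that by (simp add: k_def)
  have big': "b < k" if "x = lam ! (length lam - 1 - b) + int b" "b < length lam" for b
  proof -
    have "u 0 = lam ! (length lam - 1)" using cylinder_nth[OF lam, of 0] by (simp add: k_def)
    also have "\<dots> \<le> lam ! (length lam - 1 - b)"
      using GT_sigs_nth_mono[OF L(2), of "length lam - 1 - b" "length lam - 1"] that by simp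
    finally show ?thesis using that by (simp add: k_def)
  qed
  show "x \<in> config_GT lam \<longleftrightarrow> x \<in> config_NN u"
  proof
    assume "x \<in> config_GT lam"
    then obtain b where b: "x = lam ! (length lam - 1 - b) + int b" "b < length lam"
      unfolding config_GT_alt by auto
    then have "x = u b + int b" using cylinder_nth[OF lam big'[OF b]] by simp
    then show "x \<in> config_NN u" by (auto simp: config_NN_def)
  next
    assume "x \<in> config_NN u"
    then obtain b where b: "x = u b + int b" by (auto simp: config_NN_def)
    then have "x = lam ! (length lam - 1 - b) + int b" using cylinder_nth[OF lam big[OF b]] by simp
    then show "x \<in> config_GT lam" unfolding config_GT_alt using big[OF b] L by auto
  qed
qed

lemma measurable_config_NN: "{\<nu>\<in>space NN. x \<in> config_NN \<nu>} \<in> sets NN"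
proof -
  have "{\<nu>\<in>space NN. x \<in> config_NN \<nu>} = (\<Union>i. {\<nu>\<in>space NN. \<nu> i = x - int i})"
    by (auto simp: config_NN_def eq_diff_eq)
  then show ?thesis using measurable_coordinate_NN by auto
qed

text \<open>The null measure has mass 0, so a kernel with values in the probability measures never
  takes the default value, and the definite description denotes.\<close>

lemma (in q_parameter) P_inf_prob_imp_is_P_inf:
  assumes "P_inf q g u \<in> space (prob_algebra NN)"
  shows "is_P_inf q g u (P_inf q g u)"
proof -
  have "\<exists>!\<pi>. is_P_inf q g u \<pi>"
  proof (rule ccontr)
    assume "\<not> ?thesis"
    then have "P_inf q g u = null_measure NN" by (simp add: P_inf_def)
    then have "prob_space (null_measure NN)" using assms by (simp add: space_prob_algebra)
    from prob_space.emeasure_space_1[OF this] show False by simp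
  qed
  then show ?thesis using theI'[of "is_P_inf q g u"] by (simp add: P_inf_def)
qed

text \<open>The two sides have the same total mass, so one inequality suffices; this way the negative
  entries that \<open>P_fin\<close> might a priori have do no harm.\<close>

lemma (in q_parameter) mix_eq_bind_sig_pmf:
  assumes \<pi>: "is_P_inf q g u \<pi>" and u: "mono u" and N: "N \<ge> 1"
    and P: "\<And>lam. lam \<in> GT_sigs N \<Longrightarrow> prob_space (GT_measure N (P_fin q N g lam))"
  shows "mix \<pi> N = bind_pmf (bdry u N) (\<lambda>lam. sig_pmf (length lam) (P_fin q (length lam) g lam))"
    (is "_ = bind_pmf _ ?A")
proof (rule pmf_eqI_le)
  fix \<mu>
  have \<pi>': "\<pi> \<in> space (prob_algebra NN)" using \<pi> by (simp add: is_P_inf_def)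
  show "pmf (mix \<pi> N) \<mu> \<le> pmf (bind_pmf (bdry u N) ?A) \<mu>"
  proof (cases "\<mu> \<in> GT_sigs N")
    case False
    then have "pmf (mix \<pi> N) \<mu> = 0" using set_mix[OF \<pi>', of N] by (auto simp: set_pmf_eq)
    then show ?thesis by simp
  next
    case True
    let ?f = "\<lambda>lam. Ecal q u N lam * P_fin q N g lam \<mu>"
    let ?b = "pmf (bind_pmf (bdry u N) ?A) \<mu>"
    have fin: "sum ?f F \<le> ?b" if F: "finite F" "F \<subseteq> GT_sigs N" for F
    proof -
      have "sum ?f F \<le> (\<Sum>lam\<in>F. pmf (?A lam) \<mu> * pmf (bdry u N) lam)"
        using F True
        by (intro sum_mono)
           (auto simp: GT_sigs_length pmf_sig_pmf[OF P] subset_eq pmf_bdry[OF u] mult.commute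
              intro!: mult_left_mono Ecal_nonneg[OF u])
      also have "\<dots> = expect (bdry u N) (\<lambda>lam. indicator F lam * pmf (?A lam) \<mu>)"
        using F by (subst integral_measure_pmf_real[of F]) (auto intro!: sum.cong simp: indicator_def split: if_splits)
      also have "\<dots> \<le> expect (bdry u N) (\<lambda>lam. pmf (?A lam) \<mu>)"
        by (rule expect_mono[where C = 1 and D = 1]) (auto simp: indicator_def pmf_le_1)
      finally show ?thesis by (simp add: pmf_bind)
    qed
    have "pmf (mix \<pi> N) \<mu> = (\<Sum>\<^sub>\<infinity>lam\<in>GT_sigs N. ?f lam)"
      using \<pi> True by (simp add: pmf_mix[OF \<pi>'] is_P_inf_def)
    also have "\<dots> \<le> ?b"
    \<comment> \<open>Without summability the infinite sum is 0 by convention, and the bound is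
      trivial.\<close>
    proof (cases "?f summable_on GT_sigs N")
      case True
      then show ?thesis by (rule infsum_le_finite_sums) (rule fin)
    qed (simp add: infsum_not_exists)
    finally show ?thesis .
  qed
qed

text \<open>The conditions are sorted by time. Times at which no point is prescribed impose nothing,
  so the event is a path event up to the largest prescribed time.\<close>

lemma correlation_eq_path:
  assumes n: "n \<ge> 1" and M: "markov_process \<Omega> S init K X"
    and A: "\<And>s. A s = {y\<in>space S. \<forall>j\<in>{1..n}. t j = s \<longrightarrow> x j \<in> conf y}" "\<And>s. A s \<in> sets S"
  shows "correlation \<Omega> conf X n x t = enn2real (\<integral>\<^sup>+y. path_weight A K (Max (t ` {1..n})) 0 y \<partial>init)"
proof -
  have "X s \<in> \<Omega> \<rightarrow>\<^sub>M S" for s using M by (simp add: markov_process_def)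
  note X = measurable_space[OF this]
  have le: "t j \<le> Max (t ` {1..n})" if "j \<in> {1..n}" for j using that by (intro Max_ge) auto
  have "{\<omega>\<in>space \<Omega>. \<forall>j\<in>{1..n}. x j \<in> conf (X (t j) \<omega>)} =
      {\<omega>\<in>space \<Omega>. \<forall>s\<le>Max (t ` {1..n}). X s \<omega> \<in> A s}"
    using X le by (auto simp: A(1))
  then show ?thesis
    unfolding correlation_def measure_def by (simp only: markov_process_path_init[OF M A(2)])
qed

theorem theorem5p4:
  fixes q :: real
    and g :: "nat \<Rightarrow> complex \<Rightarrow> complex"
    and Z0 :: "(nat \<Rightarrow> int) measure"
    and \<Omega>N :: "nat \<Rightarrow> 'a measure" and ZN :: "nat \<Rightarrow> nat \<Rightarrow> 'a \<Rightarrow> int list"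
    and \<Omega> :: "'b measure" and Z :: "nat \<Rightarrow> 'b \<Rightarrow> nat \<Rightarrow> int"
    and n :: nat and x :: "nat \<Rightarrow> int" and t :: "nat \<Rightarrow> nat"
  assumes "0 < q" and "q < 1"
    and "\<And>s. admissible (g s)"
    and "Z0 \<in> space (prob_algebra NN)"
    and "\<And>N. N \<ge> 1 \<Longrightarrow>
           markov_process (\<Omega>N N) (count_space (GT_sigs N)) (GT_measure N (E_q q Z0 N))
             (\<lambda>s lam. GT_measure N (P_fin q N (g s) lam)) (ZN N)"
    and "markov_process \<Omega> NN Z0 (\<lambda>s. P_inf q (g s)) Z"
    and "n \<ge> 1"
    and "inj_on (\<lambda>j. (x j, t j)) {1..n}"
  shows "(\<lambda>N. correlation (\<Omega>N N) config_GT (ZN N) n x t)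
           \<longlonglongrightarrow> correlation \<Omega> config_NN Z n x t"
proof -
  interpret q_parameter q using assms(1,2) by unfold_locales
  note Z0 = assms(4) and MN = assms(5) and M = assms(6)
  \<comment> \<open>One kernel for all levels: it reads the level off the length, since the filter
    \<open>cylinders\<close> mixes lengths.\<close>
  define A where "A s lam = sig_pmf (length lam) (P_fin q (length lam) (g s) lam)" for s lam
  define C where "C s = {lam. \<forall>j\<in>{1..n}. t j = s \<longrightarrow> x j \<in> config_GT lam}" for s
  define C' where "C' s = {\<nu>\<in>space NN. \<forall>j\<in>{1..n}. t j = s \<longrightarrow> x j \<in> config_NN \<nu>}" for s
  define T where "T = Max (t ` {1..n})"
  let ?K = "\<lambda>s. P_inf q (g s)" and ?KA = "\<lambda>s lam. measure_pmf (A s lam)"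
  let ?KN = "\<lambda>N s lam. GT_measure N (P_fin q N (g s) lam)"
  have K: "?K s \<in> NN \<rightarrow>\<^sub>M prob_algebra NN" for s using M by (simp add: markov_process_def)
  have K_prob: "?K s u \<in> space (prob_algebra NN)" if "mono u" for s u
    using measurable_space[OF K[of s], of u] that by (simp add: space_NN)
  have KN: "?KN N s \<in> count_space (GT_sigs N) \<rightarrow>\<^sub>M prob_algebra (count_space (GT_sigs N))" if "N \<ge> 1" for N s
    using MN[OF that] by (simp add: markov_process_def)
  have P_prob: "prob_space (?KN N s lam)" if "N \<ge> 1" "lam \<in> GT_sigs N" for N s lam
    using measurable_space[OF KN[OF that(1), of s], of lam] that by (simp add: space_prob_algebra)
  have pmf_A: "pmf (A s lam) \<mu> = (if \<mu> \<in> GT_sigs N then max 0 (P_fin q N (g s) lam \<mu>) else 0)"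
    if "N \<ge> 1" "lam \<in> GT_sigs N" for s lam \<mu> N
    using pmf_sig_pmf[OF P_prob[OF that]] GT_sigs_length[OF that(2)] by (simp add: A_def)
  have set_A: "set_pmf (A s lam) \<subseteq> GT_sigs N" if "N \<ge> 1" "lam \<in> GT_sigs N" for s lam N
    by (auto simp: set_pmf_eq pmf_A[OF that] split: if_splits)
  have kernel: "boundary_kernel q (A s) (?K s)" for s
  proof unfold_locales
    show "mix (?K s u) N = bind_pmf (bdry u N) (A s)" if "mono u" "N \<ge> 1" for u N
      unfolding A_def
      using mix_eq_bind_sig_pmf[OF P_inf_prob_imp_is_P_inf[OF K_prob[OF that(1)]] that P_prob] that by simp
  qed (use set_A K_prob in auto)
  have C'_sets: "C' s \<in> sets NN" for s
  proof -
    have "C' s = {\<nu>\<in>space NN. \<forall>j\<in>{j\<in>{1..n}. t j = s}. x j \<in> config_NN \<nu>}" by (auto simp: C'_def)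
    also have "\<dots> \<in> sets NN" by (intro sets.sets_Collect_finite_All measurable_config_NN) auto
    finally show ?thesis .
  qed
  have KA: "?KA s \<in> count_space UNIV \<rightarrow>\<^sub>M prob_algebra (count_space UNIV)" for s
    by (auto simp: space_prob_algebra measure_pmf.prob_space_axioms)
  have KA_eq: "path_weight C ?KA r s lam = ennreal (path_prob C ?KA r s lam)" "0 \<le> path_prob C ?KA r s lam" for r s lam
    using path_weight_eq_path_prob[of ?KA "count_space UNIV" C, OF KA] by auto
  note K_eq = path_weight_eq_path_prob[of ?K NN C', OF K C'_sets]
  have bounds: "\<bar>path_prob C ?KA r s lam\<bar> \<le> 1" for r s lam
    using path_weight_eq_path_prob[of ?KA "count_space UNIV" C, OF KA] by auto
  \<comment> \<open>All starting times and boundary points are treated together. The indicator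
    factors are eventually constant along the filter, and the integral factor is a case of
    \<open>kernel_tendsto\<close>.\<close>
  have lim: "(path_prob C ?KA r s \<longlongrightarrow> path_prob C' ?K r s u) (cylinders u)" if "mono u" for r s u
    using that
  proof (induction r arbitrary: s u)
    case 0
    have "eventually (\<lambda>lam. \<forall>j\<in>{1..n}. x j \<in> config_GT lam \<longleftrightarrow> x j \<in> config_NN u) (cylinders u)"
      by (intro eventually_ball_finite ballI eventually_config 0) auto
    then have "eventually (\<lambda>lam. path_prob C ?KA 0 s lam = path_prob C' ?K 0 s u) (cylinders u)"
      by eventually_elim (use 0 in \<open>auto simp: C_def C'_def indicator_def space_NN\<close>)
    then show ?case by (rule tendsto_eventually)
  next
    case (Suc r)
    have "eventually (\<lambda>lam. \<forall>j\<in>{1..n}. x j \<in> config_GT lam \<longleftrightarrow> x j \<in> config_NN u) (cylinders u)"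
      by (intro eventually_ball_finite ballI eventually_config Suc.prems) auto
    then have "eventually (\<lambda>lam. (indicator (C s) lam :: real) = indicator (C' s) u) (cylinders u)"
      by eventually_elim (use Suc.prems in \<open>auto simp: C_def C'_def indicator_def space_NN\<close>)
    then have "((\<lambda>lam. indicator (C s) lam :: real) \<longlongrightarrow> indicator (C' s) u) (cylinders u)"
      by (rule tendsto_eventually)
    moreover have "((\<lambda>lam. expect (A s lam) (path_prob C ?KA r (Suc s))) \<longlongrightarrow>
        (\<integral>\<nu>. path_prob C' ?K r (Suc s) \<nu> \<partial>?K s u)) (cylinders u)"
      by (rule boundary_kernel.kernel_tendsto[OF kernel bounds Suc.IH Suc.prems])
    ultimately have "((\<lambda>lam. path_prob C ?KA (Suc r) s lam) \<longlongrightarrow> path_prob C' ?K (Suc r) s u) (cylinders u)"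
      unfolding path_prob.simps by (rule tendsto_mult)
    then show ?case .
  qed
  have corr_N: "correlation (\<Omega>N N) config_GT (ZN N) n x t = expect (mix Z0 N) (path_prob C ?KA T 0)" if N: "N \<ge> 1" for N
  proof -
    define CN where "CN s = {y\<in>space (count_space (GT_sigs N)). \<forall>j\<in>{1..n}. t j = s \<longrightarrow> x j \<in> config_GT y}" for s
    \<comment> \<open>Transfers the chain living on \<open>GT_sigs N\<close> to the kernel that is
      common to all levels, so that its path probabilities are values of one function independent of
      \<open>N\<close>.\<close>
    have eq: "path_weight CN (?KN N) r s lam = ennreal (path_prob C ?KA r s lam)" if "lam \<in> GT_sigs N" for r s lam
      using that
    proof (induction r arbitrary: s lam)
      case 0
      then show ?case by (auto simp: CN_def C_def indicator_def)
    next
      case (Suc r)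
      have "(\<integral>\<^sup>+y. path_weight CN (?KN N) r (Suc s) y \<partial>?KN N s lam) =
          (\<integral>\<^sup>+y. path_weight CN (?KN N) r (Suc s) y \<partial>?KA s lam)"
      proof (rule nn_integral_GT_measure[OF _ set_A[OF N Suc.prems]])
        show "ennreal (P_fin q N (g s) lam \<mu>) = ennreal (pmf (A s lam) \<mu>)" if "\<mu> \<in> GT_sigs N" for \<mu>
          using that by (simp add: pmf_A[OF N Suc.prems] max_def ennreal_neg)
      qed
      also have "\<dots> = (\<integral>\<^sup>+y. ennreal (path_prob C ?KA r (Suc s) y) \<partial>?KA s lam)"
        using set_A[OF N Suc.prems] Suc.IH by (intro nn_integral_cong_AE AE_pmfI) auto
      also have "\<dots> = (\<integral>\<^sup>+y. path_weight C ?KA r (Suc s) y \<partial>?KA s lam)"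
        by (simp only: KA_eq)
      finally have "path_weight CN (?KN N) (Suc r) s lam = path_weight C ?KA (Suc r) s lam"
        using Suc.prems by (auto simp: CN_def C_def indicator_def)
      then show ?case by (rule trans[OF _ KA_eq(1)])
    qed
    have "correlation (\<Omega>N N) config_GT (ZN N) n x t =
        enn2real (\<integral>\<^sup>+y. path_weight CN (?KN N) T 0 y \<partial>GT_measure N (E_q q Z0 N))"
      unfolding T_def by (rule correlation_eq_path[OF assms(7) MN[OF N] CN_def]) (auto simp: CN_def)
    also have "(\<integral>\<^sup>+y. path_weight CN (?KN N) T 0 y \<partial>GT_measure N (E_q q Z0 N)) =
        (\<integral>\<^sup>+y. path_weight CN (?KN N) T 0 y \<partial>measure_pmf (mix Z0 N))"
      by (rule nn_integral_GT_measure[OF _ set_mix[OF Z0]]) (simp add: pmf_mix[OF Z0])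
    also have "\<dots> = (\<integral>\<^sup>+y. ennreal (path_prob C ?KA T 0 y) \<partial>measure_pmf (mix Z0 N))"
      by (intro nn_integral_cong_AE AE_pmfI eq) (rule subsetD[OF set_mix[OF Z0]])
    also have "enn2real \<dots> = expect (mix Z0 N) (path_prob C ?KA T 0)"
      by (intro integral_eq_nn_integral[symmetric]) (auto simp: KA_eq)
    finally show ?thesis .
  qed
  have "correlation \<Omega> config_NN Z n x t = enn2real (\<integral>\<^sup>+\<nu>. path_weight C' ?K T 0 \<nu> \<partial>Z0)"
    unfolding T_def by (rule correlation_eq_path[OF assms(7) M C'_def C'_sets])
  also have "(\<integral>\<^sup>+\<nu>. path_weight C' ?K T 0 \<nu> \<partial>Z0) = (\<integral>\<^sup>+\<nu>. ennreal (path_prob C' ?K T 0 \<nu>) \<partial>Z0)"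
    using K_eq prob_algebra_NN(3)[OF Z0]
    by (intro nn_integral_cong) (auto simp: space_NN)
  also have "enn2real \<dots> = (\<integral>\<nu>. path_prob C' ?K T 0 \<nu> \<partial>Z0)"
  proof (rule integral_eq_nn_integral[symmetric])
    show "path_prob C' ?K T 0 \<in> borel_measurable Z0"
      using K_eq measurable_cong_sets[OF prob_algebra_NN(2)[OF Z0] refl] by blast
    show "AE \<nu> in Z0. 0 \<le> path_prob C' ?K T 0 \<nu>"
      using K_eq prob_algebra_NN(3)[OF Z0] by (intro AE_I2) (auto simp: space_NN)
  qed
  finally have corr: "correlation \<Omega> config_NN Z n x t = (\<integral>\<nu>. path_prob C' ?K T 0 \<nu> \<partial>Z0)" .
  have "(\<lambda>N. expect (mix Z0 N) (path_prob C ?KA T 0)) \<longlonglongrightarrow> correlation \<Omega> config_NN Z n x t"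
    unfolding corr by (rule mix_tendsto[OF Z0 bounds lim])
  \<comment> \<open>The chains are given from level 1 on, so the correlation functions agree with
    the expectations eventually.\<close>
  then show ?thesis
    by (rule Lim_transform_eventually) (use corr_N in \<open>auto simp: eventually_sequentially intro!: exI[of _ 1]\<close>)
qed

end
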